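(* Let $R>0$, $s\ge2$ an integer, $\bar\alpha>0$, and suppose $\mathrm e^{-A}\lesssim\Delta^2$ and $\Delta\|\delta\|_{l^2}^2\lesssim\|\delta\|_{l^\infty}^2$. Let $\mathcal P=(\gamma,k)\in\mathcal G_s(R,\bar\alpha)$ and $\alpha=k(0+)+k(0-)\in[0,\bar\alpha]$. Additionally let $(\varepsilon_j)$ be uniformly sub-Gaussian, i.e. there are constants $C_1,C_2\in(0,\infty)$ such that for all $t,N>0$ and $a_1,\dots,a_N\in\mathbb R$ $$\mathbb P\Big(\Big|\sum_{j=1}^Na_j\varepsilon_j\Big|\ge t\Big)\le C_1\exp\Big(-C_2\frac{t^2}{\sum_{j=1}^Na_j^2}\Big).$$ Then there is a constant $c>0$ and for all $\kappa>0$ there is an $\varepsilon_0\sim\kappa^{(2s+2T\bar\alpha+1)/(2s-2)}$ such that for all $\varepsilon<\varepsilon_0\wedge1$ the estimator $\hat\alpha_0$ satisfies $$\mathbb P\big(|\hat\alpha_0-\alpha|\ge\kappa\big)\le\big((7N+1)C_1+2\big)\exp\Big(-c\,(\kappa^2\wedge\kappa^{1/2})\,\varepsilon^{-(s-1)/(2s+2T\bar\alpha+1)}\Big).$$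
   Context: **Model.** Fix a maturity $T>0$. A pair $\mathcal P=(\gamma,k)$, with $\gamma\in\mathbb R$ and $k:\mathbb R\to[0,\infty)$ of bounded variation, determines a Lévy process $X$ with triplet $(0,\gamma,k(x)/|x|)$ (no Gaussian part, Lévy density $k(x)/|x|$), so that $\varphi_T(u)=\mathbb E[\mathrm e^{\mathrm iuX_T}]=\exp(T(\mathrm i\gamma u+\int(\mathrm e^{\mathrm iux}-1)\frac{k(x)}{|x|}\mathrm dx))$. The martingale condition is $\gamma+\int(\mathrm e^x-1)\frac{k(x)}{|x|}\mathrm dx=0$ (equivalently $\mathbb E[\mathrm e^{X_t}]=1$ for all $t\geq 0$). Put $k_e(x):=\operatorname{sgn}(x)\mathrm e^xk(x)$, $\|k\|_{\mathrm{TV}}$ the total variation of $k$ on $\mathbb R$. **Classes.** $\mathcal G_0(R,\bar\alpha)$: all $(\gamma,k)$ with $k$ of bounded variation, the martingale condition, $\mathbb E[\mathrm e^{2X_T}]\le R$, $\alpha=k(0+)+k(0-)\in[0,\bar\alpha]$ and $\max\{\sup_{x\in(0,1]}\frac{k(x)+k(-x)-\alpha}{x},\|k_e\|_{L^1},\|k\|_{\mathrm{TV}}\}\le R$. $\mathcal G_s(R,\bar\alpha)$: all $(\gamma,k)\in\mathcal G_0(R,\bar\alpha)$ such that in addition $k\in C^s(\mathbb R\setminus\{0\})$, all derivatives have finite one-sided limits at $0$, $|k^{(l)}(0+)+k^{(l)}(0-)|\le R$ for $l=1,\dots,s-1$, and $\|(1\vee\mathrm e^x)k^{(l)}(x)\|_{L^1}\le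 R$ for $l=0,\dots,s$. **Observations.** The option function is $\mathcal O(x)=\mathbb E[(\mathrm e^{X_T}-\mathrm e^x)_+]$ for $x\ge0$ and $\mathcal O(x)=\mathbb E[(\mathrm e^x-\mathrm e^{X_T})_+]$ for $x<0$. One observes $O_j=\mathcal O(x_j)+\delta_j\varepsilon_j$, $j=1,\dots,N$, at deterministic points $x_1<\dots<x_N$, with known noise levels $\delta_j>0$ and independent centered $\varepsilon_j$ with $\mathbb E[\varepsilon_j^2]=1$, $\sup_j\mathbb E[\varepsilon_j^4]<\infty$. Set $\delta=(\delta_j)_j$, $\Delta:=\max_{j=2,\dots,N}(x_j-x_{j-1})$, $A:=\min(x_N,-x_1)$ and $\varepsilon:=\Delta^{3/2}+\Delta^{1/2}\|\delta\|_{l^\infty}$. The general asymptotic setting is $\Delta\to0$, $A\to\infty$. $a\lesssim b$ means $a\le Cb$ with a constant $C$ independent of the design, the noise levels and $N$; $a\sim b$ means $a\lesssim b$ and $b\lesssim a$. The constant $c$ and the constants implicit in $\varepsilon_0\sim\kappa^{(2s+2T\bar\alpha+1)/(2s-2)}$ do not depend on $\kappa,\varepsilon,N$. $a\wedge b:=\min\{a,b\}$. **Interpolation.** $\tilde{\mathcal O}(x)=\beta_0(x)+\sum_{j=1}^NO_jb_j(x)$, where $b_j(x)=\frac{x-x_{j-1}}{x_j-x_{j-1}}\mathbf 1_{[x_{j-1},x_j)}(x)+\frac{x_{j+1}-x}{x_{j+1}-x_j}\mathbf 1_{[x_j,x_{j+1}]}(x)$, with auxiliary nodes $x_0<x_1$,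 $x_{N+1}>x_N$ at distance at most $\Delta$ from $x_1$, resp. $x_N$. With $j_0$ such that $x_{j_0-1}<0\le x_{j_0}$, $\beta_0$ is the continuous function supported in $[x_{j_0-1},x_{j_0}]$, linear on $[x_{j_0-1},0]$ and on $[0,x_{j_0}]$, with $\beta_0'(0+)-\beta_0'(0-)=-1$ ($\beta_0=0$ if $x_{j_0}=0$). The Fourier transform is $\mathcal Ff(u)=\int\mathrm e^{\mathrm iux}f(x)\mathrm dx$. **Estimator.** For $\eta>0$, $v_\eta(z)=z$ if $|z|\ge\eta$ and $v_\eta(z)=\eta z/|z|$ if $0<|z|<\eta$. With the cut-off $U=U_{\bar\alpha}:=\varepsilon^{-2/(2s+2T\bar\alpha+1)}$ set $$\tilde\psi(u):=\frac1T\log\big(v_{\kappa_{\bar\alpha}(u)}(1+\mathrm iu(1+\mathrm iu)\mathcal F\tilde{\mathcal O}(u))\big),\ u\in[-U,U],\qquad \hat\alpha_0:=\int_{-U}^U\operatorname{Re}(\tilde\psi(u))\,w_{\alpha_0}^U(u)\,\mathrm du,$$ with the distinguished logarithm (its imaginary part is the continuous version in $u$ of the argument of $1+\mathrm iu(1+\mathrm iu)\mathcal F\tilde{\mathcal O}(u)$ vanishing at $u=0$); if $1+\mathrm iu(1+\mathrm iu)\mathcal F\tilde{\mathcal O}(u)$ vanishes somewhere on $[-U,U]$, put $\tilde\psi:=0$. The trimming function (not to be confused with the threshold $\kappa$) is $\kappa_{\bar\alpha}(u)=\frac13\mathrm e^{-TR}$ for $|u|<1$ and $\kappa_{\bar\alpha}(u)=\frac13C_\varphi(T,R)|u|^{-T\bar\alpha}$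 for $|u|\ge1$, where $C_\varphi(T,R)>0$ is a constant depending only on $T,R$ such that $|\varphi_T(u-\mathrm i)|\ge C_\varphi(T,R)|u|^{-T\bar\alpha}$ for all $|u|\ge1$ and all $\mathcal P\in\mathcal G_0(R,\bar\alpha)$ (such a constant exists). The real weight function $w_{\alpha_0}^U$, supported on $[-U,U]$, satisfies $\int_{-U}^U\log(|u|)w_{\alpha_0}^U(u)\mathrm du=-1$, $\int_{-U}^Uu^{-j}w_{\alpha_0}^U(u)\mathrm du=0$ for all even $j\in\{1,\dots,s-2\}$, $\int_0^Uw_{\alpha_0}^U(\pm u)\mathrm du=0$, $u\mapsto u^{-s+1}w_{\alpha_0}^1(u)$ is continuous and bounded, and $|w_{\alpha_0}^U(u)|\lesssim U^{-s}|u|^{s-1}$ with a constant independent of $U$ and $u$. *)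

theory Defs
  imports "HOL-Probability.Probability"
begin

section \<open>Exponential Levy models\<close>

definition total_variation :: "(real \<Rightarrow> real) \<Rightarrow> ennreal" where
  "total_variation f =
     (SUP xs \<in> {xs. sorted xs}. \<Sum>i<length xs - 1. ennreal \<bar>f (xs ! Suc i) - f (xs ! i)\<bar>)"

definition L1_norm :: "(real \<Rightarrow> real) \<Rightarrow> ennreal" where
  "L1_norm f = (\<integral>\<^sup>+x. ennreal \<bar>f x\<bar> \<partial>lborel)"

definition levy_exponent :: "real \<Rightarrow> (real \<Rightarrow> real) \<Rightarrow> real \<Rightarrow> complex" where
  "levy_exponent \<gamma> k u =
     \<i> * of_real \<gamma> * of_real u
     + (LINT x|lborel. (iexp (u * x) - 1) * of_real (k x / \<bar>x\<bar>))"

text \<open>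
  The triplet $(0,\gamma,k(x)/|x|)$ is understood with respect to the zero truncation function:
  the characteristic exponent is \<^const>\<open>levy_exponent\<close>.
\<close>

definition levy_process ::
    "'b measure \<Rightarrow> (real \<Rightarrow> 'b \<Rightarrow> real) \<Rightarrow> real \<Rightarrow> (real \<Rightarrow> real) \<Rightarrow> bool" where
  "levy_process Q X \<gamma> k \<longleftrightarrow>
     prob_space Q \<and>
     (\<forall>t\<ge>0. X t \<in> borel_measurable Q) \<and>
     (AE \<omega> in Q. X 0 \<omega> = 0) \<and>
     (\<forall>n (t :: nat \<Rightarrow> real). 0 \<le> t 0 \<and> (\<forall>i<n. t i \<le> t (Suc i)) \<longrightarrow>
        prob_space.indep_vars Q (\<lambda>_. borel) (\<lambda>i \<omega>. X (t (Suc i)) \<omega> - X (t i) \<omega>) {..<n}) \<and>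
     (\<forall>r t. 0 \<le> r \<and> r \<le> t \<longrightarrow>
        distr Q borel (\<lambda>\<omega>. X t \<omega> - X r \<omega>) = distr Q borel (X (t - r))) \<and>
     (AE \<omega> in Q. \<forall>t\<ge>0. continuous (at_right t) (\<lambda>r. X r \<omega>) \<and>
        (t > 0 \<longrightarrow> (\<exists>l. ((\<lambda>r. X r \<omega>) \<longlongrightarrow> l) (at_left t)))) \<and>
     (\<forall>t\<ge>0. \<forall>u. char (distr Q borel (X t)) u = exp (of_real t * levy_exponent \<gamma> k u))"

text \<open>
  The distribution of $X_t$ for the Levy process determined by $(\gamma,k)$; it is unique since
  characteristic functions determine distributions.
\<close>

definition levy_law :: "real \<Rightarrow> real \<Rightarrow> (real \<Rightarrow> real) \<Rightarrow> real measure" where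
  "levy_law t \<gamma> k =
     (THE \<mu>. real_distribution \<mu> \<and> (\<forall>u. char \<mu> u = exp (of_real t * levy_exponent \<gamma> k u)))"

definition levy_cf :: "real \<Rightarrow> real \<Rightarrow> (real \<Rightarrow> real) \<Rightarrow> complex \<Rightarrow> complex" where
  "levy_cf t \<gamma> k z = (LINT x|levy_law t \<gamma> k. exp (\<i> * z * of_real x))"

text \<open>
  For nonnegative $k$ of bounded variation, the integrability required here entails that
  $\min(1,|x|)\,k(x)/|x|$ is integrable, so that $k(x)/|x|$ is a Levy density and
  the integral in \<^const>\<open>levy_exponent\<close> converges.
\<close>

definition martingale_condition :: "real \<Rightarrow> (real \<Rightarrow> real) \<Rightarrow> bool" where
  "martingale_condition \<gamma> k \<longleftrightarrow>
     integrable lborel (\<lambda>x. (exp x - 1) * (k x / \<bar>x\<bar>)) \<and>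
     \<gamma> + (LINT x|lborel. (exp x - 1) * (k x / \<bar>x\<bar>)) = 0"

definition jump_sum :: "(real \<Rightarrow> real) \<Rightarrow> real" where
  "jump_sum f = Lim (at_right 0) f + Lim (at_left 0) f"

definition class_G0 :: "real \<Rightarrow> real \<Rightarrow> real \<Rightarrow> (real \<times> (real \<Rightarrow> real)) set" where
  "class_G0 T R \<alpha>bar = {(\<gamma>, k).
     (\<forall>x. 0 \<le> k x) \<and>
     total_variation k < \<infinity> \<and>
     martingale_condition \<gamma> k \<and>
     (\<integral>\<^sup>+x. ennreal (exp (2 * x)) \<partial>levy_law T \<gamma> k) \<le> ennreal R \<and>
     0 \<le> jump_sum k \<and> jump_sum k \<le> \<alpha>bar \<and>
     (\<forall>x\<in>{0<..1}. (k x + k (- x) - jump_sum k) / x \<le> R) \<and>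
     L1_norm (\<lambda>x. sgn x * exp x * k x) \<le> ennreal R \<and>
     total_variation k \<le> ennreal R}"

definition class_Gs :: "nat \<Rightarrow> real \<Rightarrow> real \<Rightarrow> real \<Rightarrow> (real \<times> (real \<Rightarrow> real)) set" where
  "class_Gs s T R \<alpha>bar = {(\<gamma>, k).
     (\<gamma>, k) \<in> class_G0 T R \<alpha>bar \<and>
     (\<forall>l<s. \<forall>x. x \<noteq> 0 \<longrightarrow> (deriv ^^ l) k differentiable (at x)) \<and>
     continuous_on (- {0}) ((deriv ^^ s) k) \<and>
     (\<forall>l\<le>s. (\<exists>L. ((deriv ^^ l) k \<longlongrightarrow> L) (at_right 0)) \<and>
             (\<exists>L. ((deriv ^^ l) k \<longlongrightarrow> L) (at_left 0))) \<and>
     (\<forall>l\<in>{1..s - 1}. \<bar>jump_sum ((deriv ^^ l) k)\<bar> \<le> R) \<and>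
     (\<forall>l\<le>s. L1_norm (\<lambda>x. max 1 (exp x) * (deriv ^^ l) k x) \<le> ennreal R)}"


section \<open>Observations\<close>

definition option_fun :: "'b measure \<Rightarrow> ('b \<Rightarrow> real) \<Rightarrow> real \<Rightarrow> real" where
  "option_fun Q Y x =
     (if 0 \<le> x then (LINT \<omega>|Q. max (exp (Y \<omega>) - exp x) 0)
      else (LINT \<omega>|Q. max (exp x - exp (Y \<omega>)) 0))"

definition mesh :: "nat \<Rightarrow> (nat \<Rightarrow> real) \<Rightarrow> real" where
  "mesh N x = Max ((\<lambda>j. x j - x (j - 1)) ` {2..N})"

definition range_param :: "nat \<Rightarrow> (nat \<Rightarrow> real) \<Rightarrow> real" where
  "range_param N x = min (x N) (- x 1)"

definition linf_norm :: "nat \<Rightarrow> (nat \<Rightarrow> real) \<Rightarrow> real" where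
  "linf_norm N \<delta> = Max ((\<lambda>j. \<bar>\<delta> j\<bar>) ` {1..N})"

definition l2_norm :: "nat \<Rightarrow> (nat \<Rightarrow> real) \<Rightarrow> real" where
  "l2_norm N \<delta> = sqrt (\<Sum>j=1..N. (\<delta> j)\<^sup>2)"

definition noise_level :: "nat \<Rightarrow> (nat \<Rightarrow> real) \<Rightarrow> (nat \<Rightarrow> real) \<Rightarrow> real" where
  "noise_level N x \<delta> = mesh N x powr (3/2) + mesh N x powr (1/2) * linf_norm N \<delta>"

text \<open>
  The design points are $x_1,\dots,x_N$; the values $x_0$ and $x_{N+1}$ are the auxiliary nodes.
  The last condition on $x$ is what makes the index $j_0$ in \<open>node_index\<close> exist.
\<close>

definition design :: "nat \<Rightarrow> (nat \<Rightarrow> real) \<Rightarrow> (nat \<Rightarrow> real) \<Rightarrow> bool" where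
  "design N x \<delta> \<longleftrightarrow>
     2 \<le> N \<and>
     (\<forall>j\<le>N. x j < x (Suc j)) \<and>
     x 1 - x 0 \<le> mesh N x \<and> x (N + 1) - x N \<le> mesh N x \<and>
     x 0 < 0 \<and> 0 \<le> x (N + 1) \<and>
     (\<forall>j\<in>{1..N}. 0 < \<delta> j)"

definition noise_model :: "'a measure \<Rightarrow> (nat \<Rightarrow> 'a \<Rightarrow> real) \<Rightarrow> bool" where
  "noise_model M e \<longleftrightarrow>
     prob_space M \<and>
     prob_space.indep_vars M (\<lambda>_. borel) e {1..} \<and>
     (\<forall>j\<ge>1. integrable M (e j) \<and> (LINT \<omega>|M. e j \<omega>) = 0) \<and>
     (\<forall>j\<ge>1. integrable M (\<lambda>\<omega>. (e j \<omega>)\<^sup>2) \<and> (LINT \<omega>|M. (e j \<omega>)\<^sup>2) = 1) \<and>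
     (\<exists>K. \<forall>j\<ge>1. integrable M (\<lambda>\<omega>. (e j \<omega>) ^ 4) \<and> (LINT \<omega>|M. (e j \<omega>) ^ 4) \<le> K)"

definition uniformly_subgaussian ::
    "'a measure \<Rightarrow> (nat \<Rightarrow> 'a \<Rightarrow> real) \<Rightarrow> real \<Rightarrow> real \<Rightarrow> bool" where
  "uniformly_subgaussian M e C1 C2 \<longleftrightarrow>
     (\<forall>t>0. \<forall>N>0. \<forall>a :: nat \<Rightarrow> real.
        measure M {\<omega> \<in> space M. \<bar>\<Sum>j=1..N. a j * e j \<omega>\<bar> \<ge> t}
          \<le> C1 * exp (- C2 * (t\<^sup>2 / (\<Sum>j=1..N. (a j)\<^sup>2))))"

definition observation ::
    "(real \<Rightarrow> real) \<Rightarrow> (nat \<Rightarrow> real) \<Rightarrow> (nat \<Rightarrow> real) \<Rightarrow> (nat \<Rightarrow> 'a \<Rightarrow> real) \<Rightarrow> 'a \<Rightarrow> nat \<Rightarrow> real" where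
  "observation Of x \<delta> e \<omega> j = Of (x j) + \<delta> j * e j \<omega>"


section \<open>Interpolation\<close>

definition hat_fun :: "(nat \<Rightarrow> real) \<Rightarrow> nat \<Rightarrow> real \<Rightarrow> real" where
  "hat_fun x j y =
     (y - x (j - 1)) / (x j - x (j - 1)) * indicator {x (j - 1)..<x j} y
     + (x (j + 1) - y) / (x (j + 1) - x j) * indicator {x j..x (j + 1)} y"

definition node_index :: "nat \<Rightarrow> (nat \<Rightarrow> real) \<Rightarrow> nat" where
  "node_index N x = (THE j. 1 \<le> j \<and> j \<le> N + 1 \<and> x (j - 1) < 0 \<and> 0 \<le> x j)"

definition kink_spec :: "real \<Rightarrow> real \<Rightarrow> (real \<Rightarrow> real) \<Rightarrow> bool" where
  "kink_spec a b f \<longleftrightarrow>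
     continuous_on UNIV f \<and>
     (\<forall>y. y \<notin> {a..b} \<longrightarrow> f y = 0) \<and>
     (\<exists>m n. (\<forall>y\<in>{a..0}. f y = f 0 + m * y) \<and> (\<forall>y\<in>{0..b}. f y = f 0 + n * y) \<and> n - m = -1)"

definition kink_fun :: "real \<Rightarrow> real \<Rightarrow> real \<Rightarrow> real" where
  "kink_fun a b = (if b = 0 then (\<lambda>_. 0) else (THE f. kink_spec a b f))"

lemma max_min_diff:
  fixes p q y :: real
  assumes "p - q = y"
  shows "y \<le> 0 \<Longrightarrow> 0 \<le> p \<Longrightarrow> max 0 (min p q) = p"
    and "0 \<le> y \<Longrightarrow> 0 \<le> q \<Longrightarrow> max 0 (min p q) = q"
  using assms by auto

lemma kink_lines:
  fixes a b y :: real
  shows "- (a * b) / (b - a) + b / (b - a) * y = b * (y - a) / (b - a)"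
    and "- (a * b) / (b - a) + a / (b - a) * y = a * (y - b) / (b - a)"
  by (simp_all add: add_divide_distrib[symmetric] diff_divide_distrib[symmetric]
        algebra_simps del: minus_divide_left)

lemma kink_spec_iff:
  assumes "a < 0" "0 < b"
  shows "kink_spec a b f \<longleftrightarrow>
    f = (\<lambda>y. max 0 (min (b * (y - a) / (b - a)) (a * (y - b) / (b - a))))"
proof
  assume f: "kink_spec a b f"
  then obtain m n where cont: "continuous_on UNIV f" and out: "\<And>y. y \<notin> {a..b} \<Longrightarrow> f y = 0"
    and m: "\<And>y. y \<in> {a..0} \<Longrightarrow> f y = f 0 + m * y"
    and n: "\<And>y. y \<in> {0..b} \<Longrightarrow> f y = f 0 + n * y" and mn: "n - m = -1"
    unfolding kink_spec_def by blast
  have c: "isCont f y" for y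
    using cont by (simp add: continuous_on_eq_continuous_at)
  have fa: "f a = 0"
  proof -
    have "(f \<longlongrightarrow> f a) (at_left a)"
      using c[of a] by (simp add: isCont_def filterlim_at_split)
    moreover have "eventually (\<lambda>y. f y = 0) (at_left a)"
      unfolding eventually_at_left_field using out by (intro exI[of _ "a - 1"]) auto
    then have "(f \<longlongrightarrow> 0) (at_left a)"
      by (rule tendsto_eventually)
    ultimately show ?thesis
      using tendsto_unique[of "at_left a"] by auto
  qed
  have fb: "f b = 0"
  proof -
    have "(f \<longlongrightarrow> f b) (at_right b)"
      using c[of b] by (simp add: isCont_def filterlim_at_split)
    moreover have "eventually (\<lambda>y. f y = 0) (at_right b)"
      unfolding eventually_at_right_field using out by (intro exI[of _ "b + 1"]) auto
    then have "(f \<longlongrightarrow> 0) (at_right b)"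
      by (rule tendsto_eventually)
    ultimately show ?thesis
      using tendsto_unique[of "at_right b"] by auto
  qed
  have e1: "f 0 + m * a = 0" using m[of a] fa assms by simp
  have e2: "f 0 + n * b = 0" using n[of b] fb assms by simp
  have n_eq: "n = m - 1" using mn by simp
  have "m * (b - a) = b"
    using e1 e2 unfolding n_eq by (simp add: algebra_simps)
  then have m_eq: "m = b / (b - a)"
    using assms by (simp add: field_simps)
  have n_eq': "n = a / (b - a)"
    using assms unfolding n_eq m_eq by (simp add: field_simps)
  have f0: "f 0 = - (a * b) / (b - a)"
    using e1 unfolding m_eq by (simp add: field_simps)
  show "f = (\<lambda>y. max 0 (min (b * (y - a) / (b - a)) (a * (y - b) / (b - a))))"
  proof
    fix y
    have "b * (y - a) / (b - a) - a * (y - b) / (b - a) = (y * (b - a)) / (b - a)"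
      unfolding diff_divide_distrib[symmetric] by (simp add: algebra_simps)
    then have d: "b * (y - a) / (b - a) - a * (y - b) / (b - a) = y"
      using assms by simp
    consider "y < a" | "y \<in> {a..0}" | "y \<in> {0..b}" | "y > b" by force
    then show "f y = max 0 (min (b * (y - a) / (b - a)) (a * (y - b) / (b - a)))"
    proof cases
      case 1
      then have "b * (y - a) / (b - a) \<le> 0"
        using assms by (simp add: divide_nonpos_pos mult_nonneg_nonpos)
      then show ?thesis using out[of y] 1 by auto
    next
      case 2
      then have "0 \<le> b * (y - a) / (b - a)" using assms by simp
      moreover have "f y = b * (y - a) / (b - a)"
        using m[OF 2] unfolding f0 m_eq kink_lines .
      ultimately show ?thesis using max_min_diff(1)[OF d] 2 by simp
    next
      case 3
      then have "0 \<le> a * (y - b) / (b - a)"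
        using assms by (simp add: mult_nonpos_nonpos)
      moreover have "f y = a * (y - b) / (b - a)"
        using n[OF 3] unfolding f0 n_eq' kink_lines .
      ultimately show ?thesis using max_min_diff(2)[OF d] 3 by simp
    next
      case 4
      then have "a * (y - b) / (b - a) \<le> 0"
        using assms by (simp add: divide_nonpos_pos mult_nonpos_nonneg)
      then show ?thesis using out[of y] 4 by auto
    qed
  qed
next
  assume f: "f = (\<lambda>y. max 0 (min (b * (y - a) / (b - a)) (a * (y - b) / (b - a))))"
  have ba: "b - a > 0" using assms by simp
  have d: "b * (y - a) / (b - a) - a * (y - b) / (b - a) = y" for y
  proof -
    have "b * (y - a) / (b - a) - a * (y - b) / (b - a) = (y * (b - a)) / (b - a)"
      unfolding diff_divide_distrib[symmetric] by (simp add: algebra_simps)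
    then show ?thesis using ba by simp
  qed
  have L: "f y = b * (y - a) / (b - a)" if "y \<in> {a..0}" for y
  proof -
    have "0 \<le> b * (y - a) / (b - a)" using that assms by simp
    then show ?thesis using max_min_diff(1)[OF d[of y]] that unfolding f by simp
  qed
  have Rr: "f y = a * (y - b) / (b - a)" if "y \<in> {0..b}" for y
  proof -
    have "0 \<le> a * (y - b) / (b - a)" using that assms by (simp add: mult_nonpos_nonpos)
    then show ?thesis using max_min_diff(2)[OF d[of y]] that unfolding f by simp
  qed
  have f0: "f 0 = - (a * b) / (b - a)" using L[of 0] assms by simp
  have "continuous_on UNIV f"
    unfolding f using ba by (intro continuous_intros) auto
  moreover have "f y = 0" if "y \<notin> {a..b}" for y
  proof (cases "y < a")
    case True
    then have "b * (y - a) / (b - a) \<le> 0"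
      using assms by (simp add: divide_nonpos_pos mult_nonneg_nonpos)
    then show ?thesis unfolding f by auto
  next
    case False
    then have "y > b" using that by auto
    then have "a * (y - b) / (b - a) \<le> 0"
      using assms by (simp add: divide_nonpos_pos mult_nonpos_nonneg)
    then show ?thesis unfolding f by auto
  qed
  moreover have "f y = f 0 + b / (b - a) * y" if "y \<in> {a..0}" for y
    using L[OF that] unfolding f0 kink_lines .
  moreover have "f y = f 0 + a / (b - a) * y" if "y \<in> {0..b}" for y
    using Rr[OF that] unfolding f0 kink_lines .
  moreover have "a / (b - a) - b / (b - a) = -1"
    unfolding diff_divide_distrib[symmetric] using ba by (simp add: divide_eq_eq)
  ultimately show "kink_spec a b f"
    unfolding kink_spec_def by blast
qed

definition interpolant ::
    "nat \<Rightarrow> (nat \<Rightarrow> real) \<Rightarrow> (nat \<Rightarrow> real) \<Rightarrow> real \<Rightarrow> real" where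
  "interpolant N x obs y =
     kink_fun (x (node_index N x - 1)) (x (node_index N x)) y
     + (\<Sum>j=1..N. obs j * hat_fun x j y)"

definition fourier :: "(real \<Rightarrow> real) \<Rightarrow> real \<Rightarrow> complex" where
  "fourier f u = (LINT x|lborel. iexp (u * x) * of_real (f x))"


section \<open>Estimator\<close>

definition trunc :: "real \<Rightarrow> complex \<Rightarrow> complex" where
  "trunc \<eta> z = (if \<eta> \<le> cmod z then z else of_real \<eta> * z / of_real (cmod z))"

definition trim :: "real \<Rightarrow> real \<Rightarrow> real \<Rightarrow> real \<Rightarrow> real \<Rightarrow> real" where
  "trim T R \<alpha>bar C\<^sub>\<phi> u =
     (if \<bar>u\<bar> < 1 then exp (- T * R) / 3 else C\<^sub>\<phi> / 3 * \<bar>u\<bar> powr (- T * \<alpha>bar))"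

definition cutoff :: "nat \<Rightarrow> real \<Rightarrow> real \<Rightarrow> real \<Rightarrow> real" where
  "cutoff s T \<alpha>bar \<epsilon> = \<epsilon> powr (- 2 / (2 * real s + 2 * T * \<alpha>bar + 1))"

definition emp_cf :: "(real \<Rightarrow> real) \<Rightarrow> real \<Rightarrow> complex" where
  "emp_cf f u = 1 + \<i> * of_real u * (1 + \<i> * of_real u) * fourier f u"

text \<open>
  The values on $[-U,U]$ are uniquely determined if $z$ is continuous there,
  has no zeros and satisfies $z(0)=1$.
\<close>

definition continuous_arg :: "real \<Rightarrow> (real \<Rightarrow> complex) \<Rightarrow> real \<Rightarrow> real" where
  "continuous_arg U z =
     (SOME \<theta>. continuous_on {-U..U} \<theta> \<and> \<theta> 0 = 0 \<and>
        (\<forall>u\<in>{-U..U}. z u = of_real (cmod (z u)) * cis (\<theta> u)))"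

definition psi_est ::
    "real \<Rightarrow> real \<Rightarrow> real \<Rightarrow> real \<Rightarrow> real \<Rightarrow> (real \<Rightarrow> real) \<Rightarrow> real \<Rightarrow> complex" where
  "psi_est T R \<alpha>bar C\<^sub>\<phi> U f u =
     (if \<exists>v\<in>{-U..U}. emp_cf f v = 0 then 0
      else of_real (1 / T) *
        Complex (ln (cmod (trunc (trim T R \<alpha>bar C\<^sub>\<phi> u) (emp_cf f u))))
                (continuous_arg U (emp_cf f) u))"

definition alpha_est ::
    "real \<Rightarrow> real \<Rightarrow> real \<Rightarrow> real \<Rightarrow> (real \<Rightarrow> real \<Rightarrow> real) \<Rightarrow> real \<Rightarrow> (real \<Rightarrow> real) \<Rightarrow> real" where
  "alpha_est T R \<alpha>bar C\<^sub>\<phi> w U f =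
     (LINT u:{-U..U}|lborel. Re (psi_est T R \<alpha>bar C\<^sub>\<phi> U f u) * w U u)"

definition trim_constant :: "real \<Rightarrow> real \<Rightarrow> real \<Rightarrow> real \<Rightarrow> bool" where
  "trim_constant T R \<alpha>bar C\<^sub>\<phi> \<longleftrightarrow>
     0 < C\<^sub>\<phi> \<and>
     (\<forall>(\<gamma>, k) \<in> class_G0 T R \<alpha>bar. \<forall>u. 1 \<le> \<bar>u\<bar> \<longrightarrow>
        C\<^sub>\<phi> * \<bar>u\<bar> powr (- T * \<alpha>bar) \<le> cmod (levy_cf T \<gamma> k (of_real u - \<i>)))"

text \<open>
  Here \<open>w U\<close> is the weight function with cut-off $U$. All integrals below exist because of the
  final bound.
\<close>

definition weight_family :: "nat \<Rightarrow> (real \<Rightarrow> real \<Rightarrow> real) \<Rightarrow> bool" where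
  "weight_family s w \<longleftrightarrow>
     (\<forall>U>0.
        w U \<in> borel_measurable borel \<and>
        (\<forall>u. u \<notin> {-U..U} \<longrightarrow> w U u = 0) \<and>
        (LINT u:{-U..U}|lborel. ln \<bar>u\<bar> * w U u) = -1 \<and>
        (\<forall>j\<in>{1..s - 2}. even j \<longrightarrow> (LINT u:{-U..U}|lborel. w U u / u ^ j) = 0) \<and>
        (LINT u:{0..U}|lborel. w U u) = 0 \<and>
        (LINT u:{0..U}|lborel. w U (- u)) = 0) \<and>
     continuous_on (- {0}) (\<lambda>u. w 1 u / u ^ (s - 1)) \<and>
     bounded ((\<lambda>u. w 1 u / u ^ (s - 1)) ` (- {0})) \<and>
     (\<exists>C. \<forall>U>0. \<forall>u. \<bar>w U u\<bar> \<le> C * (\<bar>u\<bar> ^ (s - 1) / U ^ s))"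

end

theory Submission
  imports Defs "HOL-Complex_Analysis.Conformal_Mappings"
begin

text \<open>
  Put $\varphi(u) = \mathbb E[e^{(1+iu)X_T}]$. By analytic continuation of the characteristic function to the strip
  $0 \le \mathrm{Re} z \le 1$ and the martingale condition, $\log|\varphi(u)| = T \int (\cos(ux) - 1) e^x k(x)/|x| dx$,
  and repeated integration by parts expands the integral as
  $-\alpha \log|u| + const + \sum_{2 \mid j \le s-2} c_j u^{-j} + O(|u|^{-(s-1)})$. The moment conditions on the weight
  extract $\alpha$ up to a bias of order $U^{-(s-1)}$.

  Only moduli enter $\mathrm{Re} \tilde\psi$, so the stochastic error is controlled by the relative error
  $\sup_{|u| \le U} |\tilde\varphi(u) - \varphi(u)| / |\varphi(u)|$. The interpolation error has $L^1$ norm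
  $O(\Delta^2)$; the noise part is bounded by a union bound over a grid, with a sub-Gaussian exponent of order
  $U^{2s-3}$. Since $2s - 3$ exceeds $(s-1)/2$, this crude bound can be linearised when the relative error $\tau$ is
  small, while the truncation gives an estimation error $O(1 + \log U + \log(1 + \tau))$ in general.
\<close>

section \<open>Exponential moments by analytic continuation\<close>

text \<open>Write p = 2s + 2Ta + 1 with a = \<open>\<alpha>bar\<close>; the cut-off means that 1 /
  \<epsilon>^2 = U^p. Relative precision t on [-U, U] needs noise below a multiple of t U^(-Ta) /
  U^2: U^(-Ta) is the guaranteed size of |\<phi>|, and U^2 comes from the factor iu(1 + iu). The
  squared ratio of this level to \<epsilon> is of order t^2 U^(p - 2Ta - 4) = t^2 U^(2s - 3). The
  claim asks only for the power (s - 1)/2 of U, and (s - 1)/2 + 1/2 \<le> 2s - 3 for s \<ge> 2, so a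
  factor sqrt U is left to absorb the prefactor U of the grid. The obstacle is that \<kappa> is
  arbitrary, while the logarithm is Lipschitz only for relative errors up to 1/2. Beyond that the
  trimmed estimate obeys just a bound logarithmic in U and t. If \<kappa> is too small compared with
  log U for this bound to help, the deviation t = 1/2 already gives enough: \<kappa> is then at most
  of order U, so U^(2s - 3) dominates \<kappa>^(1/2) U^((s - 1)/2) up to constants. This is where
  the power 1/2 of \<kappa> enters.\<close>

lemma has_field_derivative_lebesgue_integral:
  fixes f f' :: "'c::{real_normed_field, second_countable_topology, banach} \<Rightarrow> 'a \<Rightarrow> 'c"
  assumes S: "open S" "convex S" "z \<in> S"
    and int: "\<And>y. y \<in> S \<Longrightarrow> integrable M (f y)"
    and meas: "f' z \<in> borel_measurable M"
    and deriv: "\<And>y x. y \<in> S \<Longrightarrow> x \<in> space M \<Longrightarrow> ((\<lambda>y. f y x) has_field_derivative f' y x) (at y)"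
    and bound: "\<And>y x. y \<in> S \<Longrightarrow> x \<in> space M \<Longrightarrow> norm (f' y x) \<le> g x"
    and g: "integrable M g"
  shows "((\<lambda>y. LINT x|M. f y x) has_field_derivative (LINT x|M. f' z x)) (at z)"
proof -
  have "((\<lambda>y. ((LINT x|M. f y x) - (LINT x|M. f z x)) / (y - z)) \<longlongrightarrow> (LINT x|M. f' z x)) (at z)"
    unfolding tendsto_at_iff_sequentially
  proof (intro allI impI)
    fix X :: "nat \<Rightarrow> 'c"
    assume X: "\<forall>i. X i \<in> UNIV - {z}" "X \<longlonglongrightarrow> z"
    from X(2) S(1,3) have "eventually (\<lambda>n. X n \<in> S) sequentially"
      by (rule topological_tendstoD)
    then obtain n0 where n0: "\<And>n. n \<ge> n0 \<Longrightarrow> X n \<in> S"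
      by (auto simp: eventually_sequentially)
    \<comment> \<open>Dropping the first \<open>n0\<close> terms puts the whole sequence into
      \<open>S\<close>, where convexity and the derivative bound make \<open>g\<close> a majorant of
      the difference quotients.\<close>
    define Y where "Y n = X (n + n0)" for n
    have Y: "Y \<longlonglongrightarrow> z" "\<And>n. Y n \<in> S" "\<And>n. Y n \<noteq> z"
      using LIMSEQ_ignore_initial_segment[OF X(2), of n0] X(1) n0 by (auto simp: Y_def[abs_def])
    have "(\<lambda>n. LINT x|M. (f (Y n) x - f z x) / (Y n - z)) \<longlonglongrightarrow> (LINT x|M. f' z x)"
    proof (rule integral_dominated_convergence[where w = g])
      show "f' z \<in> borel_measurable M" by fact
      show "integrable M g" by fact
      show "(\<lambda>x. (f (Y n) x - f z x) / (Y n - z)) \<in> borel_measurable M" for n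
        using int[OF Y(2)] int[OF S(3)] by (auto intro!: borel_measurable_integrable)
      show "AE x in M. (\<lambda>n. (f (Y n) x - f z x) / (Y n - z)) \<longlonglongrightarrow> f' z x"
      proof (rule AE_I2)
        fix x assume x: "x \<in> space M"
        have "((\<lambda>y. (f y x - f z x) / (y - z)) \<longlongrightarrow> f' z x) (at z)"
          using deriv[OF S(3) x] by (simp add: has_field_derivative_iff)
        then show "(\<lambda>n. (f (Y n) x - f z x) / (Y n - z)) \<longlonglongrightarrow> f' z x"
          using Y unfolding tendsto_at_iff_sequentially by (auto simp: comp_def)
      qed
      show "AE x in M. norm ((f (Y n) x - f z x) / (Y n - z)) \<le> g x" for n
      proof (rule AE_I2)
        fix x assume x: "x \<in> space M"
        have "norm (f (Y n) x - f z x) \<le> g x * norm (Y n - z)"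
          by (rule field_differentiable_bound[OF S(2) _ _ Y(2) S(3), where f' = "\<lambda>y. f' y x"])
             (use deriv bound x in \<open>auto intro: has_field_derivative_at_within\<close>)
        then show "norm ((f (Y n) x - f z x) / (Y n - z)) \<le> g x"
          using Y(3)[of n] by (simp add: norm_divide field_simps)
      qed
    qed
    moreover have eq: "(LINT x|M. (f (Y n) x - f z x) / (Y n - z))
        = ((LINT x|M. f (Y n) x) - (LINT x|M. f z x)) / (Y n - z)" for n
      using int[OF Y(2)] int[OF S(3)] by simp
    ultimately have "(\<lambda>n. ((LINT x|M. f (Y n) x) - (LINT x|M. f z x)) / (Y n - z)) \<longlonglongrightarrow> (LINT x|M. f' z x)"
      by (simp only: eq)
    then show "((\<lambda>y. ((LINT x|M. f y x) - (LINT x|M. f z x)) / (y - z)) \<circ> X) \<longlonglongrightarrow> (LINT x|M. f' z x)"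
      unfolding Y_def comp_def by (rule LIMSEQ_offset)
  qed
  then show ?thesis by (simp add: has_field_derivative_iff)
qed

lemma norm_exp_mult_le:
  fixes z :: complex and x :: real
  assumes "0 \<le> Re z" "Re z \<le> 1"
  shows "norm (exp (z * of_real x)) \<le> max 1 (exp x)"
proof (cases "0 \<le> x")
  case True
  then have "Re z * x \<le> 1 * x" using assms by (intro mult_right_mono) auto
  then show ?thesis by (simp add: le_max_iff_disj)
next
  case False
  then have "Re z * x \<le> 0" using assms by (simp add: mult_nonneg_nonpos)
  then show ?thesis by (simp add: max.coboundedI1)
qed

text \<open>Mean value inequality along the segment from 0 to z x: its points are (t z) x with t in
  [0, 1], and t z stays in the strip, so \<open>norm_exp_mult_le\<close> bounds the derivative on
  all of it.\<close>

lemma norm_exp_minus_one_le: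
  fixes z :: complex and x :: real
  assumes "0 \<le> Re z" "Re z \<le> 1"
  shows "norm (exp (z * of_real x) - 1) \<le> norm z * \<bar>x\<bar> * max 1 (exp x)"
proof -
  have "norm (exp (z * of_real x) - exp 0) \<le> max 1 (exp x) * norm (z * of_real x - 0)"
  proof (rule field_differentiable_bound[where S = "closed_segment 0 (z * of_real x)" and f' = exp])
    fix y assume "y \<in> closed_segment 0 (z * of_real x)"
    then obtain t where t: "0 \<le> t" "t \<le> 1" "y = t *\<^sub>R (z * of_real x)"
      by (auto simp: in_segment)
    then have y: "y = (of_real t * z) * of_real x" by (simp add: scaleR_conv_of_real)
    show "norm (exp y) \<le> max 1 (exp x)" unfolding y
      by (rule norm_exp_mult_le) (use t assms in \<open>auto simp: mult_le_one\<close>)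
  qed (auto intro: DERIV_exp has_field_derivative_at_within)
  then show ?thesis by (simp add: norm_mult mult_ac)
qed

text \<open>For x \<ge> 0 the factor |x| is absorbed by one more exponential, for x < 0 by part of
  the decay, which costs 1 / d. The bound deteriorates as d tends to 0, so the moment function is
  differentiated only inside the open strip.\<close>

lemma abs_mult_exp_le:
  fixes d t x :: real
  assumes "0 < d" "d \<le> t" "t \<le> 1"
  shows "\<bar>x\<bar> * exp (t * x) \<le> 1 / d + exp (2 * x)"
proof (cases "0 \<le> x")
  case True
  have "t * x \<le> 1 * x" using True assms by (intro mult_right_mono) auto
  then have "\<bar>x\<bar> * exp (t * x) \<le> exp x * exp x"
    using True order_trans[OF _ exp_ge_add_one_self[of x], of x] by (intro mult_mono) auto
  also have "\<dots> = exp (2 * x)" by (simp add: exp_add[symmetric])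
  also have "\<dots> \<le> 1 / d + exp (2 * x)" using assms by simp
  finally show ?thesis .
next
  case False
  have "d * \<bar>x\<bar> \<le> exp (d * \<bar>x\<bar>)" using exp_ge_add_one_self[of "d * \<bar>x\<bar>"] by linarith
  have "t * x \<le> d * x" using False assms by (simp add: mult_right_mono_neg)
  then have "d * \<bar>x\<bar> * exp (t * x) \<le> exp (d * \<bar>x\<bar>) * exp (d * x)"
    using \<open>d * \<bar>x\<bar> \<le> _\<close> assms by (intro mult_mono) auto
  also have "\<dots> = 1" using False by (simp add: exp_add[symmetric])
  finally have "\<bar>x\<bar> * exp (t * x) \<le> 1 / d" using assms by (simp add: field_simps)
  then show ?thesis by (smt (verit) exp_gt_zero)
qed

text \<open>The majorant may grow linearly in z, as the jump integrand does; along a convergent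
  sequence this growth is bounded.\<close>

lemma continuous_on_lebesgue_integral:
  fixes f :: "complex \<Rightarrow> 'a \<Rightarrow> complex"
  assumes cont: "\<And>x. x \<in> space M \<Longrightarrow> continuous_on S (\<lambda>z. f z x)"
    and meas: "\<And>z. z \<in> S \<Longrightarrow> f z \<in> borel_measurable M"
    and bound: "\<And>z x. z \<in> S \<Longrightarrow> x \<in> space M \<Longrightarrow> norm (f z x) \<le> (1 + norm z) * g x"
    and g: "integrable M g"
  shows "continuous_on S (\<lambda>z. LINT x|M. f z x)"
proof (rule continuous_on_sequentiallyI)
  fix X z assume X: "\<forall>n. X n \<in> S" and z: "z \<in> S" and lim: "X \<longlonglongrightarrow> z"
  have "Bseq X" using lim by (metis convergent_def convergent_imp_Bseq)
  then obtain B where B: "\<And>n. norm (X n) \<le> B" by (auto simp: Bseq_def)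
  show "(\<lambda>n. LINT x|M. f (X n) x) \<longlonglongrightarrow> (LINT x|M. f z x)"
  proof (rule integral_dominated_convergence[where w = "\<lambda>x. (1 + B) * \<bar>g x\<bar>"])
    show "integrable M (\<lambda>x. (1 + B) * \<bar>g x\<bar>)" using g by simp
    show "AE x in M. (\<lambda>n. f (X n) x) \<longlonglongrightarrow> f z x"
      using cont X z lim by (auto intro!: AE_I2 simp: continuous_on_sequentially comp_def)
    show "AE x in M. norm (f (X n) x) \<le> (1 + B) * \<bar>g x\<bar>" for n
    proof (rule AE_I2)
      fix x assume x: "x \<in> space M"
      have "norm (f (X n) x) \<le> (1 + norm (X n)) * g x" using bound X x by auto
      also have "\<dots> \<le> (1 + norm (X n)) * \<bar>g x\<bar>" by (intro mult_left_mono) auto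
      also have "\<dots> \<le> (1 + B) * \<bar>g x\<bar>" using B[of n] by (intro mult_right_mono) auto
      finally show "norm (f (X n) x) \<le> (1 + B) * \<bar>g x\<bar>" .
    qed
  qed (use meas X z in auto)
qed

text \<open>The zero of exp(z x) - 1 at x = 0 cancels the singularity of the Levy density; what
  remains is dominated uniformly over bounded parts of the closed strip.\<close>

lemma exp_jump_bound:
  fixes z :: complex and k :: "real \<Rightarrow> real"
  assumes "0 \<le> Re z" "Re z \<le> 1"
  shows "norm ((exp (z * of_real x) - 1) * of_real (k x / \<bar>x\<bar>)) \<le> norm z * (max 1 (exp x) * \<bar>k x\<bar>)"
proof (cases "x = 0")
  case False
  have "norm ((exp (z * of_real x) - 1) * of_real (k x / \<bar>x\<bar>))
      \<le> norm z * \<bar>x\<bar> * max 1 (exp x) * (\<bar>k x\<bar> / \<bar>x\<bar>)"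
    unfolding norm_mult of_real_divide norm_divide norm_of_real abs_abs
    by (intro mult_right_mono norm_exp_minus_one_le assms) auto
  also have "\<dots> = norm z * (max 1 (exp x) * \<bar>k x\<bar>)" using False by simp
  finally show ?thesis .
qed (auto simp: intro!: mult_nonneg_nonneg)

lemma exp_jump_integrable:
  fixes z :: complex and k :: "real \<Rightarrow> real"
  assumes "integrable lborel (\<lambda>x. max 1 (exp x) * k x)" "k \<in> borel_measurable borel"
    "0 \<le> Re z" "Re z \<le> 1"
  shows "integrable lborel (\<lambda>x. (exp (z * of_real x) - 1) * of_real (k x / \<bar>x\<bar>))"
proof (rule Bochner_Integration.integrable_bound)
  show "integrable lborel (\<lambda>x. norm z * (max 1 (exp x) * k x))" using assms by simp
  show "AE x in lborel. norm ((exp (z * of_real x) - 1) * of_real (k x / \<bar>x\<bar>))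
      \<le> norm (norm z * (max 1 (exp x) * k x))"
    using exp_jump_bound[OF assms(3,4), of _ k] by (auto simp: abs_mult)
qed (use assms in measurable)

text \<open>Both sides are continuous on the closed strip and holomorphic inside, and on Re z = 0
  they agree by hypothesis. No moment with negative exponent is assumed, so neither side need extend
  to the left of the imaginary axis; their difference does, by zero.\<close>

lemma levy_exponential_moment:
  fixes \<mu> :: "real measure" and k :: "real \<Rightarrow> real"
  assumes mu: "real_distribution \<mu>" and mom: "integrable \<mu> (\<lambda>x. exp (2 * x))"
    and ch: "\<And>u. char \<mu> u = exp (of_real T * levy_exponent \<gamma> k u)"
    and k: "k \<in> borel_measurable borel" "integrable lborel (\<lambda>x. max 1 (exp x) * k x)"
    and z: "Re z = 1"
  shows "(LINT x|\<mu>. exp (z * of_real x)) =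
    exp (of_real T * (of_real \<gamma> * z + (LINT x|lborel. (exp (z * of_real x) - 1) * of_real (k x / \<bar>x\<bar>))))"
proof -
  interpret real_distribution \<mu> by fact
  note k(1)[measurable]
  define G where "G z = (LINT x|\<mu>. exp (z * of_real x))" for z :: complex
  define J where "J z = (LINT x|lborel. (exp (z * of_real x) - 1) * of_real (k x / \<bar>x\<bar>))" for z :: complex
  define H where "H z = exp (of_real T * (of_real \<gamma> * z + J z))" for z
  let ?S = "{z. 0 \<le> Re z \<and> Re z \<le> 1}"
  have kabs: "integrable lborel (\<lambda>x. max 1 (exp x) * \<bar>k x\<bar>)"
    using integrable_abs[OF k(2)] by (simp add: abs_mult)
  have e1: "integrable \<mu> (\<lambda>x. 1 + exp (2 * x))" using mom by simp
  have mx: "max 1 (exp x) \<le> 1 + exp (2 * x)" for x :: real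
  proof (cases "0 \<le> x")
    case True then have "exp x \<le> exp (2 * x)" by simp
    then show ?thesis by (smt (verit) exp_gt_zero)
  next
    case False then show ?thesis by (smt (verit) exp_gt_zero exp_le_one_iff)
  qed
  have bG: "norm (exp (z * of_real x)) \<le> 1 + exp (2 * x)" if "z \<in> ?S" for z :: complex and x :: real
    using order_trans[OF norm_exp_mult_le mx] that by blast
  have intG: "integrable \<mu> (\<lambda>x. exp (z * of_real x))" if "z \<in> ?S" for z :: complex
    by (rule Bochner_Integration.integrable_bound[OF e1]) (use bG[OF that] in \<open>auto intro!: AE_I2 simp del: norm_exp_eq_Re intro: order_trans\<close>)
  have contG: "continuous_on ?S G" unfolding G_def
  proof (rule continuous_on_lebesgue_integral[OF _ _ _ e1])
    fix z :: complex and x :: real assume "z \<in> ?S"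
    have "norm (exp (z * of_real x)) \<le> 1 * (1 + exp (2 * x))" using bG[OF \<open>z \<in> ?S\<close>] by simp
    also have "\<dots> \<le> (1 + norm z) * (1 + exp (2 * x))" by (intro mult_right_mono) (auto simp: add_nonneg_nonneg)
    finally show "norm (exp (z * of_real x)) \<le> (1 + norm z) * (1 + exp (2 * x))" .
  next
    fix z :: complex
    show "(\<lambda>x. exp (z * of_real x)) \<in> borel_measurable \<mu>" by measurable
  qed (intro continuous_intros)
  have contJ: "continuous_on ?S J" unfolding J_def
  proof (rule continuous_on_lebesgue_integral[OF _ _ _ kabs])
    fix z :: complex and x :: real assume "z \<in> ?S"
    then have "norm ((exp (z * of_real x) - 1) * of_real (k x / \<bar>x\<bar>)) \<le> norm z * (max 1 (exp x) * \<bar>k x\<bar>)"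
      by (intro exp_jump_bound) auto
    also have "\<dots> \<le> (1 + norm z) * (max 1 (exp x) * \<bar>k x\<bar>)" by (intro mult_right_mono) auto
    finally show "norm ((exp (z * of_real x) - 1) * of_real (k x / \<bar>x\<bar>)) \<le> (1 + norm z) * (max 1 (exp x) * \<bar>k x\<bar>)" .
  next
    fix z :: complex
    show "(\<lambda>x. (exp (z * of_real x) - 1) * of_real (k x / \<bar>x\<bar>)) \<in> borel_measurable lborel" by measurable
  qed (intro continuous_intros)
  have contH: "continuous_on ?S H" unfolding H_def by (intro continuous_intros contJ)
  have holG: "G field_differentiable (at z)" if z: "0 < Re z" "Re z < 1" for z
  proof -
    let ?d = "Re z / 2"
    let ?V = "{y. ?d < Re y} \<inter> {y. Re y < 1}"
    have "(G has_field_derivative (LINT x|\<mu>. of_real x * exp (z * of_real x))) (at z)"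
      unfolding G_def
    proof (rule has_field_derivative_lebesgue_integral[where S = ?V and f' = "\<lambda>z x. of_real x * exp (z * of_real x)" and g = "\<lambda>x. 1 / ?d + exp (2 * x)"])
      show "open ?V" by (intro open_Int open_halfspace_Re_gt open_halfspace_Re_lt)
      show "convex ?V" by (intro convex_Int convex_halfspace_Re_gt convex_halfspace_Re_lt)
      show "integrable \<mu> (\<lambda>x. 1 / ?d + exp (2 * x))" using mom by simp
      fix y :: complex and x :: real assume y: "y \<in> ?V"
      show "integrable \<mu> (\<lambda>x. exp (y * of_real x))" using y z by (intro intG) auto
      show "((\<lambda>y. exp (y * of_real x)) has_field_derivative of_real x * exp (y * of_real x)) (at y)"
        by (auto intro!: derivative_eq_intros)
      show "norm (of_real x * exp (y * of_real x)) \<le> 1 / ?d + exp (2 * x)"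
        using abs_mult_exp_le[of ?d "Re y" x] y z by (simp add: norm_mult)
    qed (use z in auto)
    then show ?thesis by (auto simp: field_differentiable_def)
  qed
  have holJ: "J field_differentiable (at z)" if z: "0 < Re z" "Re z < 1" for z
  proof -
    let ?V = "{y. 0 < Re y} \<inter> {y. Re y < 1}"
    have "(J has_field_derivative (LINT x|lborel. of_real x * exp (z * of_real x) * of_real (k x / \<bar>x\<bar>))) (at z)"
      unfolding J_def
    proof (rule has_field_derivative_lebesgue_integral[where S = ?V and f' = "\<lambda>z x. of_real x * exp (z * of_real x) * of_real (k x / \<bar>x\<bar>)" and g = "\<lambda>x. max 1 (exp x) * \<bar>k x\<bar>"])
      show "open ?V" by (intro open_Int open_halfspace_Re_gt open_halfspace_Re_lt)
      show "convex ?V" by (intro convex_Int convex_halfspace_Re_gt convex_halfspace_Re_lt)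
      fix y :: complex and x :: real assume y: "y \<in> ?V"
      show "integrable lborel (\<lambda>x. (exp (y * of_real x) - 1) * of_real (k x / \<bar>x\<bar>))"
        using y by (intro exp_jump_integrable k) auto
      show "((\<lambda>y. (exp (y * of_real x) - 1) * of_real (k x / \<bar>x\<bar>)) has_field_derivative of_real x * exp (y * of_real x) * of_real (k x / \<bar>x\<bar>)) (at y)"
        by (rule derivative_eq_intros refl | simp)+
      have "norm (of_real x * exp (y * of_real x) * complex_of_real (k x / \<bar>x\<bar>)) \<le> norm (exp (y * of_real x)) * \<bar>k x\<bar>"
        by (cases "x = 0") (auto simp: norm_mult norm_divide)
      also have "\<dots> \<le> max 1 (exp x) * \<bar>k x\<bar>" using y by (intro mult_right_mono norm_exp_mult_le) auto
      finally show "norm (of_real x * exp (y * of_real x) * complex_of_real (k x / \<bar>x\<bar>)) \<le> max 1 (exp x) * \<bar>k x\<bar>" .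
    qed (use z kabs in auto)
    then show ?thesis by (auto simp: field_differentiable_def)
  qed
  have holH: "H field_differentiable (at z)" if z: "0 < Re z" "Re z < 1" for z
  proof -
    have "(\<lambda>z. of_real T * (of_real \<gamma> * z + J z)) field_differentiable (at z)"
      by (intro field_differentiable_mult field_differentiable_add field_differentiable_const
           holJ[OF z] field_differentiable_ident)
    moreover have "exp field_differentiable (at (of_real T * (of_real \<gamma> * z + J z)))"
      by (rule field_differentiable_within_exp)
    ultimately have "(exp \<circ> (\<lambda>z. of_real T * (of_real \<gamma> * z + J z))) field_differentiable (at z)"
      by (rule field_differentiable_compose)
    then show ?thesis by (simp add: H_def[abs_def] comp_def)
  qed
  have left: "G z = H z" if "Re z = 0" for z
  proof -
    have z: "z = \<i> * of_real (Im z)" using that by (simp add: complex_eq_iff)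
    have "G z = char \<mu> (Im z)" unfolding G_def char_def by (subst z) (simp add: mult_ac)
    also have "\<dots> = H z" unfolding ch levy_exponent_def H_def J_def
      by (subst (3 4) z) (simp add: mult_ac)
    finally show ?thesis .
  qed
  \<comment> \<open>Continuous pasting along the imaginary axis makes \<open>F\<close> holomorphic
    on Re z < 1; it vanishes for Re z < 0, hence on that whole half-plane.\<close>
  define F where "F z = (if Re z \<le> 0 then 0 else G z - H z)" for z
  let ?W = "{z. Re z < 1}"
  have "F holomorphic_on ?W"
  proof (rule holomorphic_on_paste_across_line[where d = 1 and k = 0])
    show "open ?W" by (rule open_halfspace_Re_lt)
    show "F holomorphic_on ?W \<inter> {z. 1 \<bullet> z < 0}"
      by (rule holomorphic_transform[where f = "\<lambda>_. 0"]) (auto simp: F_def)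
    show "F holomorphic_on ?W \<inter> {z. 0 < 1 \<bullet> z}"
    proof (rule holomorphic_transform[where f = "\<lambda>z. G z - H z"])
      show "(\<lambda>z. G z - H z) holomorphic_on ?W \<inter> {z. 0 < 1 \<bullet> z}"
        unfolding holomorphic_on_def
        by (auto intro!: field_differentiable_diff field_differentiable_at_within[OF holG] field_differentiable_at_within[OF holH])
    qed (auto simp: F_def)
    show "continuous_on ?W F"
    proof -
      have "continuous_on ?W (\<lambda>z. if Re z \<le> 0 then 0 else G z - H z)"
      proof (rule continuous_on_cases_le)
        show "continuous_on {z \<in> ?W. 0 \<le> Re z} (\<lambda>z. G z - H z)"
          by (intro continuous_on_diff continuous_on_subset[OF contG] continuous_on_subset[OF contH]) auto
      qed (use left in \<open>auto intro!: continuous_intros\<close>)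
      then show ?thesis unfolding F_def[abs_def] .
    qed
  qed simp
  have "F w = 0" if "w \<in> ?W" for w
  proof (rule analytic_continuation_open[where f = F and s = "{z. Re z < 0}" and s' = ?W and g = "\<lambda>_. 0"])
    show "{z. Re z < 0} \<noteq> {}" by (auto intro!: exI[of _ "-1"])
    show "connected ?W" by (intro convex_connected convex_halfspace_Re_lt)
  qed (use that \<open>F holomorphic_on ?W\<close> open_halfspace_Re_lt in \<open>auto simp: F_def\<close>)
  then have inner: "G w = H w" if "0 < Re w" "Re w < 1" for w
    using that by (force simp: F_def split: if_splits)
  \<comment> \<open>The line Re z = 1 lies on the boundary of the region where the identity is known
    and is reached by continuity.\<close>
  define X where "X n = z - of_real (1 / (real n + 2))" for n
  have RX: "Re (X n) = 1 - 1 / (real n + 2)" for n using z by (simp add: X_def)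
  have X01: "0 < Re (X n)" "Re (X n) < 1" for n by (auto simp: RX field_simps)
  have "(\<lambda>n. 1 / (real n + 2)) \<longlonglongrightarrow> 0"
    using LIMSEQ_ignore_initial_segment[OF lim_1_over_n, of 2] by (simp add: add.commute)
  then have "X \<longlonglongrightarrow> z - of_real 0" unfolding X_def by (intro tendsto_intros)
  then have lim: "X \<longlonglongrightarrow> z" by simp
  have "(\<lambda>n. G (X n)) \<longlonglongrightarrow> G z"
    using contG lim X01 z less_imp_le unfolding continuous_on_sequentially comp_def by (simp add: less_imp_le)
  moreover have "(\<lambda>n. H (X n)) \<longlonglongrightarrow> H z"
    using contH lim X01 z unfolding continuous_on_sequentially comp_def by (simp add: less_imp_le)
  moreover have "(\<lambda>n. G (X n)) = (\<lambda>n. H (X n))" using inner X01 by auto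
  ultimately have "G z = H z" using LIMSEQ_unique by metis
  then show ?thesis by (simp add: G_def H_def J_def)
qed

section \<open>The Fourier transform of the option function\<close>

text \<open>The option value at log-strike \<open>x\<close> for a fixed value \<open>y\<close> of
  the log-price. Working with it before taking expectations reduces the Fourier transform to an
  elementary integral.\<close>

definition payoff :: "real \<Rightarrow> real \<Rightarrow> real" where
  "payoff y x = (if 0 \<le> x then max (exp y - exp x) 0 else max (exp x - exp y) 0)"

lemma option_fun_eq: "option_fun Q Y x = (LINT \<omega>|Q. payoff (Y \<omega>) x)"
  by (simp add: option_fun_def payoff_def)

lemma payoff_nonneg: "0 \<le> payoff y x"
  by (simp add: payoff_def)

text \<open>A call pays only if x \<le> y, and then exp y \<le> exp (2y) exp (-x); a put with x < 0
  pays at most exp x. In this way the second exponential moment yields decay in |x|.\<close>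

lemma payoff_le: "payoff y x \<le> (1 + exp (2 * y)) * exp (- \<bar>x\<bar>)"
proof (cases "0 \<le> x")
  case True
  have "max (exp y - exp x) 0 \<le> exp (2 * y) * exp (- x)"
  proof (cases "x \<le> y")
    case True
    have "exp y - exp x \<le> exp y" by simp
    also have "\<dots> \<le> exp (2 * y) * exp (- x)" using True by (simp add: exp_add[symmetric])
    finally show ?thesis by simp
  qed simp
  also have "\<dots> \<le> (1 + exp (2 * y)) * exp (- x)" by (simp add: distrib_right)
  finally show ?thesis using True by (simp add: payoff_def)
next
  case False
  have "max (exp x - exp y) 0 \<le> 1 * exp x" by simp
  also have "\<dots> \<le> (1 + exp (2 * y)) * exp x" by (intro mult_right_mono) auto
  finally show ?thesis using False by (simp add: payoff_def)
qed

lemma has_bochner_integral_exp_neg_abs: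
  "has_bochner_integral lborel (\<lambda>x::real. exp (- \<bar>x\<bar>)) 2"
proof -
  have "has_bochner_integral lborel (\<lambda>x::real. exp (- \<bar>x\<bar>)) (2 *\<^sub>R 1)"
  proof (rule has_bochner_integral_even_function)
    have "(\<lambda>x::real. x ^ 0 * exp (- x) * indicator {0..} x) = (\<lambda>x. indicator {0..} x *\<^sub>R exp (- \<bar>x\<bar>))"
      by (auto simp: indicator_def)
    then show "has_bochner_integral lborel (\<lambda>x. indicator {0..} x *\<^sub>R exp (- \<bar>x\<bar>)) (1 :: real)"
      using has_bochner_integral_I0i_power_exp_m'[of 0] by simp
  qed simp
  then show ?thesis by simp
qed

text \<open>As a function of x the payoff is supported between 0 and y, and iu(1 + iu) exp(iux) (exp
  y - exp x) has the explicit antiderivative \<open>P\<close>. The factor iu(1 + iu) stays on the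
  left so that u = 0 needs no separate treatment.\<close>

lemma fourier_payoff:
  fixes u y :: real
  shows "\<i> * u * (1 + \<i> * u) * (LINT x|lborel. iexp (u * x) * of_real (payoff y x))
    = exp ((1 + \<i> * u) * of_real y) - (1 + \<i> * u) * exp (of_real y) + \<i> * u"
proof -
  define P where "P x = (1 + \<i> * u) * (exp (of_real y) * exp (\<i> * u * of_real x))
      - \<i> * u * exp ((1 + \<i> * u) * of_real x)" for x :: real
  define p where "p x = \<i> * u * (1 + \<i> * u) * (iexp (u * x) * (exp (of_real y) - exp (of_real x)))" for x :: real
  have deriv: "(P has_vector_derivative p x) (at x within S)" for x S
    unfolding P_def p_def
    by (rule has_vector_derivative_eq_rhs, (rule derivative_intros has_vector_derivative_real_field | (rule DERIV_cong, (rule derivative_intros)+))+)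
       (auto simp: algebra_simps exp_add)
  have cont: "continuous_on S p" for S unfolding p_def by (intro continuous_intros)
  have "(LINT x|lborel. \<i> * u * (1 + \<i> * u) * (iexp (u * x) * of_real (payoff y x))) = P y - P 0"
  proof (cases "0 \<le> y")
    case True
    have "has_bochner_integral lborel (\<lambda>x. indicator {0..y} x *\<^sub>R p x) (P y - P 0)"
      by (rule has_bochner_integral_FTC_Icc[OF True]) (auto intro: deriv cont)
    moreover have "(\<lambda>x. indicator {0..y} x *\<^sub>R p x) = (\<lambda>x. \<i> * u * (1 + \<i> * u) * (iexp (u * x) * of_real (payoff y x)))"
      using True by (auto simp: fun_eq_iff p_def payoff_def indicator_def max_def exp_of_real)
    ultimately show ?thesis by (simp only: has_bochner_integral_integral_eq)
  next
    case False
    then have y: "y \<le> 0" by simp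
    have "has_bochner_integral lborel (\<lambda>x. indicator {y..0} x *\<^sub>R p x) (P 0 - P y)"
      by (rule has_bochner_integral_FTC_Icc[OF y]) (auto intro: deriv cont)
    then have I: "(LINT x|lborel. - (indicator {y..0} x *\<^sub>R p x)) = P y - P 0"
      by (simp add: has_bochner_integral_integral_eq)
    have "(LINT x|lborel. \<i> * u * (1 + \<i> * u) * (iexp (u * x) * of_real (payoff y x)))
      = (LINT x|lborel. - (indicator {y..0} x *\<^sub>R p x))"
    \<comment> \<open>For y < 0 the two integrands may differ at x = 0, where the payoff is already
      that of a call and vanishes.\<close>
    proof (rule integral_cong_AE)
      show "AE x in lborel. \<i> * u * (1 + \<i> * u) * (iexp (u * x) * of_real (payoff y x)) = - (indicator {y..0} x *\<^sub>R p x)"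
        using AE_lborel_singleton[of "0::real"]
      proof eventually_elim
        case (elim x)
        then show ?case using y
          by (auto simp: p_def payoff_def indicator_def max_def exp_of_real algebra_simps)
      qed
      show "(\<lambda>x. - (indicator {y..0} x *\<^sub>R p x)) \<in> borel_measurable lborel"
        unfolding p_def by measurable
      show "(\<lambda>x. \<i> * u * (1 + \<i> * u) * (iexp (u * x) * of_real (payoff y x))) \<in> borel_measurable lborel"
        unfolding payoff_def by measurable
    qed
    then show ?thesis using I by simp
  qed
  then have "\<i> * u * (1 + \<i> * u) * (LINT x|lborel. iexp (u * x) * of_real (payoff y x)) = P y - P 0"
    by simp
  also have "\<dots> = exp ((1 + \<i> * u) * of_real y) - (1 + \<i> * u) * exp (of_real y) + \<i> * u"
    by (simp add: P_def algebra_simps exp_add)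
  finally show ?thesis .
qed

context prob_space
begin

context
  fixes Y :: "'a \<Rightarrow> real"
  assumes Y [measurable]: "random_variable borel Y"
    and int: "integrable M (\<lambda>\<omega>. exp (2 * Y \<omega>))"
begin

lemma exp_integrable: "integrable M (\<lambda>\<omega>. exp (Y \<omega>))"
proof (rule Bochner_Integration.integrable_bound)
  show "integrable M (\<lambda>\<omega>. 1 + exp (2 * Y \<omega>))" using int by simp
  have "exp y \<le> 1 + exp (2 * y)" for y :: real
  proof -
    have "0 \<le> (exp y - 1)\<^sup>2" by simp
    also have "\<dots> = 1 + exp (2 * y) - 2 * exp y" by (simp add: power2_diff exp_double)
    finally show ?thesis using exp_ge_zero[of y] by linarith
  qed
  then show "AE \<omega> in M. norm (exp (Y \<omega>)) \<le> norm (1 + exp (2 * Y \<omega>))"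
    by (intro AE_I2) (smt (verit) exp_gt_zero real_norm_def)
qed measurable

lemma payoff_integrable: "integrable M (\<lambda>\<omega>. payoff (Y \<omega>) x)"
proof (rule Bochner_Integration.integrable_bound)
  show "integrable M (\<lambda>\<omega>. (1 + exp (2 * Y \<omega>)) * exp (- \<bar>x\<bar>))" using int by simp
  show "AE \<omega> in M. norm (payoff (Y \<omega>) x) \<le> norm ((1 + exp (2 * Y \<omega>)) * exp (- \<bar>x\<bar>))"
    using payoff_le payoff_nonneg by (intro AE_I2) (smt (verit) real_norm_def)
  show "(\<lambda>\<omega>. payoff (Y \<omega>) x) \<in> borel_measurable M"
    unfolding payoff_def by measurable
qed

lemma option_fun_nonneg: "0 \<le> option_fun M Y x"
  by (simp add: option_fun_eq payoff_nonneg)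

lemma option_fun_le: "option_fun M Y x \<le> (1 + expectation (\<lambda>\<omega>. exp (2 * Y \<omega>))) * exp (- \<bar>x\<bar>)"
proof -
  have "option_fun M Y x \<le> expectation (\<lambda>\<omega>. (1 + exp (2 * Y \<omega>)) * exp (- \<bar>x\<bar>))"
    unfolding option_fun_eq using int by (intro integral_mono payoff_integrable payoff_le) simp
  then show ?thesis using int by (simp add: prob_space)
qed

lemma option_fun_measurable [measurable]: "option_fun M Y \<in> borel_measurable borel"
  unfolding option_fun_eq[abs_def] payoff_def by measurable

lemma option_fun_integrable: "integrable lborel (option_fun M Y)"
proof (rule Bochner_Integration.integrable_bound)
  show "integrable lborel (\<lambda>x. (1 + expectation (\<lambda>\<omega>. exp (2 * Y \<omega>))) * exp (- \<bar>x\<bar>))"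
    using has_bochner_integral_exp_neg_abs by (auto simp: has_bochner_integral_iff)
  show "AE x in lborel. norm (option_fun M Y x) \<le> norm ((1 + expectation (\<lambda>\<omega>. exp (2 * Y \<omega>))) * exp (- \<bar>x\<bar>))"
    using option_fun_nonneg option_fun_le by (intro AE_I2) (smt (verit) real_norm_def)
qed simp

text \<open>Expectation of \<open>fourier_payoff\<close>: since E exp(Y) = 1, the terms -(1 + iu)
  and iu leave -1, which the leading 1 of \<open>emp_cf\<close> cancels. The product majorant
  \<open>g\<close> justifies Fubini.\<close>

lemma emp_cf_option_fun:
  assumes mart: "expectation (\<lambda>\<omega>. exp (Y \<omega>)) = 1"
  shows "emp_cf (option_fun M Y) u = (LINT \<omega>|M. exp ((1 + \<i> * of_real u) * of_real (Y \<omega>)))"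
proof -
  interpret L: pair_sigma_finite M "lborel :: real measure" ..
  define f where "f \<omega> x = iexp (u * x) * of_real (payoff (Y \<omega>) x)" for \<omega> x
  define g where "g \<omega> x = (1 + exp (2 * Y \<omega>)) * exp (- \<bar>x\<bar>)" for \<omega> and x :: real
  have g: "integrable (M \<Otimes>\<^sub>M lborel) (case_prod g)"
  proof (rule L.Fubini_integrable)
    show "case_prod g \<in> borel_measurable (M \<Otimes>\<^sub>M lborel)" unfolding g_def by measurable
    show "AE \<omega> in M. integrable lborel (\<lambda>x. case_prod g (\<omega>, x))"
      using has_bochner_integral_exp_neg_abs by (auto simp: has_bochner_integral_iff g_def)
    have "(LINT x|lborel. norm (case_prod g (\<omega>, x))) = (1 + exp (2 * Y \<omega>)) * 2" for \<omega>
      using has_bochner_integral_exp_neg_abs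
      by (auto simp: has_bochner_integral_iff g_def abs_mult add_nonneg_nonneg)
    then show "integrable M (\<lambda>\<omega>. LINT x|lborel. norm (case_prod g (\<omega>, x)))" using int by simp
  qed
  have f: "integrable (M \<Otimes>\<^sub>M lborel) (case_prod f)"
  proof (rule Bochner_Integration.integrable_bound[OF g])
    show "case_prod f \<in> borel_measurable (M \<Otimes>\<^sub>M lborel)" unfolding f_def payoff_def by measurable
    show "AE z in M \<Otimes>\<^sub>M lborel. norm (case_prod f z) \<le> norm (case_prod g z)"
      using payoff_le payoff_nonneg
      by (intro AE_I2) (auto simp: f_def g_def norm_mult add_nonneg_nonneg abs_mult)
  qed
  have "fourier (option_fun M Y) u = (LINT x|lborel. LINT \<omega>|M. f \<omega> x)"
    unfolding fourier_def option_fun_eq f_def by simp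
  also have "\<dots> = (LINT \<omega>|M. LINT x|lborel. f \<omega> x)"
    by (rule L.Fubini_integral[OF f])
  finally have "\<i> * u * (1 + \<i> * u) * fourier (option_fun M Y) u
      = (LINT \<omega>|M. \<i> * u * (1 + \<i> * u) * (LINT x|lborel. f \<omega> x))"
    by simp
  also have "\<dots> = (LINT \<omega>|M. exp ((1 + \<i> * u) * of_real (Y \<omega>)) - (1 + \<i> * u) * of_real (exp (Y \<omega>)) + \<i> * u)"
    unfolding f_def fourier_payoff by (simp add: exp_of_real)
  also have "\<dots> = (LINT \<omega>|M. exp ((1 + \<i> * u) * of_real (Y \<omega>))) - (1 + \<i> * u) + \<i> * u"
  proof -
    have "integrable M (\<lambda>\<omega>. exp ((1 + \<i> * u) * of_real (Y \<omega>)))"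
      by (rule Bochner_Integration.integrable_bound[OF exp_integrable]) auto
    moreover have "integrable M (\<lambda>\<omega>. (1 + \<i> * u) * complex_of_real (exp (Y \<omega>)))"
      using exp_integrable by (intro integrable_mult_right integrable_of_real)
    ultimately show ?thesis using mart by (simp add: prob_space del: of_real_exp)
  qed
  finally show ?thesis unfolding emp_cf_def by (simp add: algebra_simps)
qed

end

end

section \<open>Linear interpolation of the option function\<close>

definition lin_interp :: "(real \<Rightarrow> real) \<Rightarrow> real \<Rightarrow> real \<Rightarrow> real \<Rightarrow> real" where
  "lin_interp f a b y = (f a * (b - y) + f b * (y - a)) / (b - a)"

lemma lin_interp_add: "lin_interp (\<lambda>x. f x + g x) a b y = lin_interp f a b y + lin_interp g a b y"
  by (simp add: lin_interp_def algebra_simps add_divide_distrib[symmetric])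

text \<open>The error equals ((f b - f y)(y - a) - (f y - f a)(b - y)) / (b - a), so the oscillation
  of slopes controls it. No second derivative enters, which allows for the kink of the payoff, and
  bounds of this kind can be summed over cells by telescoping.\<close>

lemma lin_interp_error_slopes:
  fixes f :: "real \<Rightarrow> real"
  assumes ab: "a < b" and y: "y \<in> {a..b}"
    and slope: "\<And>p q. a \<le> p \<Longrightarrow> p \<le> q \<Longrightarrow> q \<le> b \<Longrightarrow> m * (q - p) \<le> f q - f p \<and> f q - f p \<le> K * (q - p)"
  shows "\<bar>lin_interp f a b y - f y\<bar> \<le> (K - m) * (b - a)"
proof -
  have s1: "m * (y - a) \<le> f y - f a" "f y - f a \<le> K * (y - a)" using slope[of a y] y by auto
  have s2: "m * (b - y) \<le> f b - f y" "f b - f y \<le> K * (b - y)" using slope[of y b] y by auto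
  have Km: "0 \<le> K - m"
  proof -
    have "m * (b - a) \<le> K * (b - a)" using slope[of a b] ab by (meson order_refl order_trans less_imp_le)
    then have "m \<le> K" using ab by (intro mult_right_le_imp_le[of m "b - a" K]) auto
    then show ?thesis by simp
  qed
  have e: "lin_interp f a b y - f y = ((f b - f y) * (y - a) - (f y - f a) * (b - y)) / (b - a)"
    using ab by (simp add: lin_interp_def field_simps)
  have q: "0 \<le> y - a" "0 \<le> b - y" using y by auto
  have up: "(f b - f y) * (y - a) - (f y - f a) * (b - y) \<le> (K - m) * ((b - y) * (y - a))"
  proof -
    have "(f b - f y) * (y - a) \<le> K * (b - y) * (y - a)" using s2 q by (intro mult_right_mono)
    moreover have "m * (y - a) * (b - y) \<le> (f y - f a) * (b - y)" using s1 q by (intro mult_right_mono)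
    ultimately show ?thesis by (simp add: algebra_simps)
  qed
  have lo: "- ((K - m) * ((b - y) * (y - a))) \<le> (f b - f y) * (y - a) - (f y - f a) * (b - y)"
  proof -
    have "m * (b - y) * (y - a) \<le> (f b - f y) * (y - a)" using s2 q by (intro mult_right_mono)
    moreover have "(f y - f a) * (b - y) \<le> K * (y - a) * (b - y)" using s1 q by (intro mult_right_mono)
    ultimately show ?thesis by (simp add: algebra_simps)
  qed
  have "\<bar>lin_interp f a b y - f y\<bar> \<le> (K - m) * ((b - y) * (y - a)) / (b - a)"
    unfolding e using up lo ab by (simp add: abs_le_iff divide_le_cancel)
  also have "\<dots> \<le> (K - m) * ((b - a) * (b - a)) / (b - a)"
    using Km q ab by (intro divide_right_mono mult_left_mono mult_mono) auto
  also have "\<dots> = (K - m) * (b - a)" using ab by simp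
  finally show ?thesis .
qed

lemma exp_slope:
  fixes p q :: real
  assumes "p \<le> q"
  shows "exp p * (q - p) \<le> exp q - exp p" "exp q - exp p \<le> exp q * (q - p)"
proof -
  have "exp p * (1 + (q - p)) \<le> exp p * exp (q - p)" by (intro mult_left_mono exp_ge_add_one_self) simp
  then show "exp p * (q - p) \<le> exp q - exp p" by (simp add: exp_add[symmetric] algebra_simps)
  have "exp q * (1 + (p - q)) \<le> exp q * exp (p - q)" by (intro mult_left_mono exp_ge_add_one_self) simp
  then show "exp q - exp p \<le> exp q * (q - p)" by (simp add: exp_add[symmetric] algebra_simps)
qed

text \<open>
  On a cell of length at most 1, the slope of \<open>\<lambda>x. max (exp y - exp x) 0\<close> varies by at most the increment of this
  bounded nondecreasing function of \<open>t\<close>; its jump at \<open>y\<close> accounts for the cell containing the kink.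
\<close>

definition call_slope :: "real \<Rightarrow> real \<Rightarrow> real" where
  "call_slope y t = min (exp t) (exp y) + 3 * exp y * (if y \<le> t then 1 else 0)"

lemma call_slope_bounds: "0 \<le> call_slope y t" "call_slope y t \<le> 4 * exp y"
proof -
  show "0 \<le> call_slope y t" by (simp add: call_slope_def)
  have "min (exp t) (exp y) \<le> exp y" by simp
  then show "call_slope y t \<le> 4 * exp y"
  proof -
    have "3 * exp y * (if y \<le> t then 1 else 0) \<le> 3 * exp y" by simp
    then show ?thesis using \<open>min (exp t) (exp y) \<le> exp y\<close> unfolding call_slope_def by linarith
  qed
qed

lemma lin_interp_error_call:
  fixes y :: real
  assumes ab: "a < b" "b \<le> a + 1" and p: "p \<in> {a..b}"
  shows "\<bar>lin_interp (\<lambda>x. max (exp y - exp x) 0) a b p - max (exp y - exp p) 0\<bar>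
      \<le> (call_slope y b - call_slope y a) * (b - a)"
proof -
  \<comment> \<open>The slope is -exp x left of the kink \<open>y\<close> and 0 right of it. The
    upper bound \<open>?K\<close> is negative only if the whole cell lies left of \<open>y\<close>,
    the lower bound \<open>?m\<close> is 0 only if it lies right of \<open>y\<close>.\<close>
  let ?K = "- exp a * (if b \<le> y then 1 else 0)" and ?m = "- exp b * (if a < y then 1 else 0)"
  have "\<bar>lin_interp (\<lambda>x. max (exp y - exp x) 0) a b p - max (exp y - exp p) 0\<bar> \<le> (?K - ?m) * (b - a)"
  proof (rule lin_interp_error_slopes[OF ab(1) p])
    fix p q assume pq: "a \<le> p" "p \<le> q" "q \<le> b"
    have "exp a * (q - p) \<le> exp p * (q - p)" using pq by (intro mult_right_mono) auto
    then have e1: "exp a * (q - p) \<le> exp q - exp p" using exp_slope(1)[OF pq(2)] by linarith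
    have "exp q * (q - p) \<le> exp b * (q - p)" using pq by (intro mult_right_mono) auto
    then have e2: "exp q - exp p \<le> exp b * (q - p)" using exp_slope(2)[OF pq(2)] by linarith
    have pos: "0 \<le> exp b * (q - p)" using pq by simp
    have epq: "exp p \<le> exp q" using pq by simp
    consider "y \<le> a" | "a < y" "y < b" | "b \<le> y" by linarith
    then show "?m * (q - p) \<le> max (exp y - exp q) 0 - max (exp y - exp p) 0 \<and>
        max (exp y - exp q) 0 - max (exp y - exp p) 0 \<le> ?K * (q - p)"
    proof cases
      case 1
      then have "exp y \<le> exp p" "exp y \<le> exp q" using pq by auto
      then show ?thesis using 1 ab by simp
    next
      case 2
      have "max (c - B) 0 \<le> max (c - A) 0 \<and> max (c - A) 0 - max (c - B) 0 \<le> B - A"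
        if "A \<le> B" for A B c :: real using that by auto
      from this[OF epq, of "exp y"] show ?thesis using 2 e2 by auto
    next
      case 3
      then have "exp p \<le> exp y" "exp q \<le> exp y" using pq by auto
      then show ?thesis using 3 ab e1 e2 by (simp add: max_def)
    qed
  qed
  also have "\<dots> \<le> (call_slope y b - call_slope y a) * (b - a)"
  proof (rule mult_right_mono)
    consider "y \<le> a" | "a < y" "y < b" | "b \<le> y" by linarith
    then show "?K - ?m \<le> call_slope y b - call_slope y a"
    proof cases
      case 1
      then show ?thesis using ab by (simp add: call_slope_def)
    next
      case 2
      \<comment> \<open>The cell contains the kink: its length is at most 1 and exp 1 \<le> 3, so
        the jump 3 exp y built into \<open>call_slope\<close> pays for the change of slope.\<close>
      have "exp b \<le> exp (1 + y)" using 2 ab by simp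
      also have "\<dots> \<le> 3 * exp y" unfolding exp_add using exp_le by (intro mult_right_mono) auto
      finally have "exp b \<le> 3 * exp y" .
      moreover have "exp a \<le> exp y" using 2 by simp
      moreover have "call_slope y b = 4 * exp y" "call_slope y a = exp a" "?K - ?m = exp b"
        using 2 by (auto simp: call_slope_def min_def)
      ultimately show ?thesis by linarith
    next
      case 3
      then show ?thesis using ab by (simp add: call_slope_def)
    qed
  qed (use ab in simp)
  finally show ?thesis .
qed

text \<open>
  The kink function is the interpolation error of \<open>\<lambda>x. min x 0\<close> (lemma \<open>kink_fun_cell\<close>). By put-call parity
  the option function minus \<open>min x 0\<close> is the call price plus this remainder.
\<close>

definition put_rem :: "real \<Rightarrow> real" where
  "put_rem x = (if x < 0 then exp x - 1 - x else 0)"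

text \<open>\<open>put_rem\<close> is convex with derivative \<open>min (exp x - 1) 0\<close>, so
  its slopes in a cell lie between the end values of that derivative, again a bounded nondecreasing
  function.\<close>

lemma lin_interp_error_put_rem:
  assumes ab: "a < b" and p: "p \<in> {a..b}"
  shows "\<bar>lin_interp put_rem a b p - put_rem p\<bar> \<le> (min (exp b - 1) 0 - min (exp a - 1) 0) * (b - a)"
proof (rule lin_interp_error_slopes[OF ab p])
  have neg: "min (exp a - 1) 0 * (q - p) \<le> put_rem q - put_rem p \<and> put_rem q - put_rem p \<le> min (exp b - 1) 0 * (q - p)"
    if "a \<le> p" "p \<le> q" "q \<le> b" "q \<le> 0" for p q
  proof -
    have "put_rem t = exp t - 1 - t" if "t \<le> 0" for t
      using that by (cases "t = 0") (auto simp: put_rem_def)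
    then have pr: "put_rem q = exp q - 1 - q" "put_rem p = exp p - 1 - p" using that by auto
    have "exp a * (q - p) \<le> exp p * (q - p)" using that by (intro mult_right_mono) auto
    then have e1: "(exp a - 1) * (q - p) \<le> put_rem q - put_rem p"
      using exp_slope(1)[OF that(2)] unfolding pr by (simp add: algebra_simps)
    have "exp q * (q - p) \<le> min (exp b) 1 * (q - p)" using that by (intro mult_right_mono) auto
    then have "put_rem q - put_rem p \<le> (min (exp b) 1 - 1) * (q - p)"
      using exp_slope(2)[OF that(2)] unfolding pr by (simp add: algebra_simps)
    moreover have "min (exp b) 1 - 1 = min (exp b - 1) 0" by auto
    moreover have "min (exp a - 1) 0 * (q - p) \<le> (exp a - 1) * (q - p)" using that by (intro mult_right_mono) auto
    ultimately show ?thesis using e1 by auto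
  qed
  fix p q assume pq: "a \<le> p" "p \<le> q" "q \<le> b"
  consider "q \<le> 0" | "0 \<le> p" | "p < 0" "0 < q" by linarith
  then show "min (exp a - 1) 0 * (q - p) \<le> put_rem q - put_rem p \<and> put_rem q - put_rem p \<le> min (exp b - 1) 0 * (q - p)"
  proof cases
    case 1 then show ?thesis using neg pq by blast
  next
    case 2
    then have "min (exp a - 1) 0 * (q - p) \<le> 0" using pq by (intro mult_nonpos_nonneg) auto
    then show ?thesis using 2 pq by (simp add: put_rem_def)
  next
    case 3
    have "min (exp a - 1) 0 * (q - p) \<le> min (exp a - 1) 0 * (0 - p)"
      using 3 by (intro mult_left_mono_neg) auto
    then show ?thesis using neg[of p 0] 3 pq by (auto simp: put_rem_def)
  qed
qed

section \<open>Design points, kink function and hat functions\<close>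

lemma design_strict_mono:
  assumes "design N x \<delta>" "i < j" "j \<le> N + 1"
  shows "x i < x j"
  using assms(2,3)
proof (induction j)
  case (Suc j)
  then have "x j < x (Suc j)" using assms(1) by (simp add: design_def)
  then show ?case using Suc by (cases "i = j") auto
qed simp

lemma design_mono:
  assumes "design N x \<delta>" "i \<le> j" "j \<le> N + 1"
  shows "x i \<le> x j"
  using design_strict_mono[OF assms(1), of i j] assms(2,3) by (cases "i = j") auto

lemma design_spacing:
  assumes "design N x \<delta>" "1 \<le> i" "i \<le> N + 1"
  shows "x i - x (i - 1) \<le> mesh N x"
proof -
  consider "i = 1" | "i = N + 1" | "i \<in> {2..N}" using assms by force
  then show ?thesis
  proof cases
    case 3
    then show ?thesis unfolding mesh_def by (intro Max_ge) auto
  qed (use assms in \<open>auto simp: design_def\<close>)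
qed

lemma mesh_pos:
  assumes "design N x \<delta>"
  shows "0 < mesh N x"
  using design_spacing[OF assms, of 1] design_strict_mono[OF assms, of 0 1] by simp

lemma design_cell:
  assumes "design N x \<delta>" "x 0 \<le> y" "y < x (N + 1)"
  obtains i where "1 \<le> i" "i \<le> N + 1" "x (i - 1) \<le> y" "y < x i"
proof -
  define i where "i = (LEAST i. y < x i)"
  have 1: "y < x i" "\<And>j. j < i \<Longrightarrow> x j \<le> y" "i \<le> N + 1"
    unfolding i_def using assms(3) by (auto intro: LeastI Least_le dest: not_less_Least)
  then have "i \<noteq> 0" using assms(2) by (auto intro!: Nat.gr0I)
  then show thesis using 1 that[of i] by auto
qed

lemma node_index:
  assumes D: "design N x \<delta>"
  shows "1 \<le> node_index N x" "node_index N x \<le> N + 1" "x (node_index N x - 1) < 0" "0 \<le> x (node_index N x)"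
proof -
  define P where "P j \<longleftrightarrow> 1 \<le> j \<and> j \<le> N + 1 \<and> x (j - 1) < 0 \<and> 0 \<le> x j" for j
  define i where "i = (LEAST i. 0 \<le> x i)"
  have x0: "x 0 < 0" "0 \<le> x (N + 1)" using D by (auto simp: design_def)
  have i: "0 \<le> x i" "\<And>j. j < i \<Longrightarrow> x j < 0" "i \<le> N + 1"
    unfolding i_def using x0(2) by (auto intro: LeastI Least_le dest: not_less_Least)
  then have "i \<noteq> 0" using x0 by (metis not_less)
  with i have P: "P i" by (auto simp: P_def)
  moreover have "j = i" if "P j" for j
  proof (rule ccontr)
    assume "j \<noteq> i"
    then consider "j \<le> i - 1" | "i \<le> j - 1" by linarith
    then show False
    proof cases
      case 1 then show False using design_mono[OF D, of j "i - 1", OF _ le_trans[OF diff_le_self i(3)]] that P by (auto simp: P_def)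
    next
      case 2 then show False using design_mono[OF D, of i "j - 1", OF _ le_trans[OF diff_le_self]] that P by (auto simp: P_def)
    qed
  qed
  ultimately have "P (THE j. P j)" by (rule theI)
  then show "1 \<le> node_index N x" "node_index N x \<le> N + 1" "x (node_index N x - 1) < 0" "0 \<le> x (node_index N x)"
    by (auto simp: P_def node_index_def)
qed

text \<open>For b = 0 the first entry of the minimum is 0, so the formula also covers the convention
  that the kink function then vanishes.\<close>

lemma kink_fun_eq:
  assumes "a < 0" "0 \<le> b"
  shows "kink_fun a b = (\<lambda>y. max 0 (min (b * (y - a) / (b - a)) (a * (y - b) / (b - a))))"
proof (cases "b = 0")
  case True
  then show ?thesis using assms by (auto simp: kink_fun_def fun_eq_iff)
next
  case False
  then have "0 < b" using assms by simp
  have "kink_spec a b = (\<lambda>f. f = (\<lambda>y. max 0 (min (b * (y - a) / (b - a)) (a * (y - b) / (b - a)))))"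
    using kink_spec_iff[OF assms(1) \<open>0 < b\<close>] by (intro ext)
  then show ?thesis using False by (simp add: kink_fun_def)
qed

text \<open>\<open>min y 0\<close> has slope jump -1 at 0, the jump prescribed for the kink;
  subtracting its chord makes it vanish at both ends of the cell.\<close>

lemma kink_fun_interp:
  assumes "a < 0" "0 \<le> b" "y \<in> {a..b}"
  shows "kink_fun a b y = min y 0 - lin_interp (\<lambda>t. min t 0) a b y"
proof -
  have "b * (y - a) / (b - a) - a * (y - b) / (b - a) = (y * (b - a)) / (b - a)"
    unfolding diff_divide_distrib[symmetric] by (simp add: algebra_simps)
  then have d: "b * (y - a) / (b - a) - a * (y - b) / (b - a) = y" using assms by simp
  have p: "0 \<le> b * (y - a) / (b - a)" using assms by (intro divide_nonneg_nonneg mult_nonneg_nonneg) auto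
  have q: "0 \<le> a * (y - b) / (b - a)" using assms by (intro divide_nonneg_nonneg mult_nonpos_nonpos) auto
  have r: "lin_interp (\<lambda>t. min t 0) a b y = - (a * (y - b) / (b - a))"
    using assms by (simp add: lin_interp_def min_def minus_divide_left algebra_simps)
  have "max 0 (min P Q) = min y 0 - (- Q)" if "P - Q = y" "0 \<le> P" "0 \<le> Q" for P Q :: real
    using that by auto
  from this[OF d p q] show ?thesis unfolding kink_fun_eq[OF assms(1,2)] r .
qed

lemma kink_fun_bounds:
  assumes "a < 0" "0 \<le> b" "y \<le> b"
  shows "0 \<le> kink_fun a b y" "kink_fun a b y \<le> b - a"
proof -
  have "b * (y - a) / (b - a) \<le> b * (b - a) / (b - a)"
    using assms by (intro divide_right_mono mult_left_mono) auto
  also have "\<dots> = b" using assms by simp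
  finally show "kink_fun a b y \<le> b - a" unfolding kink_fun_eq[OF assms(1,2)] using assms by auto
qed (simp add: kink_fun_eq[OF assms(1,2)])

lemma kink_fun_outside:
  assumes "a < 0" "0 \<le> b" "y \<le> a \<or> b \<le> y"
  shows "kink_fun a b y = 0"
proof -
  have "b * (y - a) / (b - a) \<le> 0 \<or> a * (y - b) / (b - a) \<le> 0"
    using assms(3)
  proof
    assume "y \<le> a"
    then have "b * (y - a) / (b - a) \<le> 0"
      using assms by (intro divide_nonpos_nonneg mult_nonneg_nonpos) auto
    then show ?thesis ..
  next
    assume "b \<le> y"
    then have "a * (y - b) / (b - a) \<le> 0"
      using assms by (intro divide_nonpos_nonneg mult_nonpos_nonneg) auto
    then show ?thesis ..
  qed
  then show ?thesis unfolding kink_fun_eq[OF assms(1,2)] by auto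
qed

lemma lin_interp_linear:
  assumes "a < b" "f a = c * a" "f b = c * b"
  shows "lin_interp f a b y = c * y"
proof -
  have "f a * (b - y) + f b * (y - a) = c * y * (b - a)" using assms by (simp add: algebra_simps)
  then show ?thesis using assms by (simp add: lin_interp_def)
qed

text \<open>Off the cell of \<open>node_index\<close> the function \<open>min t 0\<close> is linear
  on the cell and both sides vanish. Hence kink plus hat interpolation amounts to interpolating the
  option function minus \<open>min x 0\<close>, from which the deterministic kink at 0 has been
  removed.\<close>

lemma kink_fun_cell:
  assumes D: "design N x \<delta>" and i: "1 \<le> i" "i \<le> N + 1" and y: "x (i - 1) \<le> y" "y \<le> x i"
  shows "kink_fun (x (node_index N x - 1)) (x (node_index N x)) y
    = min y 0 - lin_interp (\<lambda>t. min t 0) (x (i - 1)) (x i) y"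
proof -
  note n = node_index[OF D]
  let ?j = "node_index N x"
  have lt: "x (i - 1) < x i" using design_strict_mono[OF D, of "i - 1" i] i by simp
  consider "i = ?j" | "i \<le> ?j - 1" | "?j \<le> i - 1" by linarith
  then show ?thesis
  proof cases
    case 1 then show ?thesis using kink_fun_interp[OF n(3,4)] y by simp
  next
    case 2
    then have b: "x i \<le> x (?j - 1)" using n(1,2) by (intro design_mono[OF D]) auto
    then have "lin_interp (\<lambda>t. min t 0) (x (i - 1)) (x i) y = 1 * y"
      using n(3) lt by (intro lin_interp_linear) auto
    then show ?thesis using kink_fun_outside[OF n(3,4)] b n(3) y by simp
  next
    case 3
    then have b: "x ?j \<le> x (i - 1)" using n(1,2) i by (intro design_mono[OF D]) auto
    then have "lin_interp (\<lambda>t. min t 0) (x (i - 1)) (x i) y = 0 * y"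
      using n(4) lt by (intro lin_interp_linear) auto
    then show ?thesis using kink_fun_outside[OF n(3,4)] b n(4) y by simp
  qed
qed

lemma hat_fun_bounds:
  assumes D: "design N x \<delta>" and j: "j \<in> {1..N}"
  shows "0 \<le> hat_fun x j y" "hat_fun x j y \<le> indicator {x (j - 1)..x (j + 1)} y"
proof -
  have lt: "x (j - 1) < x j" "x j < x (j + 1)"
    using design_strict_mono[OF D, of "j - 1" j] design_strict_mono[OF D, of j "j + 1"] j by auto
  then have "0 \<le> hat_fun x j y \<and> hat_fun x j y \<le> indicator {x (j - 1)..x (j + 1)} y"
    by (auto simp: hat_fun_def indicator_def divide_le_eq_1)
  then show "0 \<le> hat_fun x j y" "hat_fun x j y \<le> indicator {x (j - 1)..x (j + 1)} y" by auto
qed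

text \<open>On a cell only the hats of its two endpoints survive. The auxiliary nodes 0 and N + 1
  carry no observation, so in the first and the last cell one endpoint value is replaced by
  0.\<close>

lemma sum_hat_fun_cell:
  assumes D: "design N x \<delta>" and i: "1 \<le> i" "i \<le> N + 1" and y: "x (i - 1) \<le> y" "y < x i"
  shows "(\<Sum>j=1..N. c j * hat_fun x j y) =
    ((if i = 1 then 0 else c (i - 1)) * (x i - y) + (if i = N + 1 then 0 else c i) * (y - x (i - 1))) / (x i - x (i - 1))"
proof -
  have N: "2 \<le> N" using D by (simp add: design_def)
  have lt: "x (i - 1) < x i" using design_strict_mono[OF D, of "i - 1" i] i by simp
  have 0: "hat_fun x j y = 0" if "j \<in> {1..N}" "j \<noteq> i" "j \<noteq> i - 1" for j
  proof -
    consider "j + 1 \<le> i - 1" | "i \<le> j - 1" using \<open>j \<noteq> i\<close> \<open>j \<noteq> i - 1\<close> i that(1) by (auto; linarith)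
    then show ?thesis
    proof cases
      case 1
      then have "x (j + 1) \<le> y" "x j < x (j + 1)"
        using design_mono[OF D, of "j + 1" "i - 1", OF _ le_trans[OF diff_le_self i(2)]] design_strict_mono[OF D, of j "j + 1"] i y by auto
      then show ?thesis by (auto simp: hat_fun_def indicator_def)
    next
      case 2
      then have "y < x (j - 1)" "x (j - 1) < x j" using design_mono[OF D, of i "j - 1", OF _ le_trans[OF diff_le_self]] design_strict_mono[OF D, of "j - 1" j] that y by auto
      then show ?thesis by (auto simp: hat_fun_def indicator_def)
    qed
  qed
  have hi: "hat_fun x i y = (y - x (i - 1)) / (x i - x (i - 1))"
    using y by (auto simp: hat_fun_def indicator_def)
  have hp: "hat_fun x (i - 1) y = (x i - y) / (x i - x (i - 1))" if "i \<noteq> 1"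
    using y lt i that by (auto simp: hat_fun_def indicator_def)
  have "(\<Sum>j=1..N. c j * hat_fun x j y) = (\<Sum>j\<in>{i - 1, i} \<inter> {1..N}. c j * hat_fun x j y)"
    by (rule sum.mono_neutral_right) (auto intro: 0)
  also have "\<dots> = (if i = 1 then 0 else c (i - 1) * hat_fun x (i - 1) y) + (if i = N + 1 then 0 else c i * hat_fun x i y)"
  proof -
    consider "i = 1" | "i = N + 1" | "i \<noteq> 1" "i \<noteq> N + 1" by blast
    then show ?thesis
    proof cases
      case 1 then have "{i - 1, i} \<inter> {1..N} = {1}" using N by auto
      then show ?thesis using 1 N by simp
    next
      case 2 then have "{i - 1, i} \<inter> {1..N} = {N}" using N by auto
      then show ?thesis using 2 N by simp
    next
      case 3 then have "{i - 1, i} \<inter> {1..N} = {i - 1, i}" "i - 1 \<noteq> i" using i by auto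
      then show ?thesis using 3 by simp
    qed
  qed
  finally show ?thesis using hi hp N by (auto simp: add_divide_distrib)
qed

lemma sum_hat_fun_outside:
  assumes D: "design N x \<delta>" and y: "y < x 0 \<or> x (N + 1) \<le> y"
  shows "(\<Sum>j=1..N. c j * hat_fun x j y) = 0"
proof (rule sum.neutral, intro ballI)
  fix j assume j: "j \<in> {1..N}"
  have m: "x 0 \<le> x (j - 1)" "x (j - 1) < x j" "x j < x (j + 1)" "x (j + 1) \<le> x (N + 1)"
    using design_mono[OF D, of 0 "j - 1"] design_mono[OF D, of "j + 1" "N + 1"]
      design_strict_mono[OF D, of "j - 1" j] design_strict_mono[OF D, of j "j + 1"] j by auto
  then have "hat_fun x j y = 0" using y by (auto simp: hat_fun_def indicator_def)
  then show "c j * hat_fun x j y = 0" by simp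
qed

lemma hat_fun_measurable [measurable]: "hat_fun x j \<in> borel_measurable borel"
  unfolding hat_fun_def[abs_def] by measurable

lemma interpolant_measurable:
  assumes D: "design N x \<delta>"
  shows "interpolant N x c \<in> borel_measurable borel"
  unfolding interpolant_def[abs_def] kink_fun_eq[OF node_index(3,4)[OF D]] by measurable

section \<open>Interpolation error of the option function\<close>

context prob_space
begin

lemma option_fun_decomposition:
  fixes Y :: "'a \<Rightarrow> real"
  assumes Y [measurable]: "random_variable borel Y"
    and int: "integrable M (\<lambda>\<omega>. exp (Y \<omega>))" and mart: "expectation (\<lambda>\<omega>. exp (Y \<omega>)) = 1"
  shows "option_fun M Y x - min x 0 = expectation (\<lambda>\<omega>. max (exp (Y \<omega>) - exp x) 0) + put_rem x"
proof -
  have int_call: "integrable M (\<lambda>\<omega>. max (exp (Y \<omega>) - exp x) 0)"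
    by (rule Bochner_Integration.integrable_bound[OF int]) (auto intro!: AE_I2)
  show ?thesis
  proof (cases "0 \<le> x")
    case True
    then show ?thesis by (simp add: option_fun_def put_rem_def)
  next
    case False
    have "max (exp x - exp y) 0 = max (exp y - exp x) 0 + (exp x - exp y)" for y :: real by auto
    then have "option_fun M Y x = expectation (\<lambda>\<omega>. max (exp (Y \<omega>) - exp x) 0 + (exp x - exp (Y \<omega>)))"
      using False by (simp add: option_fun_def)
    also have "\<dots> = expectation (\<lambda>\<omega>. max (exp (Y \<omega>) - exp x) 0) + (exp x - 1)"
      using int int_call mart by (simp add: prob_space)
    finally show ?thesis using False by (simp add: put_rem_def)
  qed
qed

text \<open>The pathwise bound is the increment of a function of the cell endpoints, a form that
  survives taking expectations whatever the law of \<open>Y\<close> is; atoms only make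
  \<open>G\<close> jump.\<close>

lemma interpolation_error_cell:
  fixes Y :: "'a \<Rightarrow> real"
  assumes Y [measurable]: "random_variable borel Y"
    and int: "integrable M (\<lambda>\<omega>. exp (Y \<omega>))" and mart: "expectation (\<lambda>\<omega>. exp (Y \<omega>)) = 1"
    and ab: "a < b" "b \<le> a + 1" and p: "p \<in> {a..b}"
  defines "G \<equiv> \<lambda>t. expectation (\<lambda>\<omega>. call_slope (Y \<omega>) t) + min (exp t - 1) 0"
  shows "\<bar>lin_interp (\<lambda>x. option_fun M Y x - min x 0) a b p - (option_fun M Y p - min p 0)\<bar> \<le> (G b - G a) * (b - a)"
proof -
  define C where "C x = expectation (\<lambda>\<omega>. max (exp (Y \<omega>) - exp x) 0)" for x
  have int_call: "integrable M (\<lambda>\<omega>. max (exp (Y \<omega>) - exp x) 0)" for x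
    by (rule Bochner_Integration.integrable_bound[OF int]) (auto intro!: AE_I2)
  have int_slope: "integrable M (\<lambda>\<omega>. call_slope (Y \<omega>) t)" for t
  proof (rule Bochner_Integration.integrable_bound)
    show "integrable M (\<lambda>\<omega>. 4 * exp (Y \<omega>))" using int by simp
    show "(\<lambda>\<omega>. call_slope (Y \<omega>) t) \<in> borel_measurable M" unfolding call_slope_def by measurable
  qed (use call_slope_bounds in \<open>auto intro!: AE_I2\<close>)
  have dec: "(\<lambda>x. option_fun M Y x - min x 0) = (\<lambda>x. C x + put_rem x)"
    using option_fun_decomposition[OF Y int mart] by (auto simp: C_def)
  let ?e = "\<lambda>\<omega>. lin_interp (\<lambda>x. max (exp (Y \<omega>) - exp x) 0) a b p - max (exp (Y \<omega>) - exp p) 0"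
  have "lin_interp C a b p - C p = expectation ?e"
    unfolding lin_interp_def C_def using int_call by simp
  then have "\<bar>lin_interp C a b p - C p\<bar> \<le> expectation (\<lambda>\<omega>. \<bar>?e \<omega>\<bar>)"
    by (simp only: integral_abs_bound)
  also have "\<dots> \<le> expectation (\<lambda>\<omega>. (call_slope (Y \<omega>) b - call_slope (Y \<omega>) a) * (b - a))"
  proof (rule integral_mono)
    show "integrable M (\<lambda>\<omega>. \<bar>?e \<omega>\<bar>)"
      unfolding lin_interp_def
      by (intro integrable_abs Bochner_Integration.integrable_diff integrable_divide
          Bochner_Integration.integrable_add integrable_mult_left int_call)
    show "integrable M (\<lambda>\<omega>. (call_slope (Y \<omega>) b - call_slope (Y \<omega>) a) * (b - a))"
      using int_slope by simp
  qed (rule lin_interp_error_call[OF ab p])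
  also have "\<dots> = (expectation (\<lambda>\<omega>. call_slope (Y \<omega>) b) - expectation (\<lambda>\<omega>. call_slope (Y \<omega>) a)) * (b - a)"
    using int_slope by simp
  finally have call: "\<bar>lin_interp C a b p - C p\<bar>
      \<le> (expectation (\<lambda>\<omega>. call_slope (Y \<omega>) b) - expectation (\<lambda>\<omega>. call_slope (Y \<omega>) a)) * (b - a)" .
  have split: "(A + A' - (B + B')) * h = (A - B) * h + (A' - B') * h" for A A' B B' h :: real
    by (simp add: algebra_simps)
  show ?thesis
    using call lin_interp_error_put_rem[OF ab(1) p]
    unfolding fun_cong[OF dec] dec lin_interp_add G_def split by linarith
qed

end

lemma integral_exp_neg_abs_shift:
  fixes c :: real
  shows "has_bochner_integral lborel (\<lambda>y. exp (- \<bar>y - c\<bar>)) 2"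
  using has_bochner_integral_exp_neg_abs
  unfolding lborel_has_bochner_integral_real_affine_iff[of 1 "\<lambda>y::real. exp (- \<bar>y\<bar>)" _ "- c", simplified]
  by simp

lemma integrable_indicator_Ico:
  fixes a b :: real
  shows "integrable lborel (indicator {a..<b} :: real \<Rightarrow> real)"
  by (cases "a \<le> b") (auto intro!: integrable_real_indicator)

lemma exp_neg_abs_le_shift:
  fixes y c :: real
  shows "y \<le> c \<Longrightarrow> exp (- \<bar>y\<bar>) \<le> exp c * exp (- \<bar>y - c\<bar>)"
    and "c \<le> y \<Longrightarrow> exp (- \<bar>y\<bar>) \<le> exp (- c) * exp (- \<bar>y - c\<bar>)"
  by (auto simp: exp_add[symmetric])

text \<open>On a cell between design points the error is at most an increment of \<Gamma> times the
  mesh; integration over the cell gives a second factor mesh, and the increments telescope to at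
  most 4 - (-1) = 5. The two tails contribute 2 B each and the two boundary cells 1 + B each, which
  makes 2 + 6 B.\<close>

lemma interpolation_error:
  fixes Of \<Gamma> :: "real \<Rightarrow> real"
  assumes D: "design N x \<delta>" and mesh: "mesh N x \<le> 1"
    and meas [measurable]: "Of \<in> borel_measurable borel"
    and Of: "\<And>y. 0 \<le> Of y" "\<And>y. Of y \<le> B * exp (- \<bar>y\<bar>)" and B: "0 \<le> B"
    and cell: "\<And>a b p. a < b \<Longrightarrow> b \<le> a + 1 \<Longrightarrow> p \<in> {a..b} \<Longrightarrow>
      \<bar>lin_interp (\<lambda>x. Of x - min x 0) a b p - (Of p - min p 0)\<bar> \<le> (\<Gamma> b - \<Gamma> a) * (b - a)"
    and \<Gamma>: "\<And>t. -1 \<le> \<Gamma> t" "\<And>t. \<Gamma> t \<le> 4"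
  defines "E \<equiv> \<lambda>y. interpolant N x (\<lambda>j. Of (x j)) y - Of y"
  shows "integrable lborel E"
    and "(LINT y|lborel. \<bar>E y\<bar>) \<le> 5 * (mesh N x)\<^sup>2 + (2 + 6 * B) * exp (- range_param N x)"
proof -
  define d where "d = mesh N x"
  have N: "2 \<le> N" using D by (simp add: design_def)
  have d: "0 < d" "d \<le> 1" using mesh_pos[OF D] mesh by (auto simp: d_def)
  have lt: "x (i - 1) < x i" if "i \<in> {1..N+1}" for i using design_strict_mono[OF D, of "i - 1" i] that by auto
  have sp: "x i - x (i - 1) \<le> d" if "i \<in> {1..N+1}" for i using design_spacing[OF D, of i] that by (auto simp: d_def)
  note ni = node_index[OF D]
  let ?kink = "kink_fun (x (node_index N x - 1)) (x (node_index N x))"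
  define \<Delta> where "\<Delta> i = (\<Gamma> (x i) - \<Gamma> (x (i - 1))) * d" for i
  \<comment> \<open>The error bound itself forces \<Gamma> to be nondecreasing along the nodes,
    since it dominates an absolute value.\<close>
  have mono: "0 \<le> \<Gamma> (x i) - \<Gamma> (x (i - 1))" if i: "i \<in> {1..N+1}" for i
  proof -
    have "x i \<le> x (i - 1) + 1" "x i \<in> {x (i - 1)..x i}" using lt[OF i] sp[OF i] d by simp_all
    from order_trans[OF abs_ge_zero cell[OF lt[OF i] this]]
    have "0 \<le> (\<Gamma> (x i) - \<Gamma> (x (i - 1))) * (x i - x (i - 1))" .
    then show ?thesis using lt[OF i] by (simp add: zero_le_mult_iff)
  qed
  \<comment> \<open>Majorants: \<open>g0\<close> on the cells between design points,
    \<open>g1\<close> and \<open>g2\<close> for the option function beyond \<open>x 1\<close> and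
    \<open>x N\<close>, \<open>g3\<close> and \<open>g4\<close> for the interpolant in the two cells
    that have an auxiliary node.\<close>
  define g0 where "g0 y = (\<Sum>i=2..N. \<Delta> i * indicator {x (i - 1)..<x i} y)" for y
  define g1 where "g1 y = B * exp (x 1) * exp (- \<bar>y - x 1\<bar>)" for y
  define g2 where "g2 y = B * exp (- x N) * exp (- \<bar>y - x N\<bar>)" for y
  define g3 where "g3 y = (1 + B) * exp (x 1) * indicator {x 0..<x 1} y" for y
  define g4 where "g4 y = (1 + B) * exp (- x N) * indicator {x N..<x (N + 1)} y" for y
  define g where "g y = g0 y + g1 y + g2 y + g3 y + g4 y" for y
  have Of': "\<bar>Of y\<bar> \<le> B * exp (- \<bar>y\<bar>)" for y using Of by auto
  have g_ge: "0 \<le> g0 y" "0 \<le> g1 y" "0 \<le> g2 y" "0 \<le> g3 y" "0 \<le> g4 y" for y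
    unfolding g0_def g1_def g2_def g3_def g4_def
    using B mono d by (auto intro!: sum_nonneg mult_nonneg_nonneg simp: \<Delta>_def)
  have Oleft: "\<bar>Of y\<bar> \<le> g1 y" if "y \<le> x 1" for y
    unfolding g1_def
    using order_trans[OF Of' mult_left_mono[OF exp_neg_abs_le_shift(1)[OF that] B]] by (simp add: mult_ac)
  have Oright: "\<bar>Of y\<bar> \<le> g2 y" if "x N \<le> y" for y
    unfolding g2_def
    using order_trans[OF Of' mult_left_mono[OF exp_neg_abs_le_shift(2)[OF that] B]] by (simp add: mult_ac)
  have bound: "\<bar>E y\<bar> \<le> g y" for y
  proof -
    consider "y < x 0" | "x (N + 1) \<le> y" | "x 0 \<le> y" "y < x (N + 1)" by linarith
    then show ?thesis
    proof cases
      case 1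
      have "x 0 \<le> x (node_index N x - 1)" using ni(2) by (intro design_mono[OF D]) auto
      then have "interpolant N x (\<lambda>j. Of (x j)) y = 0"
        using sum_hat_fun_outside[OF D, of y] kink_fun_outside[OF ni(3,4), of y] 1
        by (auto simp: interpolant_def)
      moreover have "y \<le> x 1" using 1 lt[of 1] by simp
      ultimately show ?thesis using Oleft[of y] g_ge[of y] by (simp add: E_def g_def)
    next
      case 2
      have "x (node_index N x) \<le> x (N + 1)" using ni(2) by (intro design_mono[OF D]) auto
      then have "interpolant N x (\<lambda>j. Of (x j)) y = 0"
        using sum_hat_fun_outside[OF D, of y] kink_fun_outside[OF ni(3,4), of y] 2
        by (auto simp: interpolant_def)
      moreover have "x N \<le> y" using 2 lt[of "N + 1"] by simp
      ultimately show ?thesis using Oright[of y] g_ge[of y] by (simp add: E_def g_def)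
    next
      case 3
      obtain i where i: "1 \<le> i" "i \<le> N + 1" "x (i - 1) \<le> y" "y < x i"
        using design_cell[OF D 3] .
      have li: "x (i - 1) < x i" "x i - x (i - 1) \<le> d" using lt[of i] sp[of i] i by auto
      have kink: "?kink y = min y 0 - lin_interp (\<lambda>t. min t 0) (x (i - 1)) (x i) y"
        using kink_fun_cell[OF D i(1,2,3)] i(4) by simp
      note sum = sum_hat_fun_cell[OF D i, of "\<lambda>j. Of (x j)"]
      have k01: "0 \<le> ?kink y" "?kink y \<le> 1"
      proof -
        show "0 \<le> ?kink y" unfolding kink_fun_eq[OF ni(3,4)] by simp
        show "?kink y \<le> 1"
        proof (cases "y \<le> x (node_index N x)")
          case True
          then have "?kink y \<le> x (node_index N x) - x (node_index N x - 1)"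
            by (rule kink_fun_bounds(2)[OF ni(3,4)])
          then show ?thesis using sp[of "node_index N x"] ni d by auto
        next
          case False
          then have "?kink y = 0" by (intro kink_fun_outside ni) auto
          then show ?thesis by simp
        qed
      qed
      have "i = 1 \<or> i = N + 1 \<or> i \<in> {2..N}" using i(1,2) by auto
      then consider "i = 1" | "i = N + 1" | "i \<in> {2..N}" by blast
      then show ?thesis
      proof cases
        case 1
        have yr: "x 0 \<le> y" "y < x 1" using i 1 by auto
        \<comment> \<open>If 0 lies in the first cell then x 1 \<ge> 0 and the crude bound 1
          suffices; otherwise the kink is supported elsewhere.\<close>
        have k: "?kink y \<le> exp (x 1)"
        proof (cases "0 \<le> x 1")
          case True then have "1 \<le> exp (x 1)" by simp
          then show ?thesis using k01 by linarith
        next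
          case False
          then have "node_index N x \<noteq> 1" using ni(4) by auto
          then have "x 1 \<le> x (node_index N x - 1)" using ni(1,2) by (intro design_mono[OF D]) auto
          then have "?kink y = 0" using yr by (intro kink_fun_outside ni) auto
          then show ?thesis by simp
        qed
        have "(\<Sum>j=1..N. Of (x j) * hat_fun x j y) = Of (x 1) * ((y - x 0) / (x 1 - x 0))"
          using sum 1 N by simp
        moreover have "\<bar>Of (x 1) * ((y - x 0) / (x 1 - x 0))\<bar> \<le> (B * exp (x 1)) * 1"
          unfolding abs_mult using yr B Oleft[of "x 1"]
          by (intro mult_mono) (auto simp: g1_def divide_le_eq)
        ultimately have "\<bar>interpolant N x (\<lambda>j. Of (x j)) y\<bar> \<le> exp (x 1) + B * exp (x 1)"
          unfolding interpolant_def using k k01 by linarith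
        also have "\<dots> = g3 y" using yr by (simp add: g3_def algebra_simps)
        finally show ?thesis using Oleft[of y] yr g_ge[of y] unfolding E_def g_def by linarith
      next
        case 2
        have yr: "x N \<le> y" "y < x (N + 1)" using i 2 by auto
        have k: "?kink y \<le> exp (- x N)"
        proof (cases "x N \<le> 0")
          case True then have "1 \<le> exp (- x N)" by simp
          then show ?thesis using k01 by linarith
        next
          case False
          then have "node_index N x - 1 \<noteq> N" using ni(3) by auto
          then have "x (node_index N x) \<le> x N" using ni(1,2) by (intro design_mono[OF D]) auto
          then have "?kink y = 0" using yr by (intro kink_fun_outside ni) auto
          then show ?thesis by simp
        qed
        have "(\<Sum>j=1..N. Of (x j) * hat_fun x j y) = Of (x N) * ((x (N + 1) - y) / (x (N + 1) - x N))"
          using sum 2 N by simp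
        moreover have "\<bar>Of (x N) * ((x (N + 1) - y) / (x (N + 1) - x N))\<bar> \<le> (B * exp (- x N)) * 1"
          unfolding abs_mult using yr B Oright[of "x N"]
          by (intro mult_mono) (auto simp: g2_def divide_le_eq)
        ultimately have "\<bar>interpolant N x (\<lambda>j. Of (x j)) y\<bar> \<le> exp (- x N) + B * exp (- x N)"
          unfolding interpolant_def using k k01 by linarith
        also have "\<dots> = g4 y" using yr by (simp add: g4_def algebra_simps)
        finally show ?thesis using Oright[of y] yr g_ge[of y] unfolding E_def g_def by linarith
      next
        case 3
        have "interpolant N x (\<lambda>j. Of (x j)) y = min y 0 + (lin_interp Of (x (i - 1)) (x i) y - lin_interp (\<lambda>t. min t 0) (x (i - 1)) (x i) y)"
          unfolding interpolant_def kink sum using 3 by (simp add: lin_interp_def)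
        also have "lin_interp Of (x (i - 1)) (x i) y - lin_interp (\<lambda>t. min t 0) (x (i - 1)) (x i) y
            = lin_interp (\<lambda>t. Of t - min t 0) (x (i - 1)) (x i) y"
          by (simp add: lin_interp_def diff_divide_distrib[symmetric] algebra_simps)
        finally have "E y = lin_interp (\<lambda>t. Of t - min t 0) (x (i - 1)) (x i) y - (Of y - min y 0)"
          unfolding E_def by linarith
        moreover have "x i \<le> x (i - 1) + 1" "y \<in> {x (i - 1)..x i}" using li d i(3,4) by auto
        ultimately have "\<bar>E y\<bar> \<le> (\<Gamma> (x i) - \<Gamma> (x (i - 1))) * (x i - x (i - 1))"
          using cell[OF li(1)] by simp
        also have "\<dots> \<le> \<Delta> i" unfolding \<Delta>_def using mono[of i] li i by (intro mult_left_mono) auto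
        also have "\<dots> = \<Delta> i * indicator {x (i - 1)..<x i} y" using i(3,4) by simp
        also have "\<dots> \<le> g0 y"
          unfolding g0_def using mono d 3 by (intro member_le_sum) (auto simp: \<Delta>_def)
        finally show ?thesis using g_ge[of y] unfolding g_def by linarith
      qed
    qed
  qed
  have gi: "integrable lborel g"
    unfolding g_def g0_def g1_def g2_def g3_def g4_def using integral_exp_neg_abs_shift integrable_indicator_Ico
    by (intro Bochner_Integration.integrable_add Bochner_Integration.integrable_sum integrable_mult_right)
       (auto simp: has_bochner_integral_iff)
  have [measurable]: "E \<in> borel_measurable borel"
    unfolding E_def by (intro borel_measurable_diff interpolant_measurable[OF D] meas)
  show Ei: "integrable lborel E"
    by (rule Bochner_Integration.integrable_bound[OF gi])
       (use bound in \<open>auto intro!: AE_I2 intro: order_trans[OF _ abs_ge_self]\<close>)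
  have "(LINT y|lborel. \<bar>E y\<bar>) \<le> (LINT y|lborel. g y)"
    using Ei gi bound by (intro integral_mono) auto
  also have "\<dots> = (\<Sum>i=2..N. \<Delta> i * (x i - x (i - 1))) + B * exp (x 1) * 2 + B * exp (- x N) * 2
      + (1 + B) * exp (x 1) * (x 1 - x 0) + (1 + B) * exp (- x N) * (x (N + 1) - x N)"
  proof -
    have "has_bochner_integral lborel g ((\<Sum>i=2..N. \<Delta> i * (x i - x (i - 1))) + B * exp (x 1) * 2 + B * exp (- x N) * 2
      + (1 + B) * exp (x 1) * (x 1 - x 0) + (1 + B) * exp (- x N) * (x (N + 1) - x N))"
      unfolding g_def g0_def g1_def g2_def g3_def g4_def
    proof (intro has_bochner_integral_add has_bochner_integral_sum has_bochner_integral_mult_right integral_exp_neg_abs_shift)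
      have ind: "has_bochner_integral lborel (indicator {a..<b} :: real \<Rightarrow> real) (b - a)" if "a < b" for a b :: real
        using that integrable_indicator_Ico by (auto simp: has_bochner_integral_iff)
      show "has_bochner_integral lborel (indicator {x (i - 1)..<x i} :: real \<Rightarrow> real) (x i - x (i - 1))" if "i \<in> {2..N}" for i
        using lt[of i] that by (intro ind) auto
      show "has_bochner_integral lborel (indicator {x 0..<x 1} :: real \<Rightarrow> real) (x 1 - x 0)"
        using lt[of 1] by (intro ind) auto
      show "has_bochner_integral lborel (indicator {x N..<x (N + 1)} :: real \<Rightarrow> real) (x (N + 1) - x N)"
        using lt[of "N + 1"] by (intro ind) auto
    qed
    then show ?thesis by (rule has_bochner_integral_integral_eq)
  qed
  also have "\<dots> \<le> 5 * d\<^sup>2 + B * exp (- range_param N x) * 2 + B * exp (- range_param N x) * 2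
      + (1 + B) * exp (- range_param N x) * 1 + (1 + B) * exp (- range_param N x) * 1"
  proof (intro add_mono)
    have "(\<Sum>i=2..N. \<Delta> i * (x i - x (i - 1))) \<le> (\<Sum>i=2..N. (\<Gamma> (x i) - \<Gamma> (x (i - 1))) * d\<^sup>2)"
    proof (rule sum_mono)
      fix i assume "i \<in> {2..N}"
      then have i: "i \<in> {1..N+1}" by simp
      have "\<Delta> i * (x i - x (i - 1)) \<le> \<Delta> i * d"
        using mono[OF i] sp[OF i] d by (intro mult_left_mono) (simp_all add: \<Delta>_def)
      then show "\<Delta> i * (x i - x (i - 1)) \<le> (\<Gamma> (x i) - \<Gamma> (x (i - 1))) * d\<^sup>2"
        by (simp add: \<Delta>_def power2_eq_square mult.assoc)
    qed
    also have "\<dots> = (\<Gamma> (x N) - \<Gamma> (x 1)) * d\<^sup>2"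
    proof -
      have "(\<Sum>i=Suc 1..N. \<Gamma> (x i) - \<Gamma> (x (i - 1))) = \<Gamma> (x N) - \<Gamma> (x 1)"
        using sum_telescope''[of 1 N "\<lambda>i. \<Gamma> (x i)"] N by simp
      then show ?thesis by (simp add: sum_distrib_right[symmetric] numeral_2_eq_2)
    qed
    also have "\<dots> \<le> 5 * d\<^sup>2"
      using \<Gamma>(2)[of "x N"] \<Gamma>(1)[of "x 1"] by (intro mult_right_mono) auto
    finally show "(\<Sum>i=2..N. \<Delta> i * (x i - x (i - 1))) \<le> 5 * d\<^sup>2" .
    have e: "exp (x 1) \<le> exp (- range_param N x)" "exp (- x N) \<le> exp (- range_param N x)"
      by (auto simp: range_param_def)
    show "B * exp (x 1) * 2 \<le> B * exp (- range_param N x) * 2"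
      "B * exp (- x N) * 2 \<le> B * exp (- range_param N x) * 2"
      by (intro mult_right_mono mult_left_mono e B; simp)+
    show "(1 + B) * exp (x 1) * (x 1 - x 0) \<le> (1 + B) * exp (- range_param N x) * 1"
      using B lt[of 1] sp[of 1] d by (intro mult_mono e) auto
    show "(1 + B) * exp (- x N) * (x (N + 1) - x N) \<le> (1 + B) * exp (- range_param N x) * 1"
      using B lt[of "N + 1"] sp[of "N + 1"] d by (intro mult_mono e) auto
  qed
  also have "\<dots> = 5 * (mesh N x)\<^sup>2 + (2 + 6 * B) * exp (- range_param N x)"
    by (simp add: d_def algebra_simps)
  finally show "(LINT y|lborel. \<bar>E y\<bar>) \<le> 5 * (mesh N x)\<^sup>2 + (2 + 6 * B) * exp (- range_param N x)" .
qed

section \<open>The stochastic error\<close>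

lemma norm_iexp_diff_le:
  "cmod (iexp s - iexp t) \<le> \<bar>s - t\<bar>"
proof -
  have "iexp s = iexp t * iexp (s - t)"
    by (simp add: exp_add[symmetric] right_diff_distrib)
  then have "iexp s - iexp t = iexp t * (iexp (s - t) - 1)"
    by (simp add: right_diff_distrib)
  then have "cmod (iexp s - iexp t) = cmod (iexp (s - t) - 1)" by (simp add: norm_mult)
  also have "\<dots> \<le> \<bar>s - t\<bar>" using iexp_approx1[of "s - t" 0] by simp
  finally show ?thesis .
qed

lemma integrable_iexp_mult:
  assumes "integrable lborel f"
  shows "integrable lborel (\<lambda>x. iexp (u * x) * of_real (f x))"
proof (rule Bochner_Integration.integrable_bound[OF assms])
  show "(\<lambda>x. iexp (u * x) * complex_of_real (f x)) \<in> borel_measurable lborel"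
    using borel_measurable_integrable[OF assms] by measurable
qed (simp add: norm_mult)

lemma fourier_norm_le:
  assumes "integrable lborel f"
  shows "cmod (fourier f u) \<le> (LINT x|lborel. \<bar>f x\<bar>)"
  unfolding fourier_def
  by (rule order_trans[OF integral_norm_bound]) (simp add: norm_mult)

lemma fourier_lipschitz:
  assumes f: "integrable lborel f" and supp: "\<And>x. f x \<noteq> 0 \<Longrightarrow> \<bar>x\<bar> \<le> L"
  shows "cmod (fourier f u - fourier f v) \<le> \<bar>u - v\<bar> * L * (LINT x|lborel. \<bar>f x\<bar>)"
proof -
  have "fourier f u - fourier f v = (LINT x|lborel. iexp (u * x) * of_real (f x) - iexp (v * x) * of_real (f x))"
    unfolding fourier_def using integrable_iexp_mult[OF f] by simp
  also have "cmod \<dots> \<le> (LINT x|lborel. cmod (iexp (u * x) * of_real (f x) - iexp (v * x) * of_real (f x)))"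
    by (rule integral_norm_bound)
  also have "\<dots> \<le> (LINT x|lborel. \<bar>u - v\<bar> * L * \<bar>f x\<bar>)"
  proof (rule integral_mono)
    show "integrable lborel (\<lambda>x. cmod (iexp (u * x) * of_real (f x) - iexp (v * x) * of_real (f x)))"
      by (intro integrable_norm Bochner_Integration.integrable_diff integrable_iexp_mult f)
    show "integrable lborel (\<lambda>x. \<bar>u - v\<bar> * L * \<bar>f x\<bar>)" using f by simp
    fix x
    show "cmod (iexp (u * x) * of_real (f x) - iexp (v * x) * of_real (f x)) \<le> \<bar>u - v\<bar> * L * \<bar>f x\<bar>"
    proof (cases "f x = 0")
      case False
      have "cmod (iexp (u * x) * of_real (f x) - iexp (v * x) * of_real (f x)) = cmod (iexp (u * x) - iexp (v * x)) * \<bar>f x\<bar>"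
        unfolding left_diff_distrib[symmetric] norm_mult by simp
      also have "\<dots> \<le> \<bar>u * x - v * x\<bar> * \<bar>f x\<bar>" by (intro mult_right_mono norm_iexp_diff_le) simp
      also have "\<dots> = \<bar>u - v\<bar> * \<bar>x\<bar> * \<bar>f x\<bar>" by (simp add: left_diff_distrib[symmetric] abs_mult)
      also have "\<dots> \<le> \<bar>u - v\<bar> * L * \<bar>f x\<bar>" using supp[OF False] by (intro mult_right_mono mult_left_mono) auto
      finally show ?thesis .
    qed simp
  qed
  also have "\<dots> = \<bar>u - v\<bar> * L * (LINT x|lborel. \<bar>f x\<bar>)" by simp
  finally show ?thesis .
qed

lemma design_total_length:
  assumes D: "design N x \<delta>" and "j \<le> N + 1"
  shows "x j - x 0 \<le> real j * mesh N x"
  using assms(2)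
proof (induction j)
  case (Suc j)
  then show ?case using design_spacing[OF D, of "Suc j"] by (simp add: algebra_simps)
qed simp

text \<open>Apart from the mesh, the Lipschitz constant involves only \<open>N\<close>: the design
  covers 0 and has total length at most N + 1, so every hat is supported in
  [-(N + 1), N + 1].\<close>

lemma hat_fun_fourier:
  assumes D: "design N x \<delta>" and j: "j \<in> {1..N}" and mesh: "mesh N x \<le> 1"
  shows "integrable lborel (hat_fun x j)"
    and "cmod (fourier (hat_fun x j) u) \<le> 2 * mesh N x"
    and "cmod (fourier (hat_fun x j) u - fourier (hat_fun x j) v) \<le> \<bar>u - v\<bar> * real (N + 1) * (2 * mesh N x)"
proof -
  note b = hat_fun_bounds[OF D j]
  have lt: "x (j - 1) < x (j + 1)" using design_strict_mono[OF D, of "j - 1" "j + 1"] j by simp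
  have i: "integrable lborel (indicator {x (j - 1)..x (j + 1)} :: real \<Rightarrow> real)"
    using lt by (intro integrable_real_indicator) auto
  show int: "integrable lborel (hat_fun x j)"
    by (rule Bochner_Integration.integrable_bound[OF i]) (use b in auto)
  have "(LINT y|lborel. \<bar>hat_fun x j y\<bar>) \<le> (LINT y|lborel. indicator {x (j - 1)..x (j + 1)} y)"
    using int i b by (intro integral_mono) auto
  also have "\<dots> = x (j + 1) - x (j - 1)" using lt by simp
  also have "\<dots> \<le> 2 * mesh N x" using design_spacing[OF D, of j] design_spacing[OF D, of "j + 1"] j by simp
  finally have L1: "(LINT y|lborel. \<bar>hat_fun x j y\<bar>) \<le> 2 * mesh N x" .
  show "cmod (fourier (hat_fun x j) u) \<le> 2 * mesh N x"
    using fourier_norm_le[OF int] L1 by (rule order_trans)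
  have "\<bar>y\<bar> \<le> real (N + 1)" if "hat_fun x j y \<noteq> 0" for y
  proof -
    have y: "y \<in> {x (j - 1)..x (j + 1)}"
    proof (rule ccontr)
      assume "y \<notin> {x (j - 1)..x (j + 1)}"
      then have "hat_fun x j y \<le> 0" using b(2)[of y] by (metis indicator_simps(2))
      then show False using b(1)[of y] that by linarith
    qed
    have "x 0 \<le> x (j - 1)" "x (j + 1) \<le> x (N + 1)"
      using design_mono[OF D, of 0 "j - 1"] design_mono[OF D, of "j + 1" "N + 1"] j by auto
    moreover have "x 0 < 0" "0 \<le> x (N + 1)" using D by (auto simp: design_def)
    moreover have "x (N + 1) - x 0 \<le> real (N + 1) * 1"
      by (rule order_trans[OF design_total_length[OF D] mult_left_mono[OF mesh]]) simp_all
    ultimately show ?thesis using y by (auto simp: abs_le_iff)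
  qed
  then have "cmod (fourier (hat_fun x j) u - fourier (hat_fun x j) v) \<le> \<bar>u - v\<bar> * real (N + 1) * (LINT y|lborel. \<bar>hat_fun x j y\<bar>)"
    by (intro fourier_lipschitz int)
  also have "\<dots> \<le> \<bar>u - v\<bar> * real (N + 1) * (2 * mesh N x)"
    using L1 by (intro mult_left_mono) auto
  finally show "cmod (fourier (hat_fun x j) u - fourier (hat_fun x j) v) \<le> \<bar>u - v\<bar> * real (N + 1) * (2 * mesh N x)" .
qed

text \<open>If all coefficients vanish, division by zero turns the given tail bound into the trivial
  \<open>C1\<close>; that case is settled directly, as the sum is then 0 < t.\<close>

lemma subgaussian_sum_bound:
  assumes sg: "uniformly_subgaussian M e C1 C2" and C: "0 < C1" "0 < C2" and "0 < t" "0 < N" "0 < S"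
    and a: "(\<Sum>j=1..N. (a j)\<^sup>2) \<le> S"
  shows "measure M {\<omega> \<in> space M. t \<le> \<bar>\<Sum>j=1..N. a j * e j \<omega>\<bar>} \<le> C1 * exp (- C2 * (t\<^sup>2 / S))"
proof (cases "(\<Sum>j=1..N. (a j)\<^sup>2) = 0")
  case True
  then have "a j = 0" if "j \<in> {1..N}" for j using that by (simp add: sum_nonneg_eq_0_iff)
  then have "(\<Sum>j=1..N. a j * e j \<omega>) = 0" for \<omega> by (intro sum.neutral) auto
  then show ?thesis using assms by simp
next
  case False
  then have pos: "0 < (\<Sum>j=1..N. (a j)\<^sup>2)" by (simp add: order.not_eq_order_implies_strict sum_nonneg)
  have "measure M {\<omega> \<in> space M. t \<le> \<bar>\<Sum>j=1..N. a j * e j \<omega>\<bar>} \<le> C1 * exp (- C2 * (t\<^sup>2 / (\<Sum>j=1..N. (a j)\<^sup>2)))"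
    using sg \<open>0 < t\<close> \<open>0 < N\<close> unfolding uniformly_subgaussian_def by blast
  also have "\<dots> \<le> C1 * exp (- C2 * (t\<^sup>2 / S))"
    using C pos a by (auto intro!: mult_left_mono divide_left_mono mult_pos_pos \<open>0 < S\<close>)
  finally show ?thesis .
qed

lemma grid_point:
  fixes U h u :: real
  assumes "0 < h" "\<bar>u\<bar> \<le> U"
  obtains i :: int where "i \<in> {- \<lceil>U / h\<rceil>..\<lceil>U / h\<rceil>}" "\<bar>u - of_int i * h\<bar> \<le> h"
proof
  have "u / h \<le> U / h" "(- U) / h \<le> u / h"
    using assms by (intro divide_right_mono; linarith)+
  then have "- \<lceil>U / h\<rceil> \<le> \<lfloor>u / h\<rfloor>" "\<lfloor>u / h\<rfloor> \<le> \<lceil>U / h\<rceil>"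
    using floor_mono[of "(- U) / h" "u / h"] floor_mono[of "u / h" "U / h"] floor_le_ceiling[of "U / h"]
    by (simp_all add: ceiling_def)
  then show "\<lfloor>u / h\<rfloor> \<in> {- \<lceil>U / h\<rceil>..\<lceil>U / h\<rceil>}" by simp
  have "of_int \<lfloor>u / h\<rfloor> \<le> u / h" "u / h < of_int \<lfloor>u / h\<rfloor> + 1" by linarith+
  then have "of_int \<lfloor>u / h\<rfloor> * h \<le> u" "u < of_int \<lfloor>u / h\<rfloor> * h + h"
    using assms(1) unfolding pos_le_divide_eq[OF assms(1)] pos_divide_less_eq[OF assms(1)] by (simp_all add: distrib_right)
  then show "\<bar>u - of_int \<lfloor>u / h\<rfloor> * h\<bar> \<le> h" by auto
qed

lemma noise_level_mesh:
  assumes D: "design N x \<delta>"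
  shows "mesh N x powr (3/2) \<le> noise_level N x \<delta>" "0 < noise_level N x \<delta>"
    and "noise_level N x \<delta> < 1 \<Longrightarrow> mesh N x \<le> 1"
proof -
  have N: "2 \<le> N" using D by (simp add: design_def)
  have "\<bar>\<delta> 1\<bar> \<le> linf_norm N \<delta>" unfolding linf_norm_def using N by (intro Max_ge) auto
  then have l: "0 \<le> linf_norm N \<delta>" by linarith
  then show le: "mesh N x powr (3/2) \<le> noise_level N x \<delta>" by (simp add: noise_level_def)
  have m: "0 < mesh N x" by (rule mesh_pos[OF D])
  then show "0 < noise_level N x \<delta>" using le by (smt (verit) powr_gt_zero)
  show "mesh N x \<le> 1" if "noise_level N x \<delta> < 1"
  proof (rule ccontr)
    assume "\<not> mesh N x \<le> 1"
    then have "1 \<le> mesh N x powr (3/2)" by (intro ge_one_powr_ge_zero) auto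
    then show False using le that by linarith
  qed
qed

text \<open>
  Union bound over a grid. On the event \<open>\<bar>e j \<omega>\<bar> < z / \<epsilon>\<close> for all \<open>j \<le> N\<close> a grid width depending only on \<open>N\<close>
  suffices: the design points satisfy \<open>\<bar>x j\<bar> \<le> (N + 1) * mesh N x\<close>, so no bound on the range of the design is needed.
\<close>

lemma stochastic_sup_bound:
  fixes e :: "nat \<Rightarrow> 'a \<Rightarrow> real" and x \<delta> :: "nat \<Rightarrow> real"
  assumes nm: "noise_model M e" and sg: "uniformly_subgaussian M e C1 C2"
    and C: "0 < C1" "0 < C2" "0 < C\<^sub>\<delta>"
    and D: "design N x \<delta>" and \<epsilon>: "\<epsilon> = noise_level N x \<delta>" "\<epsilon> < 1"
    and l2: "mesh N x * (l2_norm N \<delta>)\<^sup>2 \<le> C\<^sub>\<delta> * (linf_norm N \<delta>)\<^sup>2"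
    and U: "1 \<le> U" and z: "0 < z"
  shows "\<exists>A \<in> sets M. measure M A \<le> 39 * C1 * U * real N ^ 2 * exp (- C2 * min 1 (1 / (64 * C\<^sub>\<delta>)) * (z / \<epsilon>)\<^sup>2) \<and>
    (\<forall>\<omega> \<in> space M - A. \<forall>u\<in>{-U..U}. cmod (\<Sum>j=1..N. of_real (\<delta> j * e j \<omega>) * fourier (hat_fun x j) u) < z)"
proof -
  interpret prob_space M using nm by (simp add: noise_model_def)
  have e [measurable]: "e j \<in> borel_measurable M" if "1 \<le> j" for j
    using nm that by (auto simp: noise_model_def)
  define d where "d = mesh N x"
  define m where "m = linf_norm N \<delta>"
  have N: "2 \<le> N" using D by (simp add: design_def)
  have d0: "0 < d" using mesh_pos[OF D] by (simp add: d_def)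
  have \<delta>: "0 < \<delta> j" "\<delta> j \<le> m" if "j \<in> {1..N}" for j
  proof -
    show "0 < \<delta> j" using D that by (simp add: design_def)
    have "\<bar>\<delta> j\<bar> \<le> m" unfolding m_def linf_norm_def using that by (intro Max_ge) auto
    then show "\<delta> j \<le> m" by simp
  qed
  have m0: "0 < m" using \<delta>[of 1] N by auto
  have \<epsilon>_eq: "\<epsilon> = d powr (3/2) + d powr (1/2) * m" by (simp add: \<epsilon> noise_level_def d_def m_def)
  have \<epsilon>0: "0 < \<epsilon>" and d1: "d \<le> 1"
    using noise_level_mesh(2,3)[OF D] \<epsilon> by (simp_all add: d_def)
  have dm: "d powr (1/2) * m \<le> \<epsilon>" unfolding \<epsilon>_eq by simp
  have dm1: "d * m \<le> \<epsilon>"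
  proof -
    have "d powr 1 \<le> d powr (1/2)" using d0 d1 by (intro powr_mono') auto
    then have "d * m \<le> d powr (1/2) * m" using d0 m0 by (intro mult_right_mono) auto
    then show ?thesis using dm by linarith
  qed
  have dm2: "d * m\<^sup>2 \<le> \<epsilon>\<^sup>2"
  proof -
    have "(d powr (1/2) * m)\<^sup>2 \<le> \<epsilon>\<^sup>2" using dm d0 m0 by (intro power_mono) auto
    moreover have "(d powr (1/2))\<^sup>2 = d" using d0 by (simp add: powr_half_sqrt)
    ultimately show ?thesis by (simp add: power_mult_distrib)
  qed
  have mesh1: "mesh N x \<le> 1" using d1 by (simp add: d_def)
  define F where "F j u = fourier (hat_fun x j) u" for j u
  have F1: "cmod (F j u) \<le> 2 * d" if "j \<in> {1..N}" for j u
    using hat_fun_fourier(2)[OF D that mesh1] by (simp add: F_def d_def)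
  have F2: "cmod (F j u - F j v) \<le> \<bar>u - v\<bar> * real (N + 1) * (2 * d)" if "j \<in> {1..N}" for j u v
    using hat_fun_fourier(3)[OF D that mesh1] by (simp add: F_def d_def)
  define Z where "Z \<omega> u = (\<Sum>j=1..N. of_real (\<delta> j * e j \<omega>) * F j u)" for \<omega> u
  have ReZ: "Re (Z \<omega> u) = (\<Sum>j=1..N. (\<delta> j * Re (F j u)) * e j \<omega>)"
    and ImZ: "Im (Z \<omega> u) = (\<Sum>j=1..N. (\<delta> j * Im (F j u)) * e j \<omega>)" for \<omega> u
    by (simp_all add: Z_def mult_ac)
  \<comment> \<open>On the good event every |\<open>e j\<close>| stays below \<open>q\<close>; with
    this level both the single-error tail and the grid tail take the form exp(-c q^2).\<close>
  define q where "q = z / \<epsilon>"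
  have q0: "0 < q" using z \<epsilon>0 by (simp add: q_def)
  define c where "c = C2 * min 1 (1 / (64 * C\<^sub>\<delta>))"
  \<comment> \<open>Chosen so that the variation from a point to its grid neighbour, at most N (m q)
    h (N + 1) 2 d, is d m q / 2 \<le> z / 2.\<close>
  define h where "h = 1 / (4 * real N * real (N + 1))"
  have h0: "0 < h" using N by (simp add: h_def)
  define I where "I = {- \<lceil>U / h\<rceil>..\<lceil>U / h\<rceil>}"
  define A1 where "A1 j = {\<omega> \<in> space M. q \<le> \<bar>e j \<omega>\<bar>}" for j
  define A2 where "A2 i = {\<omega> \<in> space M. z / 4 \<le> \<bar>Re (Z \<omega> (of_int i * h))\<bar>}" for i :: int
  define A3 where "A3 i = {\<omega> \<in> space M. z / 4 \<le> \<bar>Im (Z \<omega> (of_int i * h))\<bar>}" for i :: int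
  have A1s: "A1 j \<in> events" if "j \<in> {1..N}" for j
  proof -
    have "1 \<le> j" using that by simp
    note e[OF this, measurable]
    show ?thesis unfolding A1_def by measurable
  qed
  have lin: "(\<lambda>\<omega>. \<Sum>j=1..N. a j * e j \<omega>) \<in> borel_measurable M" for a
    using e by (intro borel_measurable_sum borel_measurable_times) auto
  have A2s: "A2 i \<in> events" for i
    unfolding A2_def ReZ using lin[of "\<lambda>j. \<delta> j * Re (F j (of_int i * h))"] by measurable
  have A3s: "A3 i \<in> events" for i
    unfolding A3_def ImZ using lin[of "\<lambda>j. \<delta> j * Im (F j (of_int i * h))"] by measurable
  have P1: "prob (A1 j) \<le> C1 * exp (- c * q\<^sup>2)" if j: "j \<in> {1..N}" for j
  proof -
    have "(\<Sum>i=1..N. (if i = j then 1 else 0) * e i \<omega>) = e j \<omega>" for \<omega>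
      using j by (simp add: if_distrib[where f = "\<lambda>a. a * _"] cong: if_cong)
    moreover have "(\<Sum>i=1..N. (if i = j then 1 else 0 :: real)\<^sup>2) = 1"
      using j by (simp add: if_distrib[where f = "\<lambda>a. a\<^sup>2"] cong: if_cong)
    ultimately have "prob (A1 j) \<le> C1 * exp (- C2 * (q\<^sup>2 / 1))"
      unfolding A1_def using subgaussian_sum_bound[OF sg C(1,2) q0, of N 1 "\<lambda>i. if i = j then 1 else 0"] N by simp
    also have "\<dots> \<le> C1 * exp (- c * q\<^sup>2)"
    proof -
      have "c \<le> C2 * 1" unfolding c_def using C by (intro mult_left_mono) auto
      then have "c * q\<^sup>2 \<le> C2 * q\<^sup>2" by (intro mult_right_mono) auto
      then show ?thesis using C by (intro mult_left_mono) auto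
    qed
    finally show ?thesis .
  qed
  have l2': "(\<Sum>j=1..N. (\<delta> j)\<^sup>2) * d \<le> C\<^sub>\<delta> * m\<^sup>2"
    using l2 by (simp add: l2_norm_def d_def m_def sum_nonneg mult.commute)
  \<comment> \<open>Since |\<open>G j\<close>| \<le> 2 d, the sum of squared coefficients is at most
    4 \<open>C\<^sub>\<delta>\<close> d m^2 \<le> 4 \<open>C\<^sub>\<delta>\<close> \<epsilon>^2;
    with the threshold z / 4 this produces the factor 1 / 64.\<close>
  have tail: "prob {\<omega> \<in> space M. z / 4 \<le> \<bar>\<Sum>j=1..N. (\<delta> j * G j) * e j \<omega>\<bar>} \<le> C1 * exp (- c * q\<^sup>2)"
    if G: "\<And>j. j \<in> {1..N} \<Longrightarrow> \<bar>G j\<bar> \<le> 2 * d" for G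
  proof -
    have "(\<Sum>j=1..N. (\<delta> j * G j)\<^sup>2) \<le> (\<Sum>j=1..N. (\<delta> j)\<^sup>2 * (2 * d)\<^sup>2)"
    proof (rule sum_mono)
      fix j assume "j \<in> {1..N}"
      then have "\<bar>G j\<bar> \<le> \<bar>2 * d\<bar>" using G d0 by auto
      then have "(G j)\<^sup>2 \<le> (2 * d)\<^sup>2" by (simp add: abs_le_square_iff)
      then show "(\<delta> j * G j)\<^sup>2 \<le> (\<delta> j)\<^sup>2 * (2 * d)\<^sup>2" by (simp add: power_mult_distrib mult_left_mono)
    qed
    also have "\<dots> = 4 * (((\<Sum>j=1..N. (\<delta> j)\<^sup>2) * d) * d)"
      by (simp add: sum_distrib_right[symmetric] power2_eq_square)
    also have "\<dots> \<le> 4 * ((C\<^sub>\<delta> * m\<^sup>2) * d)" using l2' d0 by (intro mult_left_mono mult_right_mono) auto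
    also have "\<dots> = 4 * C\<^sub>\<delta> * (d * m\<^sup>2)" by simp
    also have "\<dots> \<le> 4 * C\<^sub>\<delta> * \<epsilon>\<^sup>2" using dm2 C by (intro mult_left_mono) auto
    finally have S: "(\<Sum>j=1..N. (\<delta> j * G j)\<^sup>2) \<le> 4 * C\<^sub>\<delta> * \<epsilon>\<^sup>2" .
    have q_eq: "(z / 4)\<^sup>2 / (4 * C\<^sub>\<delta> * \<epsilon>\<^sup>2) = 1 / (64 * C\<^sub>\<delta>) * q\<^sup>2"
      by (simp add: q_def power_divide)
    have "0 < z / 4" "0 < N" "0 < 4 * C\<^sub>\<delta> * \<epsilon>\<^sup>2" using z N C \<epsilon>0 by auto
    from subgaussian_sum_bound[OF sg C(1,2) this S]
    have "prob {\<omega> \<in> space M. z / 4 \<le> \<bar>\<Sum>j=1..N. (\<delta> j * G j) * e j \<omega>\<bar>} \<le> C1 * exp (- C2 * (1 / (64 * C\<^sub>\<delta>) * q\<^sup>2))"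
      unfolding q_eq .
    also have "C1 * exp (- C2 * (1 / (64 * C\<^sub>\<delta>) * q\<^sup>2)) \<le> C1 * exp (- c * q\<^sup>2)"
    proof -
      have "min 1 (1 / (64 * C\<^sub>\<delta>)) * q\<^sup>2 \<le> 1 / (64 * C\<^sub>\<delta>) * q\<^sup>2" by (intro mult_right_mono) auto
      then have "C2 * (min 1 (1 / (64 * C\<^sub>\<delta>)) * q\<^sup>2) \<le> C2 * (1 / (64 * C\<^sub>\<delta>) * q\<^sup>2)" using C by (intro mult_left_mono) auto
      then show ?thesis unfolding c_def using C by (intro mult_left_mono) (auto simp: mult.assoc)
    qed
    finally show ?thesis .
  qed
  have P2: "prob (A2 i) \<le> C1 * exp (- c * q\<^sup>2)" for i
    unfolding A2_def ReZ by (rule tail) (use F1 abs_Re_le_cmod order_trans in blast)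
  have P3: "prob (A3 i) \<le> C1 * exp (- c * q\<^sup>2)" for i
    unfolding A3_def ImZ by (rule tail) (use F1 abs_Im_le_cmod order_trans in blast)
  define A where "A = (\<Union>j\<in>{1..N}. A1 j) \<union> ((\<Union>i\<in>I. A2 i) \<union> (\<Union>i\<in>I. A3 i))"
  have As: "A \<in> events" unfolding A_def using A1s A2s A3s by (auto simp: I_def)
  have cardI: "real (card I) \<le> 2 * (U / h) + 3"
  proof -
    have "0 \<le> U / h" using U h0 by simp
    then have "0 \<le> \<lceil>U / h\<rceil>" by simp
    then have "real (card I) = 2 * of_int \<lceil>U / h\<rceil> + 1" by (simp add: I_def)
    moreover have "of_int \<lceil>U / h\<rceil> < U / h + 1" by linarith
    ultimately show ?thesis by linarith
  qed
  have "prob A \<le> prob (\<Union>j\<in>{1..N}. A1 j) + (prob (\<Union>i\<in>I. A2 i) + prob (\<Union>i\<in>I. A3 i))"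
    unfolding A_def using A1s A2s A3s
    by (intro order_trans[OF measure_Un_le] add_mono order_refl) (auto simp: I_def)
  also have "\<dots> \<le> (\<Sum>j\<in>{1..N}. prob (A1 j)) + ((\<Sum>i\<in>I. prob (A2 i)) + (\<Sum>i\<in>I. prob (A3 i)))"
    using A1s A2s A3s by (intro add_mono measure_UNION_le) (auto simp: I_def)
  also have "\<dots> \<le> (\<Sum>j\<in>{1..N}. C1 * exp (- c * q\<^sup>2)) + ((\<Sum>i\<in>I. C1 * exp (- c * q\<^sup>2)) + (\<Sum>i\<in>I. C1 * exp (- c * q\<^sup>2)))"
    using P1 P2 P3 by (intro add_mono sum_mono) auto
  also have "\<dots> = (real N + 2 * real (card I)) * (C1 * exp (- c * q\<^sup>2))"
    by (simp add: algebra_simps)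
  \<comment> \<open>U / h \<le> 8 U N^2, so the count N + 2 (2 U / h + 3) is at most (1 + 32 + 6) U
    N^2.\<close>
  also have "\<dots> \<le> (39 * U * real N ^ 2) * (C1 * exp (- c * q\<^sup>2))"
  proof (rule mult_right_mono)
    have n1: "1 \<le> real N" using N by simp
    have n2: "real N \<le> real N ^ 2" using n1 by (simp add: power2_eq_square)
    have n3: "1 * real N ^ 2 \<le> U * real N ^ 2" using U by (intro mult_right_mono) auto
    have "U / h = U * (4 * (real N ^ 2 + real N))" by (simp add: h_def power2_eq_square algebra_simps)
    also have "\<dots> \<le> U * (8 * real N ^ 2)" using n2 U by (intro mult_left_mono) auto
    finally have "U / h \<le> 8 * (U * real N ^ 2)" by simp
    then show "real N + 2 * real (card I) \<le> 39 * U * real N ^ 2"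
      using cardI n1 n2 n3 by linarith
  qed (use C in auto)
  also have "\<dots> = 39 * C1 * U * real N ^ 2 * exp (- c * q\<^sup>2)" by simp
  finally have PA: "prob A \<le> 39 * C1 * U * real N ^ 2 * exp (- c * q\<^sup>2)" .
  have good: "cmod (Z \<omega> u) < z" if \<omega>: "\<omega> \<in> space M - A" and u: "u \<in> {-U..U}" for \<omega> u
  proof -
    have "\<bar>u\<bar> \<le> U" using u by auto
    from grid_point[OF h0 this] obtain i where i: "i \<in> I" "\<bar>u - of_int i * h\<bar> \<le> h"
      unfolding I_def by metis
    let ?v = "of_int i * h"
    have "\<bar>Re (Z \<omega> ?v)\<bar> < z / 4" "\<bar>Im (Z \<omega> ?v)\<bar> < z / 4"
      using \<omega> i(1) by (auto simp: A_def A2_def A3_def not_le)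
    then have v: "cmod (Z \<omega> ?v) < z / 2" using cmod_le[of "Z \<omega> ?v"] by linarith
    have e_lt: "\<bar>e j \<omega>\<bar> \<le> q" if "j \<in> {1..N}" for j
      using \<omega> that by (auto simp: A_def A1_def not_le intro: less_imp_le)
    have "cmod (Z \<omega> u - Z \<omega> ?v) = cmod (\<Sum>j=1..N. of_real (\<delta> j * e j \<omega>) * (F j u - F j ?v))"
      by (simp add: Z_def sum_subtractf right_diff_distrib)
    also have "\<dots> \<le> (\<Sum>j=1..N. cmod (of_real (\<delta> j * e j \<omega>) * (F j u - F j ?v)))" by (rule norm_sum)
    also have "\<dots> \<le> (\<Sum>j=1..N. (m * q) * (h * real (N + 1) * (2 * d)))"
    proof (rule sum_mono)
      fix j assume j: "j \<in> {1..N}"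
      have "cmod (F j u - F j ?v) \<le> \<bar>u - ?v\<bar> * real (N + 1) * (2 * d)" by (rule F2[OF j])
      also have "\<dots> \<le> h * real (N + 1) * (2 * d)" using i(2) d0 by (intro mult_right_mono) auto
      finally have Fd: "cmod (F j u - F j ?v) \<le> h * real (N + 1) * (2 * d)" .
      have de: "\<bar>\<delta> j\<bar> * \<bar>e j \<omega>\<bar> \<le> m * q" using \<delta>[OF j] e_lt[OF j] m0 by (intro mult_mono) auto
      then show "cmod (of_real (\<delta> j * e j \<omega>) * (F j u - F j ?v)) \<le> (m * q) * (h * real (N + 1) * (2 * d))"
        unfolding norm_mult norm_of_real abs_mult using m0 q0 by (intro mult_mono de Fd) auto
    qed
    also have "\<dots> = (4 * real N * real (N + 1) * h) * ((d * m) * q / 2)" by (simp add: algebra_simps)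
    also have "\<dots> = (d * m) * q / 2" using N by (simp add: h_def)
    also have "\<dots> \<le> \<epsilon> * q / 2" using dm1 q0 by (simp add: mult_right_mono)
    also have "\<dots> = z / 2" using \<epsilon>0 by (simp add: q_def)
    finally have "cmod (Z \<omega> u - Z \<omega> ?v) \<le> z / 2" .
    then show ?thesis using v norm_triangle_sub[of "Z \<omega> u" "Z \<omega> ?v"] by linarith
  qed
  show ?thesis
    using As PA good unfolding Z_def F_def c_def q_def by (intro bexI[of _ A] conjI) auto
qed

section \<open>Expansion of the exponent and the bias\<close>

lemma integrable_tendsto_imp_zero:
  fixes f :: "real \<Rightarrow> real"
  assumes f: "set_integrable lborel {0<..} f" and lim: "(f \<longlongrightarrow> c) at_top"
  shows "c = 0"
proof (rule ccontr)
  assume "c \<noteq> 0"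
  then have "eventually (\<lambda>x. dist (f x) c < \<bar>c\<bar> / 2) at_top"
    using lim by (intro tendstoD) auto
  then obtain K where K: "\<And>x. K \<le> x \<Longrightarrow> dist (f x) c < \<bar>c\<bar> / 2"
    by (auto simp: eventually_at_top_linorder)
  define a where "a = max K 1"
  have f_ge: "\<bar>c\<bar> / 2 \<le> \<bar>f x\<bar>" if "a \<le> x" for x
  proof -
    have "\<bar>f x - c\<bar> < \<bar>c\<bar> / 2" using K[of x] that by (simp add: a_def dist_real_def)
    then show ?thesis by arith
  qed
  define I where "I = (LINT x:{0<..}|lborel. \<bar>f x\<bar>)"
  have "\<bar>c\<bar> / 2 * real n \<le> I" for n
  proof -
    have int: "integrable lborel (indicator {a..a + real n} :: real \<Rightarrow> real)"
      by (intro integrable_real_indicator) auto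
    have "\<bar>c\<bar> / 2 * real n = (LINT x|lborel. \<bar>c\<bar> / 2 * indicator {a..a + real n} x)" by simp
    also have "\<dots> \<le> (LINT x|lborel. indicator {0<..} x *\<^sub>R \<bar>f x\<bar>)"
    proof (rule integral_mono)
      show "integrable lborel (\<lambda>x. indicator {0<..} x *\<^sub>R \<bar>f x\<bar>)"
        using set_integrable_abs[OF f] by (simp add: set_integrable_def)
      show "\<bar>c\<bar> / 2 * indicator {a..a + real n} x \<le> indicator {0<..} x *\<^sub>R \<bar>f x\<bar>" for x
        using f_ge[of x] by (auto simp: indicator_def a_def)
    qed (use int in simp)
    finally show ?thesis by (simp add: I_def set_lebesgue_integral_def)
  qed
  moreover obtain n :: nat where "I / (\<bar>c\<bar> / 2) < real n" using reals_Archimedean2 by blast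
  ultimately show False using \<open>c \<noteq> 0\<close> by (metis divide_less_eq half_gt_zero_iff mult.commute not_le zero_less_abs_iff)
qed

text \<open>Integrability of \<open>f'\<close> makes \<open>f\<close> converge at infinity, and
  integrability of \<open>f\<close> leaves only the limit 0. This removes the boundary term at
  infinity in the integration by parts.\<close>

lemma integrable_deriv_tendsto_zero:
  fixes f f' :: "real \<Rightarrow> real"
  assumes deriv: "\<And>x. 0 < x \<Longrightarrow> (f has_real_derivative f' x) (at x)"
    and cont: "\<And>x. 0 < x \<Longrightarrow> isCont f' x"
    and f: "set_integrable lborel {0<..} f" and f': "set_integrable lborel {0<..} f'"
  shows "(f \<longlongrightarrow> 0) at_top"
proof -
  define g where "g x = indicator {1..} x *\<^sub>R f' x" for x
  have g: "integrable lborel g"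
  proof -
    have "set_integrable lborel {1..} f'"
      by (rule set_integrable_subset[OF f']) auto
    then show ?thesis by (simp add: g_def[abs_def] set_integrable_def)
  qed
  have "((\<lambda>y. LINT x|lborel. indicator {..y} x *\<^sub>R g x) \<longlongrightarrow> (LINT x|lborel. g x)) at_top"
    by (rule tendsto_integral_at_top) (use g in auto)
  then have "((\<lambda>y. f 1 + (LINT x|lborel. indicator {..y} x *\<^sub>R g x)) \<longlongrightarrow> f 1 + (LINT x|lborel. g x)) at_top"
    by (intro tendsto_intros)
  moreover have "eventually (\<lambda>y. f 1 + (LINT x|lborel. indicator {..y} x *\<^sub>R g x) = f y) at_top"
    using eventually_ge_at_top[of 1]
  proof eventually_elim
    case (elim y)
    have "(LINT x|lborel. indicator {..y} x *\<^sub>R g x) = (LINT x|lborel. indicator {1..y} x *\<^sub>R f' x)"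
      by (rule Bochner_Integration.integral_cong) (auto simp: g_def indicator_def)
    also have "\<dots> = f y - f 1"
    proof (rule has_bochner_integral_integral_eq, rule has_bochner_integral_FTC_Icc[OF elim])
      fix x assume "1 \<le> x" "x \<le> y"
      then show "(f has_vector_derivative f' x) (at x within {1..y})"
        using deriv[of x] by (auto simp: has_real_derivative_iff_has_vector_derivative intro: has_vector_derivative_at_within)
    next
      show "continuous_on {1..y} f'"
        using cont by (intro continuous_at_imp_continuous_on) auto
    qed
    finally show ?case by simp
  qed
  ultimately have lim: "(f \<longlongrightarrow> f 1 + (LINT x|lborel. g x)) at_top"
    by (rule Lim_transform_eventually)
  with integrable_tendsto_imp_zero[OF f lim] show ?thesis by simp
qed

text \<open>The transform is taken over a half-line because \<open>k\<close> is smooth only off 0: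
  each side is integrated by parts separately, with one-sided limits at 0 as boundary terms.\<close>

definition half_fourier :: "(real \<Rightarrow> real) \<Rightarrow> real \<Rightarrow> complex" where
  "half_fourier f u = (LINT x:{0<..}|lborel. iexp (u * x) * of_real (f x))"

lemma set_integrable_iexp_mult:
  assumes "set_integrable lborel A f"
  shows "set_integrable lborel A (\<lambda>x. iexp (u * x) * complex_of_real (f x))"
proof -
  have m: "(\<lambda>x. indicator A x *\<^sub>R f x) \<in> borel_measurable lborel"
    using assms by (simp add: set_integrable_def borel_measurable_integrable)
  have "integrable lborel (\<lambda>x. iexp (u * x) * complex_of_real (indicator A x *\<^sub>R f x))"
  proof (rule Bochner_Integration.integrable_bound)
    show "integrable lborel (\<lambda>x. indicator A x *\<^sub>R f x)" using assms by (simp add: set_integrable_def)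
    show "(\<lambda>x. iexp (u * x) * complex_of_real (indicator A x *\<^sub>R f x)) \<in> borel_measurable lborel"
      using m by measurable
  qed (simp add: norm_mult)
  then show ?thesis
    unfolding set_integrable_def by (simp add: scaleR_conv_of_real mult_ac)
qed

lemma half_fourier_norm_le:
  assumes "set_integrable lborel {0<..} f"
  shows "cmod (half_fourier f u) \<le> (LINT x:{0<..}|lborel. \<bar>f x\<bar>)"
proof -
  have "cmod (half_fourier f u) \<le> (LINT x:{0<..}|lborel. cmod (iexp (u * x) * of_real (f x)))"
    unfolding half_fourier_def by (rule set_integral_norm_bound[OF set_integrable_iexp_mult[OF assms]])
  then show ?thesis by (simp add: norm_mult)
qed

lemma half_fourier_deriv:
  fixes f f' :: "real \<Rightarrow> real"
  assumes deriv: "\<And>x. 0 < x \<Longrightarrow> (f has_real_derivative f' x) (at x)"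
    and cont: "\<And>x. 0 < x \<Longrightarrow> isCont f' x"
    and f: "set_integrable lborel {0<..} f" and f': "set_integrable lborel {0<..} f'"
    and L: "(f \<longlongrightarrow> L) (at_right 0)"
  shows "half_fourier f' u = - of_real L - \<i> * u * half_fourier f u"
proof -
  define F where "F x = iexp (u * x) * complex_of_real (f x)" for x
  define p where "p x = \<i> * u * (iexp (u * x) * complex_of_real (f x)) + iexp (u * x) * complex_of_real (f' x)" for x
  have contf: "isCont f x" if "0 < x" for x using deriv[OF that] by (rule DERIV_isCont)
  have ei: "einterval 0 \<infinity> = {0<..}" by (auto simp: einterval_def zero_ereal_def)
  have pi: "set_integrable lborel {0<..} p"
    unfolding p_def using set_integrable_iexp_mult[OF f] set_integrable_iexp_mult[OF f']
    by (intro set_integral_add set_integrable_mult_right) auto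
  have "(LBINT x=0..\<infinity>. p x) = 0 - of_real L"
  proof (rule interval_integral_FTC_integrable[where F = F])
    fix x :: real assume "0 < ereal x" "ereal x < \<infinity>"
    then have x: "0 < x" by (simp add: zero_ereal_def)
    have "(F has_vector_derivative (iexp (u * x) * of_real (f' x) + \<i> * u * iexp (u * x) * of_real (f x))) (at x)"
    proof -
      have 1: "((\<lambda>x. complex_of_real (f x)) has_vector_derivative of_real (f' x)) (at x)"
        using deriv[OF x] by (intro has_vector_derivative_of_real) (simp add: has_real_derivative_iff_has_vector_derivative)
      have "((\<lambda>z. exp (\<i> * (of_real u * z))) has_field_derivative (\<i> * u * iexp (u * x))) (at (of_real x))"
        by (auto intro!: derivative_eq_intros)
      then have 2: "((\<lambda>x. iexp (u * x)) has_vector_derivative (\<i> * u * iexp (u * x))) (at x)"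
        using has_vector_derivative_real_field[of "\<lambda>z. exp (\<i> * (of_real u * z))"] by simp
      show ?thesis unfolding F_def by (rule has_vector_derivative_mult[OF 2 1])
    qed
    then show "(F has_vector_derivative p x) (at x)" by (simp add: p_def algebra_simps)
    show "isCont p x" unfolding p_def using contf[OF x] cont[OF x] by (intro continuous_intros)
  next
    have "(f \<longlongrightarrow> 0) at_top" using integrable_deriv_tendsto_zero[OF deriv cont f f'] by simp
    then have "((\<lambda>x. cmod (F x)) \<longlongrightarrow> 0) at_top"
      by (simp add: F_def norm_mult tendsto_rabs_zero_iff)
    then have "(F \<longlongrightarrow> 0) at_top" by (rule tendsto_norm_zero_cancel)
    then show "((F \<circ> real_of_ereal) \<longlongrightarrow> 0) (at_left \<infinity>)" by (simp add: ereal_tendsto_simps)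
    have "(F \<longlongrightarrow> iexp (u * 0) * of_real L) (at_right 0)"
      unfolding F_def using L by (intro tendsto_intros) 
    then show "((F \<circ> real_of_ereal) \<longlongrightarrow> of_real L) (at_right 0)"
      unfolding zero_ereal_def by (simp add: ereal_tendsto_simps)
  qed (use pi ei in auto)
  then have "(LINT x:{0<..}|lborel. p x) = - of_real L"
    by (simp add: interval_lebesgue_integral_def ei)
  moreover have "(LINT x:{0<..}|lborel. p x) = \<i> * u * half_fourier f u + half_fourier f' u"
    unfolding p_def half_fourier_def
    using set_integrable_iexp_mult[OF f] set_integrable_iexp_mult[OF f']
    by (subst set_integral_add) auto
  ultimately show ?thesis by (simp add: algebra_simps)
qed

text \<open>Solving \<open>half_fourier_deriv\<close> for the transform of \<open>g l\<close> gives
  i/u times the sum of \<open>L l\<close> and the transform of \<open>g (Suc l)\<close>; iteration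
  collects the boundary terms.\<close>

lemma half_fourier_expansion:
  fixes g :: "nat \<Rightarrow> real \<Rightarrow> real" and L :: "nat \<Rightarrow> real"
  assumes deriv: "\<And>l x. l < s \<Longrightarrow> 0 < x \<Longrightarrow> (g l has_real_derivative g (Suc l) x) (at x)"
    and cont: "\<And>x. 0 < x \<Longrightarrow> isCont (g s) x"
    and int: "\<And>l. l \<le> s \<Longrightarrow> set_integrable lborel {0<..} (g l)"
    and L: "\<And>l. l < s \<Longrightarrow> (g l \<longlongrightarrow> L l) (at_right 0)"
    and u: "u \<noteq> 0"
  shows "half_fourier (g 0) u = (\<Sum>l<s. (\<i> / of_real u) ^ Suc l * of_real (L l)) + (\<i> / of_real u) ^ s * half_fourier (g s) u"
proof -
  have "half_fourier (g 0) u = (\<Sum>l<n. (\<i> / of_real u) ^ Suc l * of_real (L l)) + (\<i> / of_real u) ^ n * half_fourier (g n) u"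
    if "n \<le> s" for n
    using that
  proof (induction n)
    case (Suc n)
    have c: "isCont (g (Suc n)) x" if "0 < x" for x
      using cont[OF that] DERIV_isCont[OF deriv[OF _ that, of "Suc n"]] Suc.prems by (cases "Suc n = s") auto
    have "half_fourier (g (Suc n)) u = - of_real (L n) - \<i> * u * half_fourier (g n) u"
      using Suc.prems by (intro half_fourier_deriv deriv c int L) auto
    then have "half_fourier (g n) u = (\<i> / of_real u) * (of_real (L n) + half_fourier (g (Suc n)) u)"
    proof -
      assume "half_fourier (g (Suc n)) u = - of_real (L n) - \<i> * u * half_fourier (g n) u"
      then have e: "of_real (L n) + half_fourier (g (Suc n)) u = - (\<i> * u * half_fourier (g n) u)" by simp
      show ?thesis unfolding e using u by simp
    qed
    then show ?case using Suc by (simp add: algebra_simps)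
  qed simp
  then show ?thesis by blast
qed

text \<open>
  If \<open>K (Suc i)\<close> is the derivative of \<open>K i\<close>, then the \<open>l\<close>-th derivative of \<open>exp (a * x) * K 0 x\<close> is
  \<open>exp (a * x) * exp_jet a K l 0 x\<close>; the recursion avoids the Leibniz formula.
\<close>

primrec exp_jet :: "real \<Rightarrow> (nat \<Rightarrow> real \<Rightarrow> real) \<Rightarrow> nat \<Rightarrow> nat \<Rightarrow> real \<Rightarrow> real" where
  "exp_jet a K 0 i = K i"
| "exp_jet a K (Suc l) i = (\<lambda>x. a * exp_jet a K l i x + exp_jet a K l (Suc i) x)"

context
  fixes a :: real and K :: "nat \<Rightarrow> real \<Rightarrow> real" and s :: nat
  assumes deriv: "\<And>i x. i < s \<Longrightarrow> 0 < x \<Longrightarrow> (K i has_real_derivative K (Suc i) x) (at x)"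
    and cont: "\<And>x. 0 < x \<Longrightarrow> isCont (K s) x"
    and int: "\<And>i. i \<le> s \<Longrightarrow> set_integrable lborel {0<..} (\<lambda>x. exp (a * x) * K i x)"
    and lim: "\<And>i. i \<le> s \<Longrightarrow> \<exists>L. (K i \<longlongrightarrow> L) (at_right 0)"
begin

lemma exp_jet_deriv:
  "l + i < s \<Longrightarrow> 0 < x \<Longrightarrow> (exp_jet a K l i has_real_derivative exp_jet a K l (Suc i) x) (at x)"
proof (induction l arbitrary: i)
  case (Suc l)
  have "((\<lambda>x. a * exp_jet a K l i x + exp_jet a K l (Suc i) x) has_real_derivative
      a * exp_jet a K l (Suc i) x + exp_jet a K l (Suc (Suc i)) x) (at x)"
    using Suc.prems by (intro DERIV_add DERIV_cmult Suc.IH) auto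
  then show ?case by simp
qed (use deriv in auto)

lemma exp_jet_isCont:
  "l + i \<le> s \<Longrightarrow> 0 < x \<Longrightarrow> isCont (exp_jet a K l i) x"
proof (induction l arbitrary: i)
  case 0
  then show ?case using cont DERIV_isCont[OF deriv, of i x] by (cases "i = s") auto
next
  case (Suc l)
  then show ?case by (auto intro!: continuous_intros)
qed

lemma exp_jet_integrable:
  "l + i \<le> s \<Longrightarrow> set_integrable lborel {0<..} (\<lambda>x. exp (a * x) * exp_jet a K l i x)"
proof (induction l arbitrary: i)
  case (Suc l)
  have "set_integrable lborel {0<..} (\<lambda>x. a * (exp (a * x) * exp_jet a K l i x) + exp (a * x) * exp_jet a K l (Suc i) x)"
    using Suc.IH[of i] Suc.IH[of "Suc i"] Suc.prems by (intro set_integral_add set_integrable_mult_right) auto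
  then show ?case by (simp add: algebra_simps)
qed (use int in auto)

lemma exp_jet_limit:
  "l + i \<le> s \<Longrightarrow> \<exists>L. (exp_jet a K l i \<longlongrightarrow> L) (at_right 0)"
proof (induction l arbitrary: i)
  case (Suc l)
  obtain L1 L2 where "(exp_jet a K l i \<longlongrightarrow> L1) (at_right 0)" "(exp_jet a K l (Suc i) \<longlongrightarrow> L2) (at_right 0)"
    using Suc.IH[of i] Suc.IH[of "Suc i"] Suc.prems by auto
  then have "(exp_jet a K (Suc l) i \<longlongrightarrow> a * L1 + L2) (at_right 0)"
    by (auto intro!: tendsto_intros)
  then show ?case ..
qed (use lim in auto)

text \<open>The four conclusions are what \<open>half_fourier_expansion\<close> asks of its
  sequence.\<close>

lemma exp_times_jet_sequence:
  defines "g \<equiv> \<lambda>l x. exp (a * x) * exp_jet a K l 0 x"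
  shows "l < s \<Longrightarrow> 0 < x \<Longrightarrow> (g l has_real_derivative g (Suc l) x) (at x)"
    and "0 < x \<Longrightarrow> isCont (g s) x"
    and "l \<le> s \<Longrightarrow> set_integrable lborel {0<..} (g l)"
    and "l \<le> s \<Longrightarrow> \<exists>L. (g l \<longlongrightarrow> L) (at_right 0)"
proof -
  show "(g l has_real_derivative g (Suc l) x) (at x)" if "l < s" "0 < x"
    unfolding g_def using exp_jet_deriv[of l 0 x] that
    by (auto intro!: derivative_eq_intros simp: algebra_simps)
  show "isCont (g s) x" if "0 < x"
    unfolding g_def using exp_jet_isCont[of s 0 x] that by (intro continuous_intros) auto
  show "set_integrable lborel {0<..} (g l)" if "l \<le> s"
    unfolding g_def using exp_jet_integrable[of l 0] that by simp
  show "\<exists>L. (g l \<longlongrightarrow> L) (at_right 0)" if l: "l \<le> s"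
  proof -
    obtain L where "(exp_jet a K l 0 \<longlongrightarrow> L) (at_right 0)" using exp_jet_limit[of l 0] l by auto
    then have "(g l \<longlongrightarrow> exp (a * 0) * L) (at_right 0)" unfolding g_def by (intro tendsto_intros)
    then show ?thesis ..
  qed
qed

end

text \<open>The choice a = -1 reflects the negative half-line to the positive one, with a^i from the
  chain rule. Both sides of \<open>k\<close> then fit the half-line expansion of exp(a x) K 0
  x.\<close>

lemma class_Gs_derivative_sequence:
  fixes k :: "real \<Rightarrow> real"
  assumes k: "(\<gamma>, k) \<in> class_Gs s T R \<alpha>bar" and a: "a = 1 \<or> a = (-1 :: real)"
  defines "K \<equiv> \<lambda>i x. a ^ i * (deriv ^^ i) k (a * x)"
  shows "i < s \<Longrightarrow> 0 < x \<Longrightarrow> (K i has_real_derivative K (Suc i) x) (at x)"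
    and "0 < x \<Longrightarrow> isCont (K s) x"
    and "i \<le> s \<Longrightarrow> set_integrable lborel {0<..} (\<lambda>x. exp (a * x) * K i x)"
    and "i \<le> s \<Longrightarrow> \<exists>L. (K i \<longlongrightarrow> L) (at_right 0)"
    and "i \<le> s \<Longrightarrow> integrable lborel (\<lambda>x. max 1 (exp x) * (deriv ^^ i) k x)"
    and "i \<le> s \<Longrightarrow> (deriv ^^ i) k \<in> borel_measurable borel"
proof -
  have diff: "(deriv ^^ l) k differentiable (at x)" if "l < s" "x \<noteq> 0" for l x
    using k that unfolding class_Gs_def by blast
  have conts: "continuous_on (- {0}) ((deriv ^^ s) k)" using k by (simp add: class_Gs_def)
  have lims: "(\<exists>L. ((deriv ^^ l) k \<longlongrightarrow> L) (at_right 0)) \<and> (\<exists>L. ((deriv ^^ l) k \<longlongrightarrow> L) (at_left 0))" if "l \<le> s" for l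
    using k that unfolding class_Gs_def by blast
  have L1: "L1_norm (\<lambda>x. max 1 (exp x) * (deriv ^^ l) k x) \<le> ennreal R" if "l \<le> s" for l
    using k that unfolding class_Gs_def by blast
  have cont: "continuous_on (- {0}) ((deriv ^^ i) k)" if "i \<le> s" for i
  proof (cases "i = s")
    case False
    then show ?thesis using diff[of i] that
      by (intro continuous_at_imp_continuous_on) (auto intro: differentiable_imp_continuous_within)
  qed (use conts in simp)
  have isCont: "isCont ((deriv ^^ i) k) x" if "i \<le> s" "x \<noteq> 0" for i x
    using cont[OF that(1)] that(2) by (simp add: continuous_on_eq_continuous_at open_Compl)
  have a0: "a \<noteq> 0" "a * a = 1" "\<bar>a\<bar> = 1" using a by auto
  show meas: "(deriv ^^ i) k \<in> borel_measurable borel" if "i \<le> s" for i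
    by (rule borel_measurable_continuous_countable_exceptions[OF _ cont[OF that]]) simp
  show intm: "integrable lborel (\<lambda>x. max 1 (exp x) * (deriv ^^ i) k x)" if "i \<le> s" for i
  proof (rule integrableI_bounded)
    show "(\<lambda>x. max 1 (exp x) * (deriv ^^ i) k x) \<in> borel_measurable lborel" using meas[OF that] by measurable
    show "(\<integral>\<^sup>+ x. ennreal (norm (max 1 (exp x) * (deriv ^^ i) k x)) \<partial>lborel) < \<infinity>"
      using L1[OF that] unfolding L1_norm_def by (auto intro: le_less_trans)
  qed
  show "(K i has_real_derivative K (Suc i) x) (at x)" if "i < s" "0 < x"
  proof -
    have "((deriv ^^ i) k has_real_derivative (deriv ^^ Suc i) k (a * x)) (at (a * x))"
      using diff[of i "a * x"] that a0 by (simp add: DERIV_deriv_iff_real_differentiable)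
    then have "((\<lambda>x. (deriv ^^ i) k (a * x)) has_real_derivative (deriv ^^ Suc i) k (a * x) * a) (at x)"
      by (rule DERIV_chain2) (auto intro!: derivative_eq_intros)
    then show ?thesis unfolding K_def by (auto intro!: derivative_eq_intros)
  qed
  show "isCont (K s) x" if "0 < x"
  proof -
    have "isCont ((deriv ^^ s) k) (a * x)" using isCont that a0 by simp
    then have "isCont (\<lambda>x. (deriv ^^ s) k (a * x)) x"
      by (rule isCont_o2[rotated]) (intro continuous_intros)
    then show ?thesis unfolding K_def by (intro continuous_intros)
  qed
  show "set_integrable lborel {0<..} (\<lambda>x. exp (a * x) * K i x)" if i: "i \<le> s"
  proof -
    have "integrable lborel (\<lambda>x. max 1 (exp (0 + a * x)) * (deriv ^^ i) k (0 + a * x))"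
      by (rule lborel_integrable_real_affine[OF intm[OF i] a0(1)])
    then have 1: "integrable lborel (\<lambda>x. max 1 (exp (a * x)) * (deriv ^^ i) k (a * x))" by simp
    note meas[OF i, measurable]
    show ?thesis unfolding set_integrable_def
    proof (rule Bochner_Integration.integrable_bound[OF 1])
      show "(\<lambda>x. indicator {0<..} x *\<^sub>R (exp (a * x) * K i x)) \<in> borel_measurable lborel"
        unfolding K_def by measurable
      have "\<bar>exp (a * x) * K i x\<bar> \<le> \<bar>max 1 (exp (a * x)) * (deriv ^^ i) k (a * x)\<bar>" for x
        using a0 by (auto simp: K_def abs_mult power_abs intro!: mult_right_mono)
      then show "AE x in lborel. norm (indicator {0<..} x *\<^sub>R (exp (a * x) * K i x)) \<le> norm (max 1 (exp (a * x)) * (deriv ^^ i) k (a * x))"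
        by (intro AE_I2) (auto simp: indicator_def)
    qed
  qed
  show "\<exists>L. (K i \<longlongrightarrow> L) (at_right 0)" if i: "i \<le> s"
  proof -
    obtain L where "((\<lambda>x. (deriv ^^ i) k (a * x)) \<longlongrightarrow> L) (at_right 0)"
    proof (cases "a = 1")
      case True
      then show ?thesis using lims[OF i] that by auto
    next
      case False
      then have "a = -1" using a by simp
      moreover obtain L where "((deriv ^^ i) k \<longlongrightarrow> L) (at_left 0)" using lims[OF i] by auto
      ultimately show ?thesis using that by (simp add: filterlim_at_left_to_right)
    qed
    then have "(K i \<longlongrightarrow> a ^ i * L) (at_right 0)" unfolding K_def by (intro tendsto_intros)
    then show ?thesis ..
  qed
qed

lemma class_Gs_levy_integrable:
  assumes "(\<gamma>, k) \<in> class_Gs s T R \<alpha>bar"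
  shows "k \<in> borel_measurable borel" "integrable lborel (\<lambda>x. max 1 (exp x) * k x)"
    "integrable lborel (\<lambda>x. exp x * k x)"
proof -
  note Kf = class_Gs_derivative_sequence[OF assms, of 1]
  show m: "k \<in> borel_measurable borel" using Kf(6)[of 0] by simp
  show i: "integrable lborel (\<lambda>x. max 1 (exp x) * k x)" using Kf(5)[of 0] by simp
  show "integrable lborel (\<lambda>x. exp x * k x)"
    using i by (rule Bochner_Integration.integrable_bound) (use m in \<open>auto intro!: AE_I2 mult_right_mono simp: abs_mult\<close>)
qed

section \<open>Log-modulus of the shifted characteristic function\<close>

lemma integral_eq_half_line:
  fixes f :: "real \<Rightarrow> real"
  assumes f: "integrable lborel f"
  shows "(LINT x|lborel. f x) = (LINT x:{0<..}|lborel. f x + f (- x))"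
    and "set_integrable lborel {0<..} (\<lambda>x. f x + f (- x))"
proof -
  have f': "integrable lborel (\<lambda>x. f (- x))"
    using lborel_integrable_real_affine[OF f, of "-1" 0] by simp
  have i1: "integrable lborel (\<lambda>x. indicator {0<..} x *\<^sub>R f x)"
    and i2: "integrable lborel (\<lambda>x. indicator {0<..} x *\<^sub>R f (- x))"
    and i3: "integrable lborel (\<lambda>x. indicator {..<0} x *\<^sub>R f x)"
    by (intro integrable_mult_indicator f f'; simp)+
  show "set_integrable lborel {0<..} (\<lambda>x. f x + f (- x))"
    using Bochner_Integration.integrable_add[OF i1 i2] by (simp add: set_integrable_def distrib_left)
  have "(LINT x|lborel. f x) = (LINT x|lborel. indicator {0<..} x *\<^sub>R f x + indicator {..<0} x *\<^sub>R f x)"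
  proof (rule integral_cong_AE)
    show "AE x in lborel. f x = indicator {0<..} x *\<^sub>R f x + indicator {..<0} x *\<^sub>R f x"
      using AE_lborel_singleton[of "0::real"] by eventually_elim (auto simp: indicator_def)
  qed (use f i1 i3 in auto)
  also have "\<dots> = (LINT x|lborel. indicator {0<..} x *\<^sub>R f x) + (LINT x|lborel. indicator {..<0} x *\<^sub>R f x)"
    using i1 i3 by simp
  also have "(LINT x|lborel. indicator {..<0} x *\<^sub>R f x) = (LINT x|lborel. indicator {0<..} x *\<^sub>R f (- x))"
    using lborel_integral_real_affine[of "-1" "\<lambda>x. indicator {..<0} x *\<^sub>R f x" 0]
    by (simp add: indicator_def)
  finally show "(LINT x|lborel. f x) = (LINT x:{0<..}|lborel. f x + f (- x))"
    using i1 i2 by (simp add: set_lebesgue_integral_def distrib_left)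
qed

text \<open>This is log |\<phi>(u)| / T for the shifted characteristic function \<phi>, see
  \<open>cmod_levy_cf_shifted\<close>. The factor exp x stems from the shift by -i.\<close>

definition re_exponent :: "(real \<Rightarrow> real) \<Rightarrow> real \<Rightarrow> real" where
  "re_exponent k u = (LINT x|lborel. (cos (u * x) - 1) * (exp x * k x / \<bar>x\<bar>))"

lemma abs_cos_minus_one_le: "\<bar>cos x - 1\<bar> \<le> \<bar>x\<bar>" for x :: real
proof -
  have "\<bar>cos x - cos 0\<bar> \<le> 1 * \<bar>x - 0\<bar>"
    using field_differentiable_bound[of UNIV cos "\<lambda>x. - sin x" 1 x 0]
    by (auto intro!: derivative_eq_intros)
  then show ?thesis by simp
qed

lemma re_exponent_bound: "\<bar>(cos (u * x) - 1) * (exp x * k x / \<bar>x\<bar>)\<bar> \<le> \<bar>u\<bar> * \<bar>exp x * k x\<bar>" for u x :: real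
proof (cases "x = 0")
  case False
  have "\<bar>(cos (u * x) - 1) * (exp x * k x / \<bar>x\<bar>)\<bar> \<le> \<bar>u * x\<bar> * \<bar>exp x * k x / \<bar>x\<bar>\<bar>"
    unfolding abs_mult[of "cos (u * x) - 1"] by (intro mult_right_mono abs_cos_minus_one_le) simp
  also have "\<dots> = \<bar>u\<bar> * \<bar>exp x * k x\<bar>" using False by (simp add: abs_mult)
  finally show ?thesis .
qed simp

context
  fixes k :: "real \<Rightarrow> real"
  assumes k: "integrable lborel (\<lambda>x. exp x * k x)"
begin

lemma re_exponent_integrable: "integrable lborel (\<lambda>x. (cos (u * x) - 1) * (exp x * k x / \<bar>x\<bar>))"
proof (rule Bochner_Integration.integrable_bound)
  show "integrable lborel (\<lambda>x. \<bar>u\<bar> * (exp x * k x))" using k by simp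
  have "(\<lambda>x. exp x * k x) \<in> borel_measurable lborel" using k by (rule borel_measurable_integrable)
  then show "(\<lambda>x. (cos (u * x) - 1) * (exp x * k x / \<bar>x\<bar>)) \<in> borel_measurable lborel" by measurable
  show "AE x in lborel. norm ((cos (u * x) - 1) * (exp x * k x / \<bar>x\<bar>)) \<le> norm (\<bar>u\<bar> * (exp x * k x))"
    using re_exponent_bound by (auto simp: abs_mult)
qed

lemma abs_re_exponent_le: "\<bar>re_exponent k u\<bar> \<le> \<bar>u\<bar> * (LINT x|lborel. \<bar>exp x * k x\<bar>)"
proof -
  have "\<bar>re_exponent k u\<bar> \<le> (LINT x|lborel. \<bar>(cos (u * x) - 1) * (exp x * k x / \<bar>x\<bar>)\<bar>)"
    unfolding re_exponent_def by (rule integral_abs_bound)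
  also have "\<dots> \<le> (LINT x|lborel. \<bar>u\<bar> * \<bar>exp x * k x\<bar>)"
    by (intro integral_mono integrable_abs re_exponent_integrable integrable_mult_right k re_exponent_bound)
  finally show ?thesis using k by simp
qed

lemma re_exponent_even: "re_exponent k (- u) = re_exponent k u"
  by (simp add: re_exponent_def)

text \<open>Differentiating cos(ux) - 1 produces a factor x that turns 1/|x| into sgn x. So the
  derivative, unlike the function itself, is part of a half-line Fourier transform without singular
  factor; the expansion is made there and integrated afterwards.\<close>

lemma re_exponent_deriv:
  "(re_exponent k has_real_derivative - Im (half_fourier (\<lambda>x. exp x * k x + exp (- x) * k (- x)) u)) (at u)"
proof -
  define h where "h x = exp x * k x + exp (- x) * k (- x)" for x
  have k': "integrable lborel (\<lambda>x. sgn x * (exp x * k x))"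
  proof (rule Bochner_Integration.integrable_bound[OF k])
    have "(\<lambda>x. exp x * k x) \<in> borel_measurable lborel" using k by (rule borel_measurable_integrable)
    then show "(\<lambda>x. sgn x * (exp x * k x)) \<in> borel_measurable lborel" by measurable
  qed (auto simp: sgn_if)
  have hi: "set_integrable lborel {0<..} h"
    using integral_eq_half_line(2)[OF k] by (simp add: h_def[abs_def])
  have d: "(re_exponent k has_real_derivative (LINT x|lborel. - sin (u * x) * (sgn x * (exp x * k x)))) (at u)"
    unfolding re_exponent_def
  proof (rule has_field_derivative_lebesgue_integral[where S = UNIV and g = "\<lambda>x. \<bar>exp x * k x\<bar>" and f' = "\<lambda>u x. - sin (u * x) * (sgn x * (exp x * k x))"])
    fix y x :: real
    show "((\<lambda>y. (cos (y * x) - 1) * (exp x * k x / \<bar>x\<bar>)) has_real_derivative - sin (y * x) * (sgn x * (exp x * k x))) (at y)"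
      by (rule DERIV_cong, (rule derivative_intros)+) (auto simp: sgn_if)
    have "\<bar>sin (y * x)\<bar> * \<bar>sgn x * (exp x * k x)\<bar> \<le> 1 * \<bar>exp x * k x\<bar>"
      by (intro mult_mono) (auto simp: abs_mult sgn_if)
    then show "norm (- sin (y * x) * (sgn x * (exp x * k x))) \<le> \<bar>exp x * k x\<bar>" by (simp add: abs_mult)
  next
    show "(\<lambda>x. - sin (u * x) * (sgn x * (exp x * k x))) \<in> borel_measurable lborel"
      using borel_measurable_integrable[OF k'] by measurable
  qed (use k re_exponent_integrable in auto)
  have si: "integrable lborel (\<lambda>x. - sin (u * x) * (sgn x * (exp x * k x)))"
  proof (rule Bochner_Integration.integrable_bound[OF k'])
    show "(\<lambda>x. - sin (u * x) * (sgn x * (exp x * k x))) \<in> borel_measurable lborel"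
      using borel_measurable_integrable[OF k'] by measurable
    have "\<bar>sin (u * x)\<bar> * \<bar>sgn x * (exp x * k x)\<bar> \<le> 1 * \<bar>sgn x * (exp x * k x)\<bar>" for x
      by (intro mult_right_mono) auto
    then show "AE x in lborel. norm (- sin (u * x) * (sgn x * (exp x * k x))) \<le> norm (sgn x * (exp x * k x))"
      by (intro AE_I2) (simp add: abs_mult)
  qed
  have "(LINT x|lborel. - sin (u * x) * (sgn x * (exp x * k x))) = (LINT x:{0<..}|lborel. - (sin (u * x) * h x))"
    unfolding integral_eq_half_line(1)[OF si] by (rule set_lebesgue_integral_cong) (auto simp: h_def algebra_simps)
  also have "\<dots> = - (LINT x:{0<..}|lborel. Im (iexp (u * x) * complex_of_real (h x)))"
    by (simp add: set_lebesgue_integral_def Im_exp)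
  also have "(LINT x:{0<..}|lborel. Im (iexp (u * x) * complex_of_real (h x))) = Im (half_fourier h u)"
  proof -
    have "integrable lborel (\<lambda>x. indicator {0<..} x *\<^sub>R (iexp (u * x) * complex_of_real (h x)))"
      using set_integrable_iexp_mult[OF hi] by (simp add: set_integrable_def)
    from integral_Im[OF this] show ?thesis
      by (simp add: half_fourier_def set_lebesgue_integral_def)
  qed
  finally show ?thesis using d by (simp add: h_def[abs_def])
qed

end

text \<open>With \<open>r\<close> a primitive of -C / u^(n + 1), the function D + r decreases and D
  - r increases, and they enclose a common limit. Monotonicity replaces an improper integral of
  \<open>D'\<close>.\<close>

lemma limit_with_rate:
  fixes D D' :: "real \<Rightarrow> real"
  assumes deriv: "\<And>u. 1 \<le> u \<Longrightarrow> (D has_real_derivative D' u) (at u)"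
    and bound: "\<And>u. 1 \<le> u \<Longrightarrow> \<bar>D' u\<bar> \<le> C / u ^ Suc n" and n: "1 \<le> n"
  obtains L where "\<And>u. 1 \<le> u \<Longrightarrow> \<bar>D u - L\<bar> \<le> C / u ^ n"
proof -
  have C: "0 \<le> C" using bound[of 1] by (auto intro: order_trans[OF abs_ge_zero])
  define r where "r u = C / real n / u ^ n" for u
  have dr: "(r has_real_derivative - (C / u ^ Suc n)) (at u)" if "1 \<le> u" for u
  proof -
    have "(r has_real_derivative - (C / real n * (real n * u ^ (n - 1))) / (u ^ n * u ^ n)) (at u)"
      unfolding r_def using that by (auto intro!: derivative_eq_intros)
    moreover have "(C / real n * (real n * u ^ (n - 1))) / (u ^ n * u ^ n) = C / u ^ Suc n"
    proof -
      obtain m where m: "n = Suc m" using n by (cases n) auto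
      have "C / real n * (real n * u ^ (n - 1)) = C * u ^ m" unfolding m by simp
      then show ?thesis using that unfolding m by simp
    qed
    ultimately show ?thesis by simp
  qed
  have up: "D v + r v \<le> D u + r u" if "1 \<le> u" "u \<le> v" for u v
  proof (rule DERIV_nonpos_imp_nonincreasing[OF that(2)])
    fix x assume "u \<le> x" "x \<le> v"
    then have x: "1 \<le> x" using that by simp
    have "((\<lambda>u. D u + r u) has_real_derivative D' x + - (C / x ^ Suc n)) (at x)"
      by (intro DERIV_add deriv dr x)
    moreover have "D' x + - (C / x ^ Suc n) \<le> 0" using bound[OF x] by linarith
    ultimately show "\<exists>y. ((\<lambda>u. D u + r u) has_real_derivative y) (at x) \<and> y \<le> 0" by blast
  qed
  have lo: "D u - r u \<le> D v - r v" if "1 \<le> u" "u \<le> v" for u v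
  proof (rule DERIV_nonneg_imp_nondecreasing[OF that(2)])
    fix x assume "u \<le> x" "x \<le> v"
    then have x: "1 \<le> x" using that by simp
    have "((\<lambda>u. D u - r u) has_real_derivative D' x - - (C / x ^ Suc n)) (at x)"
      by (intro DERIV_diff deriv dr x)
    moreover have "0 \<le> D' x - - (C / x ^ Suc n)" using bound[OF x] by linarith
    ultimately show "\<exists>y. ((\<lambda>u. D u - r u) has_real_derivative y) (at x) \<and> 0 \<le> y" by blast
  qed
  have r0: "0 \<le> r u" if "1 \<le> u" for u using C that by (simp add: r_def)
  have cross: "D u - r u \<le> D v + r v" if "1 \<le> u" "1 \<le> v" for u v
  proof -
    have m: "1 \<le> max u v" using that by simp
    have "D u - r u \<le> D (max u v) - r (max u v)" using that by (intro lo) auto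
    also have "\<dots> \<le> D (max u v) + r (max u v)" using r0[OF m] by simp
    also have "\<dots> \<le> D v + r v" using that by (intro up) auto
    finally show ?thesis .
  qed
  define L where "L = (INF u\<in>{1..}. D u + r u)"
  have "D u - r u \<le> L" if "1 \<le> u" for u
    unfolding L_def using cross[OF that] by (intro cINF_greatest) auto
  moreover have "L \<le> D u + r u" if "1 \<le> u" for u
    unfolding L_def using cross[of 1] that by (intro cINF_lower bdd_belowI2[of _ "D 1 - r 1"]) auto
  ultimately have "\<bar>D u - L\<bar> \<le> r u" if "1 \<le> u" for u
    using that by (smt (verit))
  moreover have "r u \<le> C / u ^ n" if "1 \<le> u" for u
  proof -
    have "C / real n \<le> C / 1" using C n by (intro divide_left_mono) auto
    then show ?thesis unfolding r_def using that by (intro divide_right_mono) auto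
  qed
  ultimately show thesis using that by (meson order_trans)
qed

lemma Im_i_power_mult: "Im ((\<i> / of_real u) ^ l * of_real r) = Im (\<i> ^ l) * r / u ^ l"
proof -
  have "(\<i> / of_real u) ^ l * of_real r = of_real (r / u ^ l) * \<i> ^ l"
    by (simp add: power_divide mult_ac)
  then show ?thesis by (simp add: Im_complex_of_real mult_ac del: of_real_divide)
qed

text \<open>Boundary terms of odd index are real and drop out of the imaginary part. This is why, up
  to the remainder, only even powers of 1/u occur and the weight has vanishing moments for even
  j.\<close>

lemma Im_i_power_odd_index: "odd l \<Longrightarrow> Im (\<i> ^ Suc l) = 0"
  by (auto elim!: oddE simp: power_mult[symmetric] power_add)

text \<open>The boundary term of index 0 is \<open>jump_sum k\<close> / u, whose primitive is the
  logarithm. Even indices up to s - 2 give the powers; index s - 1, whatever its parity, joins the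
  remainder of order u^(-s), which loses one power on integration.\<close>

lemma re_exponent_expansion_at_top:
  fixes k :: "real \<Rightarrow> real"
  assumes k: "(\<gamma>, k) \<in> class_Gs s T R \<alpha>bar" and s: "2 \<le> s"
  obtains c :: "nat \<Rightarrow> real" and L C :: real where
    "\<And>u. 1 \<le> u \<Longrightarrow> \<bar>re_exponent k u + jump_sum k * ln u - (\<Sum>l | l \<in> {1..s - 2} \<and> even l. c l / u ^ l) - L\<bar> \<le> C / u ^ (s - 1)"
proof -
  define K where "K a i x = a ^ i * (deriv ^^ i) k (a * x)" for a :: real and i x
  define G where "G a l x = exp (a * x) * exp_jet a (K a) l 0 x" for a :: real and l x
  define g where "g l x = G 1 l x + G (-1) l x" for l x
  note Kf = class_Gs_derivative_sequence[OF k, folded K_def]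
  have Gf: "l < s \<Longrightarrow> 0 < x \<Longrightarrow> (G a l has_real_derivative G a (Suc l) x) (at x)"
      "0 < x \<Longrightarrow> isCont (G a s) x"
      "l \<le> s \<Longrightarrow> set_integrable lborel {0<..} (G a l)"
      "l \<le> s \<Longrightarrow> \<exists>L. (G a l \<longlongrightarrow> L) (at_right 0)"
    if a: "a = 1 \<or> a = -1" for a l x
    using exp_times_jet_sequence[where a = a and K = "K a" and s = s] Kf(1-4)[OF a]
    unfolding G_def[abs_def] by auto
  have gd: "(g l has_real_derivative g (Suc l) x) (at x)" if "l < s" "0 < x" for l x
    unfolding g_def using that by (intro DERIV_add Gf) auto
  have gc: "isCont (g s) x" if "0 < x" for x
    unfolding g_def using that by (intro continuous_intros Gf) auto
  have gi: "set_integrable lborel {0<..} (g l)" if "l \<le> s" for l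
    unfolding g_def using that by (intro set_integral_add Gf) auto
  have "\<exists>L. (g l \<longlongrightarrow> L) (at_right 0)" if l: "l \<le> s" for l
  proof -
    obtain L1 L2 where "(G 1 l \<longlongrightarrow> L1) (at_right 0)" "(G (-1) l \<longlongrightarrow> L2) (at_right 0)"
      using Gf(4)[of 1 l] Gf(4)[of "-1" l] l by auto
    then have "(g l \<longlongrightarrow> L1 + L2) (at_right 0)" unfolding g_def by (intro tendsto_intros)
    then show ?thesis ..
  qed
  then have "\<exists>M. \<forall>l. l \<le> s \<longrightarrow> (g l \<longlongrightarrow> M l) (at_right 0)" by metis
  then obtain M where M: "\<And>l. l \<le> s \<Longrightarrow> (g l \<longlongrightarrow> M l) (at_right 0)" by blast
  have g0: "g 0 = (\<lambda>x. exp x * k x + exp (- x) * k (- x))"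
    by (simp add: g_def G_def K_def fun_eq_iff)
  have M0: "M 0 = jump_sum k"
  proof -
    have "\<forall>l\<le>s. (\<exists>L. ((deriv ^^ l) k \<longlongrightarrow> L) (at_right 0)) \<and> (\<exists>L. ((deriv ^^ l) k \<longlongrightarrow> L) (at_left 0))"
      using k unfolding class_Gs_def by blast
    from this[rule_format, of 0] obtain p q where pq: "(k \<longlongrightarrow> p) (at_right 0)" "(k \<longlongrightarrow> q) (at_left 0)" by auto
    have q': "((\<lambda>x. k (- x)) \<longlongrightarrow> q) (at_right 0)"
      using pq(2) by (simp add: filterlim_at_left_to_right)
    have "(g 0 \<longlongrightarrow> exp 0 * p + exp (- 0) * q) (at_right 0)"
      unfolding g0 using pq(1) q' by (intro tendsto_intros)
    then have "M 0 = p + q" using tendsto_unique[OF _ M[of 0]] by simp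
    moreover have "jump_sum k = p + q"
      unfolding jump_sum_def using tendsto_Lim[OF _ pq(1)] tendsto_Lim[OF _ pq(2)] by simp
    ultimately show ?thesis by simp
  qed
  note ke = class_Gs_levy_integrable(3)[OF k]
  \<comment> \<open>Makes the derivative of \<open>c l\<close> / u^l equal to minus the boundary
    term of index l.\<close>
  define c where "c l = Im (\<i> ^ Suc l) * M l / real l" for l
  define E where "E = {l \<in> {1..s - 2}. even l}"
  have finE: "finite E" by (simp add: E_def)
  define D where "D u = re_exponent k u + jump_sum k * ln u - (\<Sum>l\<in>E. c l / u ^ l)" for u
  define D' where "D' u = - Im ((\<i> / of_real u) ^ Suc (s - 1) * of_real (M (s - 1)) + (\<i> / of_real u) ^ s * half_fourier (g s) u)" for u
  define C where "C = \<bar>M (s - 1)\<bar> + (LINT x:{0<..}|lborel. \<bar>g s x\<bar>)"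
  have deriv: "(D has_real_derivative D' u) (at u)" if u: "1 \<le> u" for u
  proof -
    have "half_fourier (g 0) u = (\<Sum>l<s. (\<i> / of_real u) ^ Suc l * of_real (M l)) + (\<i> / of_real u) ^ s * half_fourier (g s) u"
      using u by (intro half_fourier_expansion gd gc gi M) auto
    then have "Im (half_fourier (g 0) u) = (\<Sum>l<s. Im (\<i> ^ Suc l) * M l / u ^ Suc l) + Im ((\<i> / of_real u) ^ s * half_fourier (g s) u)"
      by (simp only: Im_sum Im_i_power_mult plus_complex.sel)
    also have "(\<Sum>l<s. Im (\<i> ^ Suc l) * M l / u ^ Suc l)
        = jump_sum k / u + (\<Sum>l\<in>E. Im (\<i> ^ Suc l) * M l / u ^ Suc l) + Im (\<i> ^ Suc (s - 1)) * M (s - 1) / u ^ Suc (s - 1)"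
    proof -
      \<comment> \<open>The index s - 1 is listed separately and is not in \<open>E\<close>, which
        ends at s - 2; for s = 2 the set \<open>E\<close> is empty and only the indices 0 and 1
        remain.\<close>
      have "(\<Sum>l<s. Im (\<i> ^ Suc l) * M l / u ^ Suc l) = (\<Sum>l\<in>insert 0 (insert (s - 1) E). Im (\<i> ^ Suc l) * M l / u ^ Suc l)"
      proof (rule sum.mono_neutral_right)
        show "insert 0 (insert (s - 1) E) \<subseteq> {..<s}" using s by (auto simp: E_def)
        have "odd l" if "l < s" "l \<noteq> 0" "l \<noteq> s - 1" "l \<notin> E" for l
          using that by (auto simp: E_def)
        then show "\<forall>l\<in>{..<s} - insert 0 (insert (s - 1) E). Im (\<i> ^ Suc l) * M l / u ^ Suc l = 0"
          by (auto simp del: power_Suc simp: Im_i_power_odd_index)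
      qed simp
      also have "\<dots> = jump_sum k / u + (Im (\<i> ^ Suc (s - 1)) * M (s - 1) / u ^ Suc (s - 1) + (\<Sum>l\<in>E. Im (\<i> ^ Suc l) * M l / u ^ Suc l))"
      proof -
        have "0 \<notin> insert (s - 1) E" "s - 1 \<notin> E" using s by (auto simp: E_def)
        then show ?thesis using finE M0 by (simp del: power_Suc)
      qed
      finally show ?thesis by simp
    qed
    finally have Im_eq: "- Im (half_fourier (g 0) u) + jump_sum k / u + (\<Sum>l\<in>E. Im (\<i> ^ Suc l) * M l / u ^ Suc l) = D' u"
      unfolding D'_def plus_complex.sel Im_i_power_mult by simp
    have d1: "(re_exponent k has_real_derivative - Im (half_fourier (g 0) u)) (at u)"
      unfolding g0 by (rule re_exponent_deriv[OF ke])
    have d2: "((\<lambda>u. jump_sum k * ln u) has_real_derivative jump_sum k / u) (at u)"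
      using u by (auto intro!: derivative_eq_intros)
    have d3: "((\<lambda>u. c l / u ^ l) has_real_derivative - (Im (\<i> ^ Suc l) * M l / u ^ Suc l)) (at u)" if l: "l \<in> E" for l
    proof -
      have "((\<lambda>u. c l / u ^ l) has_real_derivative - (c l * (real l * u ^ (l - 1))) / (u ^ l * u ^ l)) (at u)"
        using u by (auto intro!: derivative_eq_intros)
      moreover have "c l * (real l * u ^ (l - 1)) / (u ^ l * u ^ l) = Im (\<i> ^ Suc l) * M l / u ^ Suc l"
      proof -
        obtain m where m: "l = Suc m" using l by (cases l) (auto simp: E_def)
        have "c l * (real l * u ^ (l - 1)) = Im (\<i> ^ Suc l) * M l * u ^ m"
          unfolding c_def m by (simp del: power_Suc)
        then show ?thesis using u unfolding m by simp
      qed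
      ultimately show ?thesis by (simp del: power_Suc)
    qed
    have "(D has_real_derivative (- Im (half_fourier (g 0) u) + jump_sum k / u - (\<Sum>l\<in>E. - (Im (\<i> ^ Suc l) * M l / u ^ Suc l)))) (at u)"
      unfolding D_def by (intro DERIV_diff DERIV_add DERIV_sum d1 d2 d3)
    then show ?thesis using Im_eq by (simp add: sum_negf del: power_Suc)
  qed
  have bound: "\<bar>D' u\<bar> \<le> C / u ^ Suc (s - 1)" if u: "1 \<le> u" for u
  proof -
    have s1: "Suc (s - 1) = s" using s by simp
    have "\<bar>D' u\<bar> \<le> cmod ((\<i> / of_real u) ^ s * of_real (M (s - 1)) + (\<i> / of_real u) ^ s * half_fourier (g s) u)"
      unfolding D'_def s1 abs_minus_cancel by (rule abs_Im_le_cmod)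
    also have "\<dots> \<le> cmod ((\<i> / of_real u) ^ s * of_real (M (s - 1))) + cmod ((\<i> / of_real u) ^ s * half_fourier (g s) u)"
      by (rule norm_triangle_ineq)
    also have "\<dots> = (\<bar>M (s - 1)\<bar> + cmod (half_fourier (g s) u)) / u ^ s"
      using u by (simp add: norm_mult norm_power norm_divide power_divide add_divide_distrib)
    also have "\<dots> \<le> C / u ^ s"
      unfolding C_def using u half_fourier_norm_le[OF gi[of s]] by (intro divide_right_mono add_mono) auto
    finally show ?thesis unfolding s1 .
  qed
  have s1: "1 \<le> s - 1" using s by simp
  obtain L where L: "\<And>u. 1 \<le> u \<Longrightarrow> \<bar>D u - L\<bar> \<le> C / u ^ (s - 1)"
    using limit_with_rate[OF deriv bound s1] by metis
  then show thesis
    using that[of c L C] unfolding D_def E_def by simp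
qed

lemma abs_ln_le_inverse:
  fixes u :: real
  assumes "0 < u" "u \<le> 1"
  shows "\<bar>ln u\<bar> \<le> 1 / u"
proof -
  have "ln (1 / u) \<le> 1 / u - 1" using assms by (intro ln_le_minus_one) auto
  moreover have "ln u \<le> 0" using assms by simp
  ultimately show ?thesis using assms by (simp add: ln_div)
qed

text \<open>For 0 < u < 1 each term is bounded by a constant times u^(-(s-1)), the logarithm because
  |ln u| \<le> 1/u and s \<ge> 2; negative u follow by evenness. The blow-up at 0 is harmless, since
  the weight vanishes there at the rate |u|^(s-1).\<close>

lemma re_exponent_expansion:
  fixes k :: "real \<Rightarrow> real"
  assumes k: "(\<gamma>, k) \<in> class_Gs s T R \<alpha>bar" and s: "2 \<le> s"
  shows "\<exists>(c :: nat \<Rightarrow> real) L C. 0 \<le> C \<and> (\<forall>u. u \<noteq> 0 \<longrightarrow>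
    \<bar>re_exponent k u + jump_sum k * ln \<bar>u\<bar> - (\<Sum>l | l \<in> {1..s - 2} \<and> even l. c l / u ^ l) - L\<bar> \<le> C / \<bar>u\<bar> ^ (s - 1))"
proof -
  obtain c L C where C: "\<And>u. 1 \<le> u \<Longrightarrow> \<bar>re_exponent k u + jump_sum k * ln u - (\<Sum>l | l \<in> {1..s - 2} \<and> even l. c l / u ^ l) - L\<bar> \<le> C / u ^ (s - 1)"
    using re_exponent_expansion_at_top[OF k s] by blast
  let ?E = "{l. l \<in> {1..s - 2} \<and> even l}"
  note ke = class_Gs_levy_integrable(3)[OF k]
  define B where "B = (LINT x|lborel. \<bar>exp x * k x\<bar>)"
  have B: "0 \<le> B" unfolding B_def by simp
  define C' where "C' = max C (B + \<bar>jump_sum k\<bar> + (\<Sum>l\<in>?E. \<bar>c l\<bar>) + \<bar>L\<bar>)"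
  have pos: "\<bar>re_exponent k u + jump_sum k * ln u - (\<Sum>l\<in>?E. c l / u ^ l) - L\<bar> \<le> C' / u ^ (s - 1)" if u: "0 < u" for u
  proof (cases "1 \<le> u")
    case True
    have "C / u ^ (s - 1) \<le> C' / u ^ (s - 1)" using u by (intro divide_right_mono) (auto simp: C'_def)
    then show ?thesis using C[OF True] by simp
  next
    case False
    then have u1: "u \<le> 1" by simp
    have p1: "1 \<le> 1 / u ^ (s - 1)" using u u1 by (simp add: power_le_one)
    have pl: "1 / u ^ l \<le> 1 / u ^ (s - 1)" if "l \<le> s - 1" for l
      using u u1 that by (intro divide_left_mono power_decreasing) auto
    have "\<bar>re_exponent k u\<bar> \<le> u * B" using abs_re_exponent_le[OF ke, of u] u by (simp add: B_def)
    also have "\<dots> \<le> B" using B u1 by (simp add: mult_left_le_one_le u less_imp_le)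
    also have "\<dots> \<le> B * (1 / u ^ (s - 1))" using mult_left_mono[OF p1 B] by simp
    finally have t1: "\<bar>re_exponent k u\<bar> \<le> B * (1 / u ^ (s - 1))" .
    have "\<bar>ln u\<bar> \<le> 1 / u ^ 1" using abs_ln_le_inverse[OF u u1] by simp
    also have "\<dots> \<le> 1 / u ^ (s - 1)" using s by (intro pl) simp
    finally have t2: "\<bar>jump_sum k * ln u\<bar> \<le> \<bar>jump_sum k\<bar> * (1 / u ^ (s - 1))"
      unfolding abs_mult by (rule mult_left_mono) simp
    have "\<bar>\<Sum>l\<in>?E. c l / u ^ l\<bar> \<le> (\<Sum>l\<in>?E. \<bar>c l / u ^ l\<bar>)" by (rule sum_abs)
    also have "\<dots> \<le> (\<Sum>l\<in>?E. \<bar>c l\<bar> * (1 / u ^ (s - 1)))"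
    proof (rule sum_mono)
      fix l assume "l \<in> ?E"
      then have "\<bar>c l\<bar> * (1 / u ^ l) \<le> \<bar>c l\<bar> * (1 / u ^ (s - 1))" by (intro mult_left_mono pl) auto
      then show "\<bar>c l / u ^ l\<bar> \<le> \<bar>c l\<bar> * (1 / u ^ (s - 1))" using u by (simp add: abs_divide)
    qed
    finally have t3: "\<bar>\<Sum>l\<in>?E. c l / u ^ l\<bar> \<le> (\<Sum>l\<in>?E. \<bar>c l\<bar>) * (1 / u ^ (s - 1))"
      by (simp only: sum_distrib_right)
    have t4: "\<bar>L\<bar> \<le> \<bar>L\<bar> * (1 / u ^ (s - 1))" using mult_left_mono[OF p1, of "\<bar>L\<bar>"] by simp
    have "\<bar>re_exponent k u + jump_sum k * ln u - (\<Sum>l\<in>?E. c l / u ^ l) - L\<bar>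
        \<le> (B + \<bar>jump_sum k\<bar> + (\<Sum>l\<in>?E. \<bar>c l\<bar>) + \<bar>L\<bar>) * (1 / u ^ (s - 1))"
      using t1 t2 t3 t4 unfolding distrib_right by linarith
    also have "\<dots> \<le> C' * (1 / u ^ (s - 1))" using u by (intro mult_right_mono) (auto simp: C'_def)
    finally show ?thesis by simp
  qed
  have C'0: "0 \<le> C'" using pos[of 1] by (auto intro: order_trans[OF abs_ge_zero])
  show ?thesis
  proof (rule exI[of _ c], rule exI[of _ L], rule exI[of _ C'], intro conjI allI impI C'0)
    fix u :: real assume "u \<noteq> 0"
    have "(\<Sum>l\<in>?E. c l / u ^ l) = (\<Sum>l\<in>?E. c l / \<bar>u\<bar> ^ l)"
      by (intro sum.cong) (auto simp: power_even_abs)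
    moreover have "re_exponent k u = re_exponent k \<bar>u\<bar>"
      by (cases "0 \<le> u") (auto simp: re_exponent_even[symmetric, of _ u] re_exponent_even[OF ke])
    ultimately show "\<bar>re_exponent k u + jump_sum k * ln \<bar>u\<bar> - (\<Sum>l\<in>?E. c l / u ^ l) - L\<bar> \<le> C' / \<bar>u\<bar> ^ (s - 1)"
      using pos[of "\<bar>u\<bar>"] \<open>u \<noteq> 0\<close> by simp
  qed
qed

section \<open>Weighted integrals and the bias\<close>

lemma weight_times_integrable:
  fixes w :: "real \<Rightarrow> real \<Rightarrow> real" and F :: "real \<Rightarrow> real"
  assumes U: "0 < U" and Cw: "0 \<le> Cw" "\<And>u. \<bar>w U u\<bar> \<le> Cw * (\<bar>u\<bar> ^ (s - 1) / U ^ s)"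
    and [measurable]: "w U \<in> borel_measurable borel" "F \<in> borel_measurable borel"
    and K: "\<And>u. u \<in> {-U..U} \<Longrightarrow> u \<noteq> 0 \<Longrightarrow> \<bar>F u\<bar> * \<bar>u\<bar> ^ (s - 1) \<le> K"
    and s: "2 \<le> s"
  shows "set_integrable lborel {-U..U} (\<lambda>u. F u * w U u)"
    and "\<bar>LINT u:{-U..U}|lborel. F u * w U u\<bar> \<le> 2 * K * Cw / U ^ (s - 1)"
proof -
  \<comment> \<open>The bound on \<open>F\<close> excludes u = 0; there the weight vanishes, because
    its bound contains |u|^(s-1) with s \<ge> 2.\<close>
  have w0: "w U 0 = 0" using Cw(2)[of 0] s by (simp add: power_0_left)
  have b: "\<bar>F u * w U u\<bar> \<le> K * Cw / U ^ s" if "u \<in> {-U..U}" for u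
  proof (cases "u = 0")
    case False
    have "\<bar>F u * w U u\<bar> \<le> \<bar>F u\<bar> * (Cw * (\<bar>u\<bar> ^ (s - 1) / U ^ s))"
      unfolding abs_mult by (intro mult_left_mono Cw) simp
    also have "\<dots> = (\<bar>F u\<bar> * \<bar>u\<bar> ^ (s - 1)) * (Cw / U ^ s)" by simp
    also have "\<dots> \<le> K * (Cw / U ^ s)" using K[OF that False] Cw U by (intro mult_right_mono) auto
    finally show ?thesis by simp
  next
    case True
    have "0 \<le> K" using K[of U] U by (auto intro: order_trans[rotated])
    then show ?thesis using True w0 Cw U by simp
  qed
  have c: "set_integrable lborel {-U..U} (\<lambda>u. K * Cw / U ^ s)"
    unfolding set_integrable_def by (intro integrable_scaleR_left integrable_real_indicator) (auto simp: emeasure_lborel_Icc_eq)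
  show i: "set_integrable lborel {-U..U} (\<lambda>u. F u * w U u)"
    unfolding set_integrable_def
  proof (rule Bochner_Integration.integrable_bound[OF c[unfolded set_integrable_def]])
    have "norm (indicator {-U..U} u *\<^sub>R (F u * w U u)) \<le> norm (indicator {-U..U} u *\<^sub>R (K * Cw / U ^ s))" for u
    proof (cases "u \<in> {-U..U}")
      case True
      from order_trans[OF b[OF True] abs_ge_self] show ?thesis using True by simp
    qed simp
    then show "AE u in lborel. norm (indicator {-U..U} u *\<^sub>R (F u * w U u)) \<le> norm (indicator {-U..U} u *\<^sub>R (K * Cw / U ^ s))"
      by (intro AE_I2)
  qed measurable
  have "\<bar>LINT u:{-U..U}|lborel. F u * w U u\<bar> \<le> (LINT u:{-U..U}|lborel. \<bar>F u * w U u\<bar>)"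
    using set_integral_norm_bound[OF i] by simp
  also have "\<dots> \<le> (LINT u:{-U..U}|lborel. K * Cw / U ^ s)"
    using set_integrable_abs[OF i] c b by (intro set_integral_mono) auto
  also have "\<dots> = 2 * U * (K * Cw / U ^ s)"
    using U by (simp add: set_lebesgue_integral_def)
  also have "\<dots> = 2 * K * Cw / U ^ (s - 1)"
    using U s by (cases s) auto
  finally show "\<bar>LINT u:{-U..U}|lborel. F u * w U u\<bar> \<le> 2 * K * Cw / U ^ (s - 1)" .
qed

text \<open>One \<open>B\<close> serves all cut-offs, because neither the constant of the expansion
  nor the constant in the weight bound depends on U.\<close>

lemma weight_bias:
  fixes w :: "real \<Rightarrow> real \<Rightarrow> real" and k :: "real \<Rightarrow> real"
  assumes k: "(\<gamma>, k) \<in> class_Gs s T R \<alpha>bar" and s: "2 \<le> s" and w: "weight_family s w"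
  obtains B where "0 \<le> B"
    "\<And>U. 1 \<le> U \<Longrightarrow> \<bar>(LINT u:{-U..U}|lborel. re_exponent k u * w U u) - jump_sum k\<bar> \<le> B / U ^ (s - 1)"
proof -
  obtain c L C where C: "0 \<le> C" "\<And>u. u \<noteq> 0 \<Longrightarrow> \<bar>re_exponent k u + jump_sum k * ln \<bar>u\<bar> - (\<Sum>l | l \<in> {1..s - 2} \<and> even l. c l / u ^ l) - L\<bar> \<le> C / \<bar>u\<bar> ^ (s - 1)"
    using re_exponent_expansion[OF k s] by auto
  let ?E = "{l. l \<in> {1..s - 2} \<and> even l}"
  obtain Cw where Cw0: "\<And>U u. 0 < U \<Longrightarrow> \<bar>w U u\<bar> \<le> Cw * (\<bar>u\<bar> ^ (s - 1) / U ^ s)"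
    using w unfolding weight_family_def by blast
  have Cw: "0 \<le> Cw" using Cw0[of 1 1] by (auto intro: order_trans[OF abs_ge_zero])
  note ke = class_Gs_levy_integrable(3)[OF k]
  define D where "D u = re_exponent k u + jump_sum k * ln \<bar>u\<bar> - (\<Sum>l\<in>?E. c l / u ^ l) - L" for u
  have Rm [measurable]: "re_exponent k \<in> borel_measurable borel"
    by (intro borel_measurable_continuous_onI continuous_at_imp_continuous_on ballI DERIV_isCont[OF re_exponent_deriv[OF ke]])
  have Dm [measurable]: "D \<in> borel_measurable borel" unfolding D_def by measurable
  have main: "\<bar>(LINT u:{-U..U}|lborel. re_exponent k u * w U u) - jump_sum k\<bar> \<le> (2 * C * Cw) / U ^ (s - 1)"
    if U1: "1 \<le> U" for U
  proof -
    have U: "0 < U" using U1 by simp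
    have wm: "w U \<in> borel_measurable borel" and wln: "(LINT u:{-U..U}|lborel. ln \<bar>u\<bar> * w U u) = -1"
      and wev: "\<And>j. j \<in> ?E \<Longrightarrow> (LINT u:{-U..U}|lborel. w U u / u ^ j) = 0"
      and wp: "(LINT u:{0..U}|lborel. w U u) = 0" and wn: "(LINT u:{0..U}|lborel. w U (- u)) = 0"
      using w U unfolding weight_family_def by auto
    note wti = weight_times_integrable[where w = w and U = U and Cw = Cw and s = s, OF U Cw Cw0[OF U] wm _ _ s]
    have up: "\<bar>u\<bar> ^ j \<le> U ^ j" if "u \<in> {-U..U}" for u j using that by (intro power_mono) auto
    have iD: "set_integrable lborel {-U..U} (\<lambda>u. D u * w U u)" and bD: "\<bar>LINT u:{-U..U}|lborel. D u * w U u\<bar> \<le> 2 * C * Cw / U ^ (s - 1)"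
    proof -
      have "\<bar>D u\<bar> * \<bar>u\<bar> ^ (s - 1) \<le> C" if "u \<in> {-U..U}" "u \<noteq> 0" for u
      proof -
        have "\<bar>D u\<bar> * \<bar>u\<bar> ^ (s - 1) \<le> C / \<bar>u\<bar> ^ (s - 1) * \<bar>u\<bar> ^ (s - 1)"
          unfolding D_def by (intro mult_right_mono C that) auto
        then show ?thesis using that by simp
      qed
      from wti[OF Dm this] show "set_integrable lborel {-U..U} (\<lambda>u. D u * w U u)" "\<bar>LINT u:{-U..U}|lborel. D u * w U u\<bar> \<le> 2 * C * Cw / U ^ (s - 1)" by blast+
    qed
    have i1: "set_integrable lborel {-U..U} (\<lambda>u. 1 * w U u)"
      by (rule wti(1)[where K = "U ^ (s - 1)"]) (use up in auto)
    have il: "set_integrable lborel {-U..U} (\<lambda>u. 1 / u ^ l * w U u)" if "l \<in> ?E" for l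
    proof (rule wti(1)[where K = "U ^ (s - 1 - l)"])
      fix u assume u: "u \<in> {-U..U}" "u \<noteq> 0"
      have "l + (s - 1 - l) = s - 1" using that by auto
      then have "\<bar>u\<bar> ^ (s - 1) = \<bar>u\<bar> ^ l * \<bar>u\<bar> ^ (s - 1 - l)" by (metis power_add)
      then have "\<bar>1 / u ^ l\<bar> * \<bar>u\<bar> ^ (s - 1) = \<bar>u\<bar> ^ (s - 1 - l)" using u by (simp add: power_abs)
      then show "\<bar>1 / u ^ l\<bar> * \<bar>u\<bar> ^ (s - 1) \<le> U ^ (s - 1 - l)" using up[OF u(1)] by simp
    qed measurable
    have iln: "set_integrable lborel {-U..U} (\<lambda>u. ln \<bar>u\<bar> * w U u)"
    proof (rule wti(1)[where K = "1 + U * U ^ (s - 1)"])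
      fix u assume u: "u \<in> {-U..U}" "u \<noteq> 0"
      show "\<bar>ln \<bar>u\<bar>\<bar> * \<bar>u\<bar> ^ (s - 1) \<le> 1 + U * U ^ (s - 1)"
      proof (cases "\<bar>u\<bar> \<le> 1")
        case True
        have "\<bar>ln \<bar>u\<bar>\<bar> * \<bar>u\<bar> ^ (s - 1) \<le> (1 / \<bar>u\<bar>) * \<bar>u\<bar> ^ 1"
          using u s True by (intro mult_mono abs_ln_le_inverse power_decreasing) auto
        also have "\<dots> = 1" using u by simp
        finally show ?thesis using U by (smt (verit) mult_nonneg_nonneg zero_le_power)
      next
        case False
        then have "\<bar>ln \<bar>u\<bar>\<bar> \<le> \<bar>u\<bar>" using ln_bound[of "\<bar>u\<bar>"] by simp
        also have "\<dots> \<le> U" using u by auto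
        finally have "\<bar>ln \<bar>u\<bar>\<bar> * \<bar>u\<bar> ^ (s - 1) \<le> U * U ^ (s - 1)" using U up[OF u(1)] by (intro mult_mono) auto
        then show ?thesis by simp
      qed
    qed measurable
    \<comment> \<open>The mean over [-U, U] vanishes because both half-line means do; this removes
      the constant \<open>L\<close>, as the even moments remove the \<open>c l\<close>.\<close>
    have w0: "(LINT u:{-U..U}|lborel. w U u) = 0"
    proof -
      have ii: "set_integrable lborel {-U..U} (w U)" using i1 by simp
      have ip: "set_integrable lborel {0..U} (w U)" and im: "set_integrable lborel {-U..0} (w U)"
        using U by (auto intro: set_integrable_subset[OF ii])
      have "(LINT u:{-U..U}|lborel. w U u) = (LINT u|lborel. indicator {0..U} u *\<^sub>R w U u + indicator {-U..0} u *\<^sub>R w U u)"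
        unfolding set_lebesgue_integral_def
      proof (rule integral_cong_AE)
        show "AE u in lborel. indicator {-U..U} u *\<^sub>R w U u = indicator {0..U} u *\<^sub>R w U u + indicator {-U..0} u *\<^sub>R w U u"
          using AE_lborel_singleton[of "0::real"] by eventually_elim (use U in \<open>auto simp: indicator_def\<close>)
      qed (use wm in auto)
      also have "\<dots> = (LINT u:{0..U}|lborel. w U u) + (LINT u:{-U..0}|lborel. w U u)"
        using ip im by (simp add: set_lebesgue_integral_def set_integrable_def)
      also have "(LINT u:{-U..0}|lborel. w U u) = (LINT u:{0..U}|lborel. w U (- u))"
      proof -
        have "(indicator {-U..0} (- u) :: real) = indicator {0..U} u" for u by (auto simp: indicator_def)
        then show ?thesis
          unfolding set_lebesgue_integral_def
          using lborel_integral_real_affine[of "-1" "\<lambda>x. indicator {-U..0} x *\<^sub>R w U x" 0] by simp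
      qed
      finally show ?thesis using wp wn by simp
    qed
    have "(LINT u:{-U..U}|lborel. re_exponent k u * w U u)
        = (LINT u:{-U..U}|lborel. D u * w U u - jump_sum k * (ln \<bar>u\<bar> * w U u) + (\<Sum>l\<in>?E. c l * (1 / u ^ l * w U u)) + L * (1 * w U u))"
      by (rule set_lebesgue_integral_cong) (auto simp: D_def algebra_simps sum_distrib_left)
    also have "\<dots> = (LINT u:{-U..U}|lborel. D u * w U u) - jump_sum k * (LINT u:{-U..U}|lborel. ln \<bar>u\<bar> * w U u)
        + (\<Sum>l\<in>?E. c l * (LINT u:{-U..U}|lborel. 1 / u ^ l * w U u)) + L * (LINT u:{-U..U}|lborel. 1 * w U u)"
    proof -
      have hb: "has_bochner_integral lborel (\<lambda>u. indicator {-U..U} u *\<^sub>R (D u * w U u) - jump_sum k * (indicator {-U..U} u *\<^sub>R (ln \<bar>u\<bar> * w U u))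
          + (\<Sum>l\<in>?E. c l * (indicator {-U..U} u *\<^sub>R (1 / u ^ l * w U u))) + L * (indicator {-U..U} u *\<^sub>R (1 * w U u)))
        ((LINT u:{-U..U}|lborel. D u * w U u) - jump_sum k * (LINT u:{-U..U}|lborel. ln \<bar>u\<bar> * w U u)
        + (\<Sum>l\<in>?E. c l * (LINT u:{-U..U}|lborel. 1 / u ^ l * w U u)) + L * (LINT u:{-U..U}|lborel. 1 * w U u))"
        using iD iln il i1 unfolding set_integrable_def set_lebesgue_integral_def
        by (intro has_bochner_integral_add has_bochner_integral_diff has_bochner_integral_mult_right
            has_bochner_integral_sum has_bochner_integral_integrable) auto
      have eq: "indicator {-U..U} u *\<^sub>R (D u * w U u - jump_sum k * (ln \<bar>u\<bar> * w U u) + (\<Sum>l\<in>?E. c l * (1 / u ^ l * w U u)) + L * (1 * w U u))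
          = indicator {-U..U} u *\<^sub>R (D u * w U u) - jump_sum k * (indicator {-U..U} u *\<^sub>R (ln \<bar>u\<bar> * w U u))
          + (\<Sum>l\<in>?E. c l * (indicator {-U..U} u *\<^sub>R (1 / u ^ l * w U u))) + L * (indicator {-U..U} u *\<^sub>R (1 * w U u))" for u
        by (cases "u \<in> {-U..U}") simp_all
      show ?thesis
        by (subst set_lebesgue_integral_def) (simp only: eq has_bochner_integral_integral_eq[OF hb])
    qed
    also have "\<dots> = (LINT u:{-U..U}|lborel. D u * w U u) + jump_sum k"
      using wln wev w0 by simp
    finally show ?thesis using bD by simp
  qed
  show thesis by (rule that[OF _ main]) (use C Cw in auto)
qed

section \<open>The shifted characteristic function\<close>

text \<open>\<open>levy_law\<close> is a definite description: the process supplies existence, and a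
  law is determined by its characteristic function.\<close>

lemma levy_law_eq_distr:
  assumes "levy_process Q X \<gamma> k" "0 \<le> t"
  shows "levy_law t \<gamma> k = distr Q borel (X t)"
proof -
  interpret prob_space Q using assms by (simp add: levy_process_def)
  have X: "X t \<in> borel_measurable Q" and
    ch: "\<And>u. char (distr Q borel (X t)) u = exp (of_real t * levy_exponent \<gamma> k u)"
    using assms by (auto simp: levy_process_def)
  have rd: "real_distribution (distr Q borel (X t))"
    using X by (rule real_distribution_distr)
  show ?thesis
    unfolding levy_law_def
  proof (rule the_equality)
    fix \<mu> assume "real_distribution \<mu> \<and> (\<forall>u. char \<mu> u = exp (of_real t * levy_exponent \<gamma> k u))"
    then show "\<mu> = distr Q borel (X t)" using rd ch by (intro Levy_uniqueness) auto
  qed (use rd ch in auto)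
qed

context
  fixes Q :: "'b measure" and X :: "real \<Rightarrow> 'b \<Rightarrow> real" and k :: "real \<Rightarrow> real" and \<gamma> T R \<alpha>bar :: real and s :: nat
  assumes k: "(\<gamma>, k) \<in> class_Gs s T R \<alpha>bar" and X: "levy_process Q X \<gamma> k" and T: "0 < T"
begin

lemma levy_square_exp_integrable: "integrable Q (\<lambda>\<omega>. exp (2 * X T \<omega>))"
proof -
  have [measurable]: "X T \<in> borel_measurable Q" using X T by (simp add: levy_process_def)
  have "(\<integral>\<^sup>+x. ennreal (exp (2 * x)) \<partial>levy_law T \<gamma> k) \<le> ennreal R"
    using k unfolding class_Gs_def class_G0_def by blast
  then have "(\<integral>\<^sup>+\<omega>. ennreal (exp (2 * X T \<omega>)) \<partial>Q) \<le> ennreal R"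
    using levy_law_eq_distr[OF X, of T] T by (simp add: nn_integral_distr)
  then show ?thesis by (intro integrableI_bounded) (auto intro: le_less_trans)
qed

lemma levy_cf_shifted:
  "levy_cf T \<gamma> k (of_real u - \<i>) = (LINT \<omega>|Q. exp ((1 + \<i> * of_real u) * of_real (X T \<omega>)))"
proof -
  have [measurable]: "X T \<in> borel_measurable Q" using X T by (simp add: levy_process_def)
  have "\<i> * (of_real u - \<i>) = 1 + \<i> * of_real u" by (simp add: algebra_simps)
  then show ?thesis
    using levy_law_eq_distr[OF X, of T] T by (simp add: levy_cf_def integral_distr)
qed

lemma levy_cf_shifted_exp:
  "levy_cf T \<gamma> k (of_real u - \<i>) = exp (of_real T * (of_real \<gamma> * (1 + \<i> * of_real u)
    + (LINT x|lborel. (exp ((1 + \<i> * of_real u) * of_real x) - 1) * of_real (k x / \<bar>x\<bar>))))"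
proof -
  interpret prob_space Q using X by (simp add: levy_process_def)
  have [measurable]: "X T \<in> borel_measurable Q" using X T by (simp add: levy_process_def)
  note kc = class_Gs_levy_integrable[OF k]
  have "(LINT x|distr Q borel (X T). exp ((1 + \<i> * of_real u) * of_real x))
    = exp (of_real T * (of_real \<gamma> * (1 + \<i> * of_real u)
    + (LINT x|lborel. (exp ((1 + \<i> * of_real u) * of_real x) - 1) * of_real (k x / \<bar>x\<bar>))))"
  proof (rule levy_exponential_moment[OF _ _ _ kc(1,2)])
    show "real_distribution (distr Q borel (X T))" by (intro real_distribution_distr) measurable
    show "integrable (distr Q borel (X T)) (\<lambda>x. exp (2 * x))"
      using levy_square_exp_integrable by (simp add: integrable_distr_eq)
    show "char (distr Q borel (X T)) u = exp (of_real T * levy_exponent \<gamma> k u)" for u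
      using X T by (simp add: levy_process_def)
  qed simp
  then show ?thesis unfolding levy_cf_shifted by (simp add: integral_distr)
qed

lemma martingale_eq: "\<gamma> = - (LINT x|lborel. (exp x - 1) * (k x / \<bar>x\<bar>))"
  and martingale_integrable: "integrable lborel (\<lambda>x. (exp x - 1) * (k x / \<bar>x\<bar>))"
  using k by (auto simp: class_Gs_def class_G0_def martingale_condition_def)

text \<open>At u = 0 the exponential moment formula gives exp of T times \<gamma> plus the jump
  integral, and the martingale condition makes this exponent 0.\<close>

lemma levy_martingale: "(LINT \<omega>|Q. exp (X T \<omega>)) = 1"
proof -
  have "complex_of_real (LINT \<omega>|Q. exp (X T \<omega>)) = levy_cf T \<gamma> k (of_real 0 - \<i>)"
    unfolding levy_cf_shifted by (simp add: exp_of_real)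
  also have "\<dots> = exp (of_real T * (of_real \<gamma> + (LINT x|lborel. (exp (of_real x) - 1) * of_real (k x / \<bar>x\<bar>))))"
    unfolding levy_cf_shifted_exp by simp
  also have "(LINT x|lborel. (exp (of_real x) - 1) * complex_of_real (k x / \<bar>x\<bar>)) = of_real (LINT x|lborel. (exp x - 1) * (k x / \<bar>x\<bar>))"
    unfolding integral_complex_of_real[symmetric] by (intro Bochner_Integration.integral_cong) (simp_all add: exp_of_real)
  also have "\<dots> = of_real (- \<gamma>)" using martingale_eq by simp
  finally have "complex_of_real (LINT \<omega>|Q. exp (X T \<omega>)) = of_real 1" by simp
  then show ?thesis by (simp only: of_real_eq_iff)
qed

text \<open>The martingale condition replaces the drift by the integral of -(exp x - 1), and (exp x
  cos(ux) - 1) - (exp x - 1) = exp x (cos(ux) - 1).\<close>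

lemma cmod_levy_cf_shifted: "cmod (levy_cf T \<gamma> k (of_real u - \<i>)) = exp (T * re_exponent k u)"
proof -
  note kc = class_Gs_levy_integrable[OF k]
  let ?f = "\<lambda>x. (exp ((1 + \<i> * of_real u) * of_real x) - 1) * complex_of_real (k x / \<bar>x\<bar>)"
  have fi: "integrable lborel ?f" by (rule exp_jump_integrable[OF kc(2,1)]) auto
  have Re_f: "Re (?f x) = (exp x * cos (u * x) - 1) * (k x / \<bar>x\<bar>)" for x
    by (simp add: Re_exp)
  have Re_int: "Re (LINT x|lborel. ?f x) = (LINT x|lborel. (exp x * cos (u * x) - 1) * (k x / \<bar>x\<bar>))"
    unfolding integral_Re[OF fi, symmetric] Re_f ..
  have ri: "integrable lborel (\<lambda>x. (exp x * cos (u * x) - 1) * (k x / \<bar>x\<bar>))"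
    using integrable_Re[OF fi] unfolding Re_f .
  have "re_exponent k u = (LINT x|lborel. (exp x * cos (u * x) - 1) * (k x / \<bar>x\<bar>) - (exp x - 1) * (k x / \<bar>x\<bar>))"
    unfolding re_exponent_def
    by (intro Bochner_Integration.integral_cong refl) (simp add: diff_divide_distrib[symmetric] algebra_simps)
  also have "\<dots> = (LINT x|lborel. (exp x * cos (u * x) - 1) * (k x / \<bar>x\<bar>)) + \<gamma>"
    using ri martingale_integrable martingale_eq by simp
  finally have "re_exponent k u = Re (of_real \<gamma> * (1 + \<i> * of_real u) + (LINT x|lborel. ?f x))"
    using Re_int by simp
  then show ?thesis unfolding levy_cf_shifted_exp norm_exp_eq_Re by simp
qed

lemma cmod_levy_cf_le_one: "cmod (levy_cf T \<gamma> k (of_real u - \<i>)) \<le> 1"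
proof -
  have kn: "0 \<le> k x" for x using k by (simp add: class_Gs_def class_G0_def)
  have "(LINT x|lborel. (cos (u * x) - 1) * (exp x * k x / \<bar>x\<bar>)) \<le> (LINT x|(lborel :: real measure). 0 :: real)"
    using re_exponent_integrable[OF class_Gs_levy_integrable(3)[OF k]] kn
    by (intro integral_mono) (auto intro!: mult_nonpos_nonneg)
  then have "re_exponent k u \<le> 0" by (simp add: re_exponent_def)
  then show ?thesis unfolding cmod_levy_cf_shifted using T by (simp add: mult_nonneg_nonpos)
qed

text \<open>The class bounds the L1 norm of exp x k x by R. The resulting inequality |\<phi>(u)|
  \<ge> exp(-T R) for |u| \<le> 1 is the origin of the trimming level exp(-T R) / 3 near 0.\<close>

lemma re_exponent_lower_bound: 
  assumes R: "0 < R" and u: "\<bar>u\<bar> \<le> 1"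
  shows "- R \<le> re_exponent k u"
proof -
  note ke = class_Gs_levy_integrable(3)[OF k]
  have "L1_norm (\<lambda>x. sgn x * exp x * k x) \<le> ennreal R"
    using k unfolding class_Gs_def class_G0_def by blast
  moreover have "L1_norm (\<lambda>x. sgn x * exp x * k x) = (\<integral>\<^sup>+x. ennreal \<bar>exp x * k x\<bar> \<partial>lborel)"
    unfolding L1_norm_def
  proof (rule nn_integral_cong_AE)
    show "AE x in lborel. ennreal \<bar>sgn x * exp x * k x\<bar> = ennreal \<bar>exp x * k x\<bar>"
      using AE_lborel_singleton[of "0::real"] by eventually_elim (auto simp: abs_mult)
  qed
  moreover have "(\<integral>\<^sup>+x. ennreal \<bar>exp x * k x\<bar> \<partial>lborel) = ennreal (LINT x|lborel. \<bar>exp x * k x\<bar>)"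
    using ke by (intro nn_integral_eq_integral) auto
  ultimately have "(LINT x|lborel. \<bar>exp x * k x\<bar>) \<le> R" using R by simp
  moreover have "\<bar>re_exponent k u\<bar> \<le> \<bar>u\<bar> * (LINT x|lborel. \<bar>exp x * k x\<bar>)" by (rule abs_re_exponent_le[OF ke])
  moreover have "\<bar>u\<bar> * (LINT x|lborel. \<bar>exp x * k x\<bar>) \<le> 1 * (LINT x|lborel. \<bar>exp x * k x\<bar>)"
    using u by (intro mult_right_mono) auto
  ultimately show ?thesis by linarith
qed

text \<open>Being at most |\<phi>| / 3, the trimming level is inactive as soon as the relative error
  is at most 1/2; being at least c0 / 3 times U^(-T \<alpha>bar), it keeps the logarithm of order ln
  U. Together the two bounds give |\<phi>| \<ge> c0 U^(-T \<alpha>bar) on [-U, U].\<close>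

lemma trim_bounds:
  assumes R: "0 < R" and a: "0 < \<alpha>bar" and tc: "trim_constant T R \<alpha>bar C\<^sub>\<phi>" and U: "1 \<le> U" and u: "u \<in> {-U..U}"
  defines "c0 \<equiv> min (exp (- T * R)) C\<^sub>\<phi>"
  shows "0 < trim T R \<alpha>bar C\<^sub>\<phi> u"
    and "c0 / 3 * U powr (- T * \<alpha>bar) \<le> trim T R \<alpha>bar C\<^sub>\<phi> u"
    and "trim T R \<alpha>bar C\<^sub>\<phi> u \<le> cmod (levy_cf T \<gamma> k (of_real u - \<i>)) / 3"
proof -
  have C: "0 < C\<^sub>\<phi>" using tc by (simp add: trim_constant_def)
  have c0: "0 < c0" "c0 \<le> exp (- T * R)" "c0 \<le> C\<^sub>\<phi>" using C by (auto simp: c0_def)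
  have Ta: "- T * \<alpha>bar \<le> 0" using T a by simp
  have U1: "U powr (- T * \<alpha>bar) \<le> 1" using powr_mono[OF Ta U] U by simp
  show "0 < trim T R \<alpha>bar C\<^sub>\<phi> u" using C by (auto simp: trim_def intro!: divide_pos_pos mult_pos_pos)
  show "c0 / 3 * U powr (- T * \<alpha>bar) \<le> trim T R \<alpha>bar C\<^sub>\<phi> u"
  proof (cases "\<bar>u\<bar> < 1")
    case True
    have "c0 / 3 * U powr (- T * \<alpha>bar) \<le> exp (- T * R) / 3 * 1" using c0 U1 by (intro mult_mono) auto
    then show ?thesis using True by (simp add: trim_def)
  next
    case False
    have "U powr (- T * \<alpha>bar) \<le> \<bar>u\<bar> powr (- T * \<alpha>bar)" using False u Ta by (intro powr_mono2') auto
    then have "c0 / 3 * U powr (- T * \<alpha>bar) \<le> C\<^sub>\<phi> / 3 * \<bar>u\<bar> powr (- T * \<alpha>bar)" using c0 C by (intro mult_mono) auto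
    then show ?thesis using False by (simp add: trim_def)
  qed
  show "trim T R \<alpha>bar C\<^sub>\<phi> u \<le> cmod (levy_cf T \<gamma> k (of_real u - \<i>)) / 3"
  proof (cases "\<bar>u\<bar> < 1")
    case True
    have "T * (- R) \<le> T * re_exponent k u" using re_exponent_lower_bound[OF R, of u] True T by (intro mult_left_mono) auto
    then show ?thesis using True unfolding cmod_levy_cf_shifted by (simp add: trim_def)
  next
    case False
    have "(\<gamma>, k) \<in> class_G0 T R \<alpha>bar" using k by (simp add: class_Gs_def)
    then have "C\<^sub>\<phi> * \<bar>u\<bar> powr (- T * \<alpha>bar) \<le> cmod (levy_cf T \<gamma> k (of_real u - \<i>))"
      using tc False unfolding trim_constant_def by fastforce
    then show ?thesis using False by (simp add: trim_def)
  qed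
qed

end

text \<open>The condition t \<le> 1/2 keeps 1 - t away from 0, so that -ln(1 - t) \<le> t / (1 - t)
  \<le> 2 t.\<close>

lemma abs_ln_ratio_le:
  fixes a b t :: real
  assumes "0 < b" "\<bar>a - b\<bar> \<le> t * b" "t \<le> 1 / 2"
  shows "\<bar>ln a - ln b\<bar> \<le> 2 * t"
proof -
  have t0: "0 \<le> t" using assms by (metis abs_ge_zero mult_nonneg_nonneg mult_pos_pos not_le order_trans mult.commute zero_le_mult_iff)
  have up: "a \<le> (1 + t) * b" and lo: "(1 - t) * b \<le> a" using assms(2) by (auto simp: abs_le_iff algebra_simps)
  have a0: "0 < a" using lo assms mult_pos_pos[of "1 - t" b] by linarith
  have "ln a \<le> ln ((1 + t) * b)" using up a0 by simp
  also have "\<dots> = ln (1 + t) + ln b" using t0 assms by (simp add: ln_mult)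
  also have "ln (1 + t) \<le> t" using t0 by (rule ln_add_one_self_le_self)
  finally have 1: "ln a \<le> t + ln b" by simp
  have "ln (1 / (1 - t)) \<le> 1 / (1 - t) - 1" using assms by (intro ln_le_minus_one) auto
  also have "\<dots> = t / (1 - t)" using assms by (simp add: field_simps)
  also have "\<dots> \<le> t / (1 / 2)" using assms t0 by (intro divide_left_mono) auto
  finally have "- (2 * t) \<le> ln (1 - t)" using assms by (simp add: ln_div)
  moreover have "ln (1 - t) + ln b \<le> ln a"
  proof -
    have "ln ((1 - t) * b) \<le> ln a" using lo a0 assms by (intro ln_mono) auto
    then show ?thesis using assms by (simp add: ln_mult)
  qed
  ultimately show ?thesis using 1 t0 by (simp add: abs_le_iff)
qed

lemma Re_psi_est:
  assumes "\<not> (\<exists>v\<in>{-U..U}. emp_cf f v = 0)"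
  shows "Re (psi_est T R \<alpha>bar C\<^sub>\<phi> U f u) = 1 / T * ln (cmod (trunc (trim T R \<alpha>bar C\<^sub>\<phi> u) (emp_cf f u)))"
  using assms by (simp add: psi_est_def)

lemma cmod_trunc:
  assumes "0 < \<eta>" "z \<noteq> 0"
  shows "cmod (trunc \<eta> z) = max \<eta> (cmod z)"
  using assms by (auto simp: trunc_def norm_mult norm_divide)

lemma borel_measurable_fourier [measurable]:
  assumes [measurable]: "f \<in> borel_measurable borel"
  shows "fourier f \<in> borel_measurable borel"
  unfolding fourier_def[abs_def] by measurable

section \<open>Combination of the tail bounds\<close>

text \<open>
  A probability \<open>P\<close> satisfies \<open>P \<le> sqrt P\<close>, which turns the polynomial factor \<open>N\<^sup>2\<close> into the linear one;
  constant factors are absorbed by decreasing the rate \<open>c\<close>.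
\<close>

lemma tail_absorption:
  fixes K c4 c5 X0 C1 :: real
  assumes "0 < K" "0 < c4" "0 < c5" "0 < X0" "0 < C1"
  shows "\<exists>c>0. \<forall>P X U N. P \<le> 1 \<longrightarrow> 0 \<le> X \<longrightarrow> 1 \<le> U \<longrightarrow> 1 \<le> N \<longrightarrow>
    (X \<le> X0 \<or> P \<le> K * U * N ^ 2 * exp (- (c4 * X) - c5 * sqrt U)) \<longrightarrow>
    P \<le> ((7 * N + 1) * C1 + 2) * exp (- c * X)"
proof -
  \<comment> \<open>From y^2 / 2 \<le> exp y with y = c5 sqrt U: U exp(-c5 sqrt U) \<le> 2 /
    c5^2.\<close>
  define K7 where "K7 = 2 / c5\<^sup>2"
  \<comment> \<open>Ratio between the constant left after taking the square root and 7 C1, the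
    coefficient of N in the target.\<close>
  define K9 where "K9 = sqrt (K * K7) / (7 * C1)"
  define l where "l = max 1 (ln K9)"
  \<comment> \<open>The rate c4 / 4 remains after the square root and after spending half of the
    rest on \<open>K9\<close>; the other two entries ensure c X \<le> 1/2 when X is too small for
    that.\<close>
  define c where "c = min (c4 / 4) (min (c4 / (8 * l)) (1 / (2 * X0)))"
  have K7: "0 < K7" using assms by (simp add: K7_def)
  have K9: "0 < K9" using assms K7 by (simp add: K9_def)
  have l: "1 \<le> l" "ln K9 \<le> l" by (auto simp: l_def)
  have c: "0 < c" "c \<le> c4 / 4" "c \<le> c4 / (8 * l)" "c \<le> 1 / (2 * X0)"
    using assms l by (auto simp: c_def)
  \<comment> \<open>The summand 2 in the prefactor makes the target at least 1 whenever c X \<le>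
    1/2, so that P \<le> 1 suffices there.\<close>
  have half: "1 \<le> 2 * exp (- (1 / 2 :: real))"
    using exp_ge_add_one_self[of "- (1/2) :: real"] by simp
  have small: "1 \<le> ((7 * N + 1) * C1 + 2) * exp (- c * X)" if "c * X \<le> 1 / 2" "1 \<le> N" for X N
  proof -
    have "2 * exp (- (1 / 2)) \<le> ((7 * N + 1) * C1 + 2) * exp (- c * X)"
      using that assms by (intro mult_mono) auto
    then show ?thesis using half by linarith
  qed
  have main: "P \<le> ((7 * N + 1) * C1 + 2) * exp (- c * X)"
    if P: "P \<le> 1" and X: "0 \<le> X" and U: "1 \<le> U" and N: "1 \<le> N"
      and dich: "X \<le> X0 \<or> P \<le> K * U * N ^ 2 * exp (- (c4 * X) - c5 * sqrt U)" for P X U N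
    using dich
  proof
    assume "X \<le> X0"
    then have "c * X \<le> 1 / (2 * X0) * X0" using c X assms by (intro mult_mono) auto
    also have "\<dots> = 1 / 2" using assms by simp
    finally show ?thesis using small[OF _ N] P by force
  next
    assume PK: "P \<le> K * U * N ^ 2 * exp (- (c4 * X) - c5 * sqrt U)"
    have A0: "7 * C1 * N \<le> (7 * N + 1) * C1 + 2" using assms by (simp add: algebra_simps)
    have U_le: "U * exp (- (c5 * sqrt U)) \<le> K7"
    proof -
      have y: "0 \<le> c5 * sqrt U" using assms U by simp
      have "(c5 * sqrt U)\<^sup>2 / 2 \<le> exp (c5 * sqrt U)"
        using exp_lower_Taylor_quadratic[OF y] y by linarith
      then have "U * c5\<^sup>2 \<le> 2 * exp (c5 * sqrt U)" using U by (simp add: power_mult_distrib mult.commute)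
      then have "U \<le> K7 * exp (c5 * sqrt U)" using assms by (simp add: K7_def field_simps)
      then have "U * exp (- (c5 * sqrt U)) \<le> K7 * exp (c5 * sqrt U) * exp (- (c5 * sqrt U))" by (intro mult_right_mono) auto
      then show ?thesis by (simp add: exp_add[symmetric] mult.assoc)
    qed
    have "P \<le> K * (U * exp (- (c5 * sqrt U))) * N ^ 2 * exp (- (c4 * X))"
      using PK by (simp add: exp_diff exp_minus field_simps)
    also have "\<dots> \<le> K * K7 * N ^ 2 * exp (- (c4 * X))"
      using assms U_le by (intro mult_right_mono mult_left_mono) auto
    finally have P2: "P \<le> K * K7 * N ^ 2 * exp (- (c4 * X))" .
    have P3: "P \<le> K9 * ((7 * N + 1) * C1 + 2) * exp (- (c4 / 2 * X))"
    proof (cases "P \<le> 0")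
      case True
      have "0 \<le> K9 * ((7 * N + 1) * C1 + 2) * exp (- (c4 / 2 * X))" using K9 assms N by (intro mult_nonneg_nonneg) auto
      then show ?thesis using True by linarith
    next
      case False
      have "P * P \<le> P * 1" using P False by (intro mult_left_mono) auto
      then have "P\<^sup>2 \<le> K * K7 * N ^ 2 * exp (- (c4 * X))" using P2 by (simp add: power2_eq_square)
      then have "P \<le> sqrt (K * K7 * N ^ 2 * exp (- (c4 * X)))" by (rule real_le_rsqrt)
      also have "\<dots> = sqrt (K * K7) * N * exp (- (c4 / 2 * X))"
      proof -
        have "exp (- (c4 * X)) = (exp (- (c4 / 2 * X)))\<^sup>2" by (simp add: exp_double[symmetric])
        then show ?thesis using N by (simp add: real_sqrt_mult)
      qed
      also have "\<dots> = K9 * (7 * C1 * N) * exp (- (c4 / 2 * X))" using assms by (simp add: K9_def)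
      also have "\<dots> \<le> K9 * ((7 * N + 1) * C1 + 2) * exp (- (c4 / 2 * X))"
        using K9 A0 by (intro mult_right_mono mult_left_mono) auto
      finally show ?thesis .
    qed
    show ?thesis
    proof (cases "K9 * exp (- (c4 / 4 * X)) \<le> 1")
      case True
      have "P \<le> ((7 * N + 1) * C1 + 2) * (K9 * exp (- (c4 / 4 * X))) * exp (- (c4 / 4 * X))"
      proof -
        have "exp (- (c4 / 2 * X)) = exp (- (c4 / 4 * X)) * exp (- (c4 / 4 * X))"
          by (simp add: exp_add[symmetric])
        then show ?thesis using P3 by (simp add: mult_ac)
      qed
      also have "\<dots> \<le> ((7 * N + 1) * C1 + 2) * 1 * exp (- (c4 / 4 * X))"
        using True assms N by (intro mult_right_mono mult_left_mono) auto
      also have "\<dots> \<le> ((7 * N + 1) * C1 + 2) * exp (- c * X)"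
        using mult_right_mono[OF c(2) X] assms N by (intro mult_mono) auto
      finally show ?thesis .
    next
      case False
      then have "1 < K9 * exp (- (c4 / 4 * X))" by simp
      then have "0 < ln (K9 * exp (- (c4 / 4 * X)))" by simp
      then have "c4 / 4 * X < l" using K9 l by (simp add: ln_mult)
      then have "c4 * X \<le> 4 * l" by simp
      have "c * X \<le> c4 / (8 * l) * X" using c X by (intro mult_right_mono) auto
      also have "\<dots> = (c4 * X) / (8 * l)" by simp
      also have "\<dots> \<le> (4 * l) / (8 * l)" using \<open>c4 * X \<le> 4 * l\<close> l by (intro divide_right_mono) auto
      also have "\<dots> = 1 / 2" using l by simp
      finally show ?thesis using small[OF _ N] P by force
    qed
  qed
  show ?thesis using c(1) main by blast
qed

text \<open>
  Here \<open>\<tau>\<close> is a relative deviation of the empirical characteristic function. It is chosen as \<open>\<kappa> / (2 * K5)\<close>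
  for small \<open>\<kappa>\<close>, as \<open>exp (\<kappa> / (4 * C4)) - 1\<close> if \<open>\<kappa>\<close> is large compared to \<open>ln U\<close>, and as \<open>1 / 2\<close> in between.
\<close>

lemma combined_tail_bound:
  fixes K1 B K5 C4 c1 C1 K6 :: real and s :: nat
  assumes s: "2 \<le> s" and pos: "0 < K1" "0 \<le> B" "0 < K5" "0 < C4" "0 < c1" "0 < C1" "0 < K6"
  shows "\<exists>c>0. \<exists>b>0. \<forall>\<kappa> U N P. 0 < \<kappa> \<longrightarrow> 1 \<le> U \<longrightarrow> 1 \<le> N \<longrightarrow> P \<le> 1 \<longrightarrow> 1 / U ^ (s - 1) < b * \<kappa> \<longrightarrow>
    (\<forall>\<tau>. 0 < \<tau> \<longrightarrow> \<tau> \<le> 1 / 2 \<longrightarrow> K1 / U ^ (s - 1) \<le> \<tau> \<longrightarrow> B / U ^ (s - 1) + K5 * \<tau> < \<kappa> \<longrightarrow>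
       P \<le> K6 * U * N ^ 2 * exp (- (c1 * \<tau>\<^sup>2 * U ^ (2 * s - 3)))) \<longrightarrow>
    (\<forall>\<tau>. K1 \<le> \<tau> \<longrightarrow> C4 * (1 + ln U + ln (1 + \<tau>)) < \<kappa> \<longrightarrow>
       P \<le> K6 * U * N ^ 2 * exp (- (c1 * \<tau>\<^sup>2 * U ^ (2 * s - 3)))) \<longrightarrow>
    P \<le> ((7 * N + 1) * C1 + 2) * exp (- c * (min (\<kappa>\<^sup>2) (\<kappa> powr (1/2)) * U powr ((real s - 1) / 2)))"
proof -
  \<comment> \<open>With r = 1 / U^(s-1) < b \<kappa>, the two entries give K1 r \<le> \<kappa> / (2
    K5) and B r \<le> \<kappa> / 4. The denominator has B + 1 because B may be 0.\<close>
  define b where "b = min (1 / (2 * K5 * K1)) (1 / (4 * (B + 1)))"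
  define c2 where "c2 = min (c1 / (4 * K5\<^sup>2)) (c1 / (16 * C4\<^sup>2))"
  \<comment> \<open>If \<kappa> is below 2 C4 (1 + ln U) or below 4 C4 K1, then \<kappa> \<le> C9 (1
    + ln U).\<close>
  define C9 where "C9 = 2 * C4 + 4 * C4 * K1"
  \<comment> \<open>In the intermediate range of \<kappa>, the condition 1 / U^(s-1) \<le> q0 makes
    \<tau> = 1/2 admissible; if it fails, U is bounded and X \<le> X0.\<close>
  define q0 where "q0 = min (1 / (2 * K1)) (K5 / (2 * (B + 1)))"
  define X0 where "X0 = 1 + sqrt (C9 * (1 / q0)) * (1 / q0)"
  define c4 where "c4 = min (c2 / 2) (c1 / 8 / sqrt C9)"
  define c5 where "c5 = min (c2 / 2) (c1 / 8)"
  have C9: "0 < C9" using pos by (simp add: C9_def add_pos_pos)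
  have q0: "0 < q0" using pos by (auto simp: q0_def add_nonneg_pos)
  have b0: "0 < b" using pos by (auto simp: b_def add_nonneg_pos)
  have c2: "0 < c2" "c2 \<le> c1 / (4 * K5\<^sup>2)" "c2 \<le> c1 / (16 * C4\<^sup>2)" using pos by (auto simp: c2_def)
  have c4: "0 < c4" "c4 \<le> c2 / 2" "c4 \<le> c1 / 8 / sqrt C9" using pos c2 C9 by (auto simp: c4_def)
  have c5: "0 < c5" "c5 \<le> c2 / 2" "c5 \<le> c1 / 8" using pos c2 by (auto simp: c5_def)
  have X0: "0 < X0" "1 \<le> X0" "sqrt (C9 * (1 / q0)) * (1 / q0) \<le> X0"
  proof -
    have "0 \<le> sqrt (C9 * (1 / q0)) * (1 / q0)" using C9 q0 by simp
    then show "0 < X0" "1 \<le> X0" "sqrt (C9 * (1 / q0)) * (1 / q0) \<le> X0" by (auto simp: X0_def)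
  qed
  obtain c where c: "0 < c" and absorb: "\<And>P X U N. P \<le> 1 \<Longrightarrow> 0 \<le> X \<Longrightarrow> 1 \<le> U \<Longrightarrow> 1 \<le> N \<Longrightarrow>
    (X \<le> X0 \<or> P \<le> K6 * U * N ^ 2 * exp (- (c4 * X) - c5 * sqrt U)) \<Longrightarrow>
    P \<le> ((7 * N + 1) * C1 + 2) * exp (- c * X)"
    using tail_absorption[OF pos(7) c4(1) c5(1) X0(1) pos(6)] by blast
  have "P \<le> ((7 * N + 1) * C1 + 2) * exp (- c * (min (\<kappa>\<^sup>2) (\<kappa> powr (1/2)) * U powr ((real s - 1) / 2)))"
    if \<kappa>: "0 < \<kappa>" and U: "1 \<le> U" and N: "1 \<le> N" and P: "P \<le> 1" and q: "1 / U ^ (s - 1) < b * \<kappa>"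
      and f1: "\<And>\<tau>. 0 < \<tau> \<Longrightarrow> \<tau> \<le> 1 / 2 \<Longrightarrow> K1 / U ^ (s - 1) \<le> \<tau> \<Longrightarrow> B / U ^ (s - 1) + K5 * \<tau> < \<kappa> \<Longrightarrow>
       P \<le> K6 * U * N ^ 2 * exp (- (c1 * \<tau>\<^sup>2 * U ^ (2 * s - 3)))"
      and f2: "\<And>\<tau>. K1 \<le> \<tau> \<Longrightarrow> C4 * (1 + ln U + ln (1 + \<tau>)) < \<kappa> \<Longrightarrow>
       P \<le> K6 * U * N ^ 2 * exp (- (c1 * \<tau>\<^sup>2 * U ^ (2 * s - 3)))"
    for \<kappa> U N P :: real
  proof -
    define W where "W = U powr ((real s - 1) / 2)"
    define X where "X = min (\<kappa>\<^sup>2) (\<kappa> powr (1/2)) * W"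
    define r where "r = 1 / U ^ (s - 1)"
    have W1: "1 \<le> W" unfolding W_def using U s by (intro ge_one_powr_ge_zero) auto
    have r: "0 < r" "r < b * \<kappa>" using q U by (auto simp: r_def)
    have sqU: "1 \<le> sqrt U" using U by simp
    have WU: "W * sqrt U \<le> U ^ (2 * s - 3)"
    proof -
      have s': "2 \<le> real s" using s by simp
      have eq: "W * sqrt U = U powr ((real s - 1) / 2 + 1 / 2)"
        using U by (simp add: W_def powr_add powr_half_sqrt)
      have "real (2 * s - 3) = 2 * real s - 3" using s by (simp add: of_nat_diff)
      then have "U powr ((real s - 1) / 2 + 1 / 2) \<le> U powr real (2 * s - 3)"
      proof (intro powr_mono U)
        have "(t - 1) / 2 + 1 / 2 \<le> 2 * t - 3" if "2 \<le> t" for t :: real using that by (simp add: field_simps)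
        from this[OF s'] show "(real s - 1) / 2 + 1 / 2 \<le> real (2 * s - 3)"
          using \<open>real (2 * s - 3) = 2 * real s - 3\<close> by simp
      qed
      also have "\<dots> = U ^ (2 * s - 3)" using U by (intro powr_realpow) auto
      finally show ?thesis unfolding eq .
    qed
    have X: "0 \<le> X" "X \<le> \<kappa>\<^sup>2 * W" "X \<le> sqrt \<kappa> * W"
      unfolding X_def using W1 \<kappa> by (auto intro!: mult_right_mono simp: powr_half_sqrt)
    have KUN: "0 \<le> K6 * U * N ^ 2" using pos U by simp
    have quad: "X \<le> X0 \<or> P \<le> K6 * U * N ^ 2 * exp (- (c4 * X) - c5 * sqrt U)"
      if h: "P \<le> K6 * U * N ^ 2 * exp (- (c2 * \<kappa>\<^sup>2 * U ^ (2 * s - 3)))"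
    proof (cases "\<kappa>\<^sup>2 * W \<le> 1")
      case True
      then show ?thesis using X X0 by linarith
    next
      case False
      \<comment> \<open>With x = \<kappa>^2 W and y = sqrt U both at least 1, (x - 1)(y - 1) \<ge> 0
        gives x + y \<le> 2 x y: the exponent splits into a part for X and a part for sqrt
        U.\<close>
      have "0 \<le> (\<kappa>\<^sup>2 * W - 1) * (sqrt U - 1)" using False sqU by (intro mult_nonneg_nonneg) auto
      then have "\<kappa>\<^sup>2 * W + sqrt U \<le> 2 * (\<kappa>\<^sup>2 * W * sqrt U)"
      proof -
        have "1 * 1 \<le> \<kappa>\<^sup>2 * W * sqrt U" using False sqU by (intro mult_mono) auto
        then show ?thesis using \<open>0 \<le> (\<kappa>\<^sup>2 * W - 1) * (sqrt U - 1)\<close> by (simp add: algebra_simps)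
      qed
      then have "c2 / 2 * (\<kappa>\<^sup>2 * W + sqrt U) \<le> c2 / 2 * (2 * (\<kappa>\<^sup>2 * W * sqrt U))" using c2 by (intro mult_left_mono) auto
      also have "\<dots> = c2 * \<kappa>\<^sup>2 * (W * sqrt U)" by simp
      also have "\<dots> \<le> c2 * \<kappa>\<^sup>2 * U ^ (2 * s - 3)" using WU c2 by (intro mult_left_mono) auto
      finally have 1: "c2 / 2 * (\<kappa>\<^sup>2 * W) + c2 / 2 * sqrt U \<le> c2 * \<kappa>\<^sup>2 * U ^ (2 * s - 3)" by (simp only: distrib_left)
      have 2: "c4 * X \<le> c2 / 2 * (\<kappa>\<^sup>2 * W)" using c4 c2 X by (intro mult_mono) auto
      have 3: "c5 * sqrt U \<le> c2 / 2 * sqrt U" using c5 sqU by (intro mult_right_mono) auto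
      have "exp (- (c2 * \<kappa>\<^sup>2 * U ^ (2 * s - 3))) \<le> exp (- (c4 * X) - c5 * sqrt U)"
        using 1 2 3 by simp
      then show ?thesis using h mult_left_mono[OF _ KUN] order_trans by blast
    qed
    have quad': "X \<le> X0 \<or> P \<le> K6 * U * N ^ 2 * exp (- (c4 * X) - c5 * sqrt U)"
      if h: "P \<le> K6 * U * N ^ 2 * exp (- (c1 * \<tau>\<^sup>2 * U ^ (2 * s - 3)))" and t: "c2 * \<kappa>\<^sup>2 \<le> c1 * \<tau>\<^sup>2" for \<tau>
    proof (rule quad)
      have "c2 * \<kappa>\<^sup>2 * U ^ (2 * s - 3) \<le> c1 * \<tau>\<^sup>2 * U ^ (2 * s - 3)" using t U by (intro mult_right_mono) auto
      then have "exp (- (c1 * \<tau>\<^sup>2 * U ^ (2 * s - 3))) \<le> exp (- (c2 * \<kappa>\<^sup>2 * U ^ (2 * s - 3)))" by simp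
      from order_trans[OF h mult_left_mono[OF this KUN]]
      show "P \<le> K6 * U * N ^ 2 * exp (- (c2 * \<kappa>\<^sup>2 * U ^ (2 * s - 3)))" .
    qed
    have "X \<le> X0 \<or> P \<le> K6 * U * N ^ 2 * exp (- (c4 * X) - c5 * sqrt U)"
    proof (cases "\<kappa> \<le> K5")
      case True
      define \<tau> where "\<tau> = \<kappa> / (2 * K5)"
      have \<tau>0: "0 < \<tau>" using \<kappa> pos by (simp add: \<tau>_def)
      have \<tau>1: "\<tau> \<le> 1 / 2" using True pos by (simp add: \<tau>_def field_simps)
      have "K1 * r \<le> K1 * (1 / (2 * K5 * K1) * \<kappa>)"
      proof -
        have "b * \<kappa> \<le> 1 / (2 * K5 * K1) * \<kappa>" using \<kappa> by (intro mult_right_mono) (auto simp: b_def)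
        then show ?thesis using r pos by (intro mult_left_mono) auto
      qed
      also have "\<dots> = \<tau>" using pos by (simp add: \<tau>_def)
      finally have K1r: "K1 / U ^ (s - 1) \<le> \<tau>" by (simp add: r_def)
      have Br: "B * r \<le> \<kappa> / 4"
      proof -
        have "b * \<kappa> \<le> 1 / (4 * (B + 1)) * \<kappa>" using \<kappa> by (intro mult_right_mono) (auto simp: b_def)
        then have "B * r \<le> (B + 1) * (1 / (4 * (B + 1)) * \<kappa>)" using r pos by (intro mult_mono) auto
        also have "\<dots> = \<kappa> / 4"
        proof -
          have "m * (1 / (4 * m) * \<kappa>) = \<kappa> / 4" if "0 < m" for m :: real using that by simp
          from this[of "B + 1"] pos show ?thesis by simp
        qed
        finally show ?thesis .
      qed
      have "B / U ^ (s - 1) + K5 * \<tau> < \<kappa>"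
      proof -
        have "B / U ^ (s - 1) \<le> \<kappa> / 4" "K5 * \<tau> = \<kappa> / 2" using Br pos by (simp_all add: r_def \<tau>_def)
        then show ?thesis using \<kappa> by linarith
      qed
      from f1[OF \<tau>0 \<tau>1 K1r this] show ?thesis
      proof (rule quad')
        have "c2 * \<kappa>\<^sup>2 \<le> c1 / (4 * K5\<^sup>2) * \<kappa>\<^sup>2" using c2 by (intro mult_right_mono) auto
        also have "\<dots> = c1 * \<tau>\<^sup>2" by (simp add: \<tau>_def power_divide power_mult_distrib)
        finally show "c2 * \<kappa>\<^sup>2 \<le> c1 * \<tau>\<^sup>2" .
      qed
    next
      case large: False
      have lnU: "0 \<le> ln U" using U by simp
      show ?thesis
      proof (cases "2 * C4 * (1 + ln U) \<le> \<kappa> \<and> 4 * C4 * K1 \<le> \<kappa>")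
        case True
        define \<tau> where "\<tau> = exp (\<kappa> / (4 * C4)) - 1"
        have \<tau>: "\<kappa> / (4 * C4) \<le> \<tau>" using exp_ge_add_one_self[of "\<kappa> / (4 * C4)"] unfolding \<tau>_def by linarith
        have "K1 \<le> \<kappa> / (4 * C4)" using True pos by (simp add: field_simps)
        then have K1\<tau>: "K1 \<le> \<tau>" using \<tau> by linarith
        have "C4 * (1 + ln U + ln (1 + \<tau>)) = C4 * (1 + ln U) + \<kappa> / 4" using pos by (simp add: \<tau>_def distrib_left)
        also have "\<dots> < \<kappa>" using True \<kappa> by simp
        finally have "C4 * (1 + ln U + ln (1 + \<tau>)) < \<kappa>" .
        from f2[OF K1\<tau> this] show ?thesis
        proof (rule quad')
          have "c2 * \<kappa>\<^sup>2 \<le> c1 / (16 * C4\<^sup>2) * \<kappa>\<^sup>2" using c2 by (intro mult_right_mono) auto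
          also have "\<dots> = c1 * (\<kappa> / (4 * C4))\<^sup>2" by (simp add: power_divide power_mult_distrib)
          also have "\<dots> \<le> c1 * \<tau>\<^sup>2" using \<tau> \<kappa> pos by (intro mult_left_mono power_mono) auto
          finally show "c2 * \<kappa>\<^sup>2 \<le> c1 * \<tau>\<^sup>2" .
        qed
      next
        case False
        have lnU': "1 + ln U \<le> U" using ln_le_minus_one[of U] U by simp
        have \<kappa>C: "\<kappa> \<le> C9 * (1 + ln U)"
        proof -
          have "0 \<le> 4 * C4 * K1 * ln U" "0 \<le> 2 * C4 * (1 + ln U)" "0 \<le> 4 * C4 * K1" using pos lnU by auto
          then show ?thesis using False unfolding C9_def by (auto simp: algebra_simps)
        qed
        have \<kappa>U: "\<kappa> \<le> C9 * U" using \<kappa>C mult_left_mono[OF lnU', of C9] C9 by linarith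
        \<comment> \<open>Here the factor sqrt \<kappa> of X is paid for by the spare factor sqrt U,
          since \<tau> = 1/2 gives an exponent that does not grow with \<kappa>.\<close>
        then have sq: "sqrt \<kappa> \<le> sqrt C9 * sqrt U" by (simp add: real_sqrt_mult[symmetric])
        show ?thesis
        proof (cases "r \<le> q0")
          case True
          have "K1 * r \<le> K1 * (1 / (2 * K1))" using True pos by (intro mult_left_mono) (auto simp: q0_def)
          then have K1r: "K1 / U ^ (s - 1) \<le> 1 / 2" using pos by (simp add: r_def)
          have "B * r \<le> (B + 1) * (K5 / (2 * (B + 1)))" using True pos r by (intro mult_mono) (auto simp: q0_def)
          moreover have "m * (K5 / (2 * m)) = K5 / 2" if "0 < m" for m :: real using that by simp
          from this[of "B + 1"] have "(B + 1) * (K5 / (2 * (B + 1))) = K5 / 2" using pos by linarith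
          ultimately have "B / U ^ (s - 1) \<le> K5 / 2" by (simp only: r_def) simp
          then have "B / U ^ (s - 1) + K5 * (1 / 2) < \<kappa>" using large by linarith
          then have h: "P \<le> K6 * U * N ^ 2 * exp (- (c1 * (1 / 2)\<^sup>2 * U ^ (2 * s - 3)))"
            using f1[of "1 / 2"] K1r by simp
          have "c4 * X \<le> c1 / 8 / sqrt C9 * (sqrt C9 * sqrt U * W)"
            using c4 X pos C9 W1 order_trans[OF X(3) mult_right_mono[OF sq]] by (intro mult_mono) auto
          also have "\<dots> = c1 / 8 * (W * sqrt U)" using C9 by simp
          finally have 1: "c4 * X \<le> c1 / 8 * (W * sqrt U)" .
          have "1 * sqrt U \<le> W * sqrt U" using W1 sqU by (intro mult_right_mono) auto
          then have 2: "c5 * sqrt U \<le> c1 / 8 * (W * sqrt U)" using c5 sqU pos by (intro mult_mono) auto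
          have "c1 / 4 * (W * sqrt U) \<le> c1 / 4 * U ^ (2 * s - 3)" using WU pos by (intro mult_left_mono) auto
          then have "exp (- (c1 * (1 / 2)\<^sup>2 * U ^ (2 * s - 3))) \<le> exp (- (c4 * X) - c5 * sqrt U)"
            using 1 2 by (simp add: power2_eq_square)
          then show ?thesis using h mult_left_mono[OF _ KUN] order_trans by blast
        next
          case False
          then have "U ^ (s - 1) < 1 / q0" using q0 U by (simp add: r_def field_simps)
          moreover have "U ^ 1 \<le> U ^ (s - 1)" using U s by (intro power_increasing) auto
          ultimately have U0: "U \<le> 1 / q0" by simp
          have "W \<le> U powr real (s - 1)" unfolding W_def using U s by (intro powr_mono) (auto simp: of_nat_diff)
          also have "\<dots> = U ^ (s - 1)" using U by (intro powr_realpow) auto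
          finally have W0: "W \<le> 1 / q0" using \<open>U ^ (s - 1) < 1 / q0\<close> by simp
          have "sqrt \<kappa> \<le> sqrt (C9 * (1 / q0))"
            using order_trans[OF \<kappa>U mult_left_mono[OF U0]] C9 by (intro real_sqrt_le_mono) auto
          then have "sqrt \<kappa> * W \<le> sqrt (C9 * (1 / q0)) * (1 / q0)"
            using W0 W1 C9 q0 by (intro mult_mono) auto
          then show ?thesis using X(3) X0(3) by linarith
        qed
      qed
    qed
    from absorb[OF P X(1) U N this] show ?thesis by (simp add: X_def W_def)
  qed
  then show ?thesis using c b0 by (intro exI[of _ c] conjI exI[of _ b]) auto
qed

section \<open>The error of the estimator\<close>

lemma interpolant_observation:
  "interpolant N x (observation Of x \<delta> e \<omega>) y
    = interpolant N x (\<lambda>j. Of (x j)) y + (\<Sum>j=1..N. (\<delta> j * e j \<omega>) * hat_fun x j y)"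
  by (simp add: interpolant_def observation_def distrib_right sum.distrib)

lemma fourier_add:
  assumes "integrable lborel f" "integrable lborel g"
  shows "fourier (\<lambda>x. f x + g x) u = fourier f u + fourier g u"
  unfolding fourier_def using integrable_iexp_mult[OF assms(1)] integrable_iexp_mult[OF assms(2)]
  by (simp add: distrib_left)

lemma fourier_sum:
  assumes "\<And>j. j \<in> I \<Longrightarrow> integrable lborel (f j)"
  shows "fourier (\<lambda>x. \<Sum>j\<in>I. c j * f j x) u = (\<Sum>j\<in>I. of_real (c j) * fourier (f j) u)"
proof -
  have "fourier (\<lambda>x. \<Sum>j\<in>I. c j * f j x) u = (LINT x|lborel. (\<Sum>j\<in>I. of_real (c j) * (iexp (u * x) * of_real (f j x))))"
    unfolding fourier_def by (simp add: sum_distrib_left mult_ac)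
  also have "\<dots> = (\<Sum>j\<in>I. LINT x|lborel. of_real (c j) * (iexp (u * x) * of_real (f j x)))"
    using assms by (intro Bochner_Integration.integral_sum integrable_mult_right integrable_iexp_mult)
  finally show ?thesis by (simp add: fourier_def)
qed

text \<open>The interpolant is affine in the data, so its error splits into the deterministic
  interpolation error and the noise sum; the factor iu(1 + iu) of \<open>emp_cf\<close> is at most 2
  U^2 in modulus on [-U, U].\<close>

lemma emp_cf_error:
  assumes D: "design N x \<delta>" and mesh: "mesh N x \<le> 1" and Of: "integrable lborel Of"
    and E: "integrable lborel (\<lambda>y. interpolant N x (\<lambda>j. Of (x j)) y - Of y)"
      "(LINT y|lborel. \<bar>interpolant N x (\<lambda>j. Of (x j)) y - Of y\<bar>) \<le> d"
    and z: "cmod (\<Sum>j=1..N. of_real (\<delta> j * e j \<omega>) * fourier (hat_fun x j) u) \<le> z"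
    and U: "1 \<le> U" "u \<in> {-U..U}"
  shows "cmod (emp_cf (interpolant N x (observation Of x \<delta> e \<omega>)) u - emp_cf Of u) \<le> 2 * U\<^sup>2 * (d + z)"
proof -
  define Er where "Er y = interpolant N x (\<lambda>j. Of (x j)) y - Of y" for y
  define S where "S y = (\<Sum>j=1..N. (\<delta> j * e j \<omega>) * hat_fun x j y)" for y
  have hi: "integrable lborel (hat_fun x j)" if "j \<in> {1..N}" for j
    by (rule hat_fun_fourier(1)[OF D that mesh])
  have Si: "integrable lborel S"
    unfolding S_def using hi by (intro Bochner_Integration.integrable_sum integrable_mult_right) auto
  have Ei: "integrable lborel Er" using E(1) by (simp add: Er_def[abs_def])
  have "interpolant N x (observation Of x \<delta> e \<omega>) = (\<lambda>y. Of y + (Er y + S y))"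
    by (simp add: interpolant_observation Er_def S_def fun_eq_iff)
  then have "fourier (interpolant N x (observation Of x \<delta> e \<omega>)) u = fourier Of u + (fourier Er u + fourier S u)"
    using fourier_add[OF Of Bochner_Integration.integrable_add[OF Ei Si]] fourier_add[OF Ei Si] by simp
  then have diff: "emp_cf (interpolant N x (observation Of x \<delta> e \<omega>)) u - emp_cf Of u
      = (\<i> * of_real u * (1 + \<i> * of_real u)) * (fourier Er u + fourier S u)"
    by (simp add: emp_cf_def algebra_simps)
  have "cmod (fourier Er u) \<le> d"
    using order_trans[OF fourier_norm_le[OF Ei] E(2)[folded Er_def]] .
  moreover have "cmod (fourier S u) \<le> z"
    using z hi by (subst S_def[abs_def], subst fourier_sum) auto
  ultimately have 1: "cmod (fourier Er u + fourier S u) \<le> d + z"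
    using norm_triangle_ineq[of "fourier Er u" "fourier S u"] by linarith
  have "cmod (1 + \<i> * of_real u) \<le> 1 + \<bar>u\<bar>"
    using norm_triangle_ineq[of 1 "\<i> * of_real u"] by (simp add: norm_mult)
  also have "\<dots> \<le> 2 * U" using U by auto
  finally have "cmod (1 + \<i> * of_real u) \<le> 2 * U" .
  moreover have "\<bar>u\<bar> \<le> U" using U by auto
  ultimately have "\<bar>u\<bar> * cmod (1 + \<i> * of_real u) \<le> U * (2 * U)" using U by (intro mult_mono) auto
  then have "cmod (\<i> * of_real u * (1 + \<i> * of_real u)) \<le> 2 * U\<^sup>2"
    by (simp add: norm_mult power2_eq_square mult_ac)
  then show ?thesis unfolding diff norm_mult[of "\<i> * of_real u * (1 + \<i> * of_real u)"]
    using 1 by (intro mult_mono) auto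
qed

context
  fixes Q :: "'b measure" and X :: "real \<Rightarrow> 'b \<Rightarrow> real" and k :: "real \<Rightarrow> real" and \<gamma> T R \<alpha>bar C\<^sub>\<phi> :: real and s :: nat
    and w :: "real \<Rightarrow> real \<Rightarrow> real" and B Cw :: real
  assumes k: "(\<gamma>, k) \<in> class_Gs s T R \<alpha>bar" and X: "levy_process Q X \<gamma> k" and T: "0 < T"
    and R: "0 < R" and a: "0 < \<alpha>bar" and tc: "trim_constant T R \<alpha>bar C\<^sub>\<phi>" and s: "2 \<le> s"
    and Cw: "0 \<le> Cw" "\<And>U u. 0 < U \<Longrightarrow> \<bar>w U u\<bar> \<le> Cw * (\<bar>u\<bar> ^ (s - 1) / U ^ s)"
    and w: "\<And>U. 0 < U \<Longrightarrow> w U \<in> borel_measurable borel"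
    and B: "\<And>U. 1 \<le> U \<Longrightarrow> \<bar>(LINT u:{-U..U}|lborel. re_exponent k u * w U u) - jump_sum k\<bar> \<le> B / U ^ (s - 1)"
begin

text \<open>The bias is at most B / U^(s-1); the rest is a weighted integral of a function bounded
  by m / T, and the weight has L1 norm at most 2 Cw whatever U is.\<close>

lemma alpha_est_error:
  assumes U: "1 \<le> U" and f: "f \<in> borel_measurable borel"
    and nz: "\<not> (\<exists>v\<in>{-U..U}. emp_cf f v = 0)"
    and m: "\<And>u. u \<in> {-U..U} \<Longrightarrow>
      \<bar>ln (cmod (trunc (trim T R \<alpha>bar C\<^sub>\<phi> u) (emp_cf f u))) - ln (cmod (levy_cf T \<gamma> k (of_real u - \<i>)))\<bar> \<le> m"
  shows "\<bar>alpha_est T R \<alpha>bar C\<^sub>\<phi> w U f - jump_sum k\<bar> \<le> B / U ^ (s - 1) + 2 * Cw / T * m"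
proof -
  note f[measurable]
  have U0: "0 < U" using U by simp
  note ke = class_Gs_levy_integrable(3)[OF k]
  define P where "P u = 1 / T * ln (cmod (trunc (trim T R \<alpha>bar C\<^sub>\<phi> u) (emp_cf f u)))" for u
  define F where "F u = P u - re_exponent k u" for u
  have Rm [measurable]: "re_exponent k \<in> borel_measurable borel"
    by (intro borel_measurable_continuous_onI continuous_at_imp_continuous_on ballI DERIV_isCont[OF re_exponent_deriv[OF ke]])
  have em [measurable]: "emp_cf f \<in> borel_measurable borel"
    unfolding emp_cf_def[abs_def] by measurable
  have tm [measurable]: "trim T R \<alpha>bar C\<^sub>\<phi> \<in> borel_measurable borel"
    unfolding trim_def[abs_def] by measurable
  have Pm [measurable]: "P \<in> borel_measurable borel"
    unfolding P_def[abs_def] trunc_def by measurable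
  have Fm: "F \<in> borel_measurable borel" unfolding F_def[abs_def] by measurable
  have F: "\<bar>F u\<bar> \<le> m / T" if "u \<in> {-U..U}" for u
  proof -
    have "ln (cmod (levy_cf T \<gamma> k (of_real u - \<i>))) = T * re_exponent k u"
      unfolding cmod_levy_cf_shifted[OF k X T] by simp
    then have "F u = (ln (cmod (trunc (trim T R \<alpha>bar C\<^sub>\<phi> u) (emp_cf f u))) - ln (cmod (levy_cf T \<gamma> k (of_real u - \<i>)))) / T"
      using T by (simp add: F_def P_def field_simps)
    then show ?thesis using m[OF that] T by (simp add: abs_divide divide_right_mono)
  qed
  note wti = weight_times_integrable[where w = w and U = U and Cw = Cw and s = s, OF U0 Cw(1) Cw(2)[OF U0] w[OF U0] _ _ s]
  have up: "\<bar>u\<bar> ^ (s - 1) \<le> U ^ (s - 1)" if "u \<in> {-U..U}" for u using that by (intro power_mono) auto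
  have FK: "\<bar>F u\<bar> * \<bar>u\<bar> ^ (s - 1) \<le> m / T * U ^ (s - 1)" if "u \<in> {-U..U}" for u
    using F[OF that] up[OF that] by (intro mult_mono) auto
  define I where "I = (LINT x|lborel. \<bar>exp x * k x\<bar>)"
  have RK: "\<bar>re_exponent k u\<bar> * \<bar>u\<bar> ^ (s - 1) \<le> (U * I) * U ^ (s - 1)" if "u \<in> {-U..U}" for u
  proof -
    have "\<bar>re_exponent k u\<bar> \<le> \<bar>u\<bar> * I" unfolding I_def by (rule abs_re_exponent_le[OF ke])
    also have "\<dots> \<le> U * I" using that by (intro mult_right_mono) (auto simp: I_def)
    finally show ?thesis using up[OF that] by (intro mult_mono) auto
  qed
  note iF = wti[OF Fm FK] and iR = wti(1)[OF Rm RK]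
  have "alpha_est T R \<alpha>bar C\<^sub>\<phi> w U f = (LINT u:{-U..U}|lborel. F u * w U u + re_exponent k u * w U u)"
    unfolding alpha_est_def
    by (rule set_lebesgue_integral_cong) (auto simp: Re_psi_est[OF nz] F_def P_def algebra_simps)
  also have "\<dots> = (LINT u:{-U..U}|lborel. F u * w U u) + (LINT u:{-U..U}|lborel. re_exponent k u * w U u)"
    using iF(1) iR by (rule set_integral_add)
  finally have "\<bar>alpha_est T R \<alpha>bar C\<^sub>\<phi> w U f - jump_sum k\<bar>
      \<le> \<bar>LINT u:{-U..U}|lborel. F u * w U u\<bar> + \<bar>(LINT u:{-U..U}|lborel. re_exponent k u * w U u) - jump_sum k\<bar>"
    by linarith
  also have "\<dots> \<le> 2 * Cw / T * m + B / U ^ (s - 1)"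
  proof (rule add_mono)
    have "2 * (m / T * U ^ (s - 1)) * Cw / U ^ (s - 1) = 2 * Cw / T * m" using U0 by simp
    then show "\<bar>LINT u:{-U..U}|lborel. F u * w U u\<bar> \<le> 2 * Cw / T * m" using iF(2) by simp
  qed (rule B[OF U])
  finally show ?thesis by simp
qed

text \<open>A relative error of at most 1/2 keeps the empirical modulus above |\<phi>| / 2, hence
  nonzero and above the trimming level, so the logarithm acts on an untrimmed value between (1 -
  t)|\<phi>| and (1 + t)|\<phi>|.\<close>

lemma alpha_est_error_small:
  assumes U: "1 \<le> U" and f: "f \<in> borel_measurable borel" and t: "t \<le> 1 / 2"
    and d: "\<And>u. u \<in> {-U..U} \<Longrightarrow> cmod (emp_cf f u - levy_cf T \<gamma> k (of_real u - \<i>)) \<le> t * cmod (levy_cf T \<gamma> k (of_real u - \<i>))"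
  shows "\<bar>alpha_est T R \<alpha>bar C\<^sub>\<phi> w U f - jump_sum k\<bar> \<le> B / U ^ (s - 1) + 4 * Cw / T * t"
proof -
  define \<phi> where "\<phi> u = levy_cf T \<gamma> k (of_real u - \<i>)" for u :: real
  have pos: "0 < cmod (\<phi> u)" for u unfolding \<phi>_def cmod_levy_cf_shifted[OF k X T] by simp
  have half: "cmod (\<phi> u) / 2 \<le> cmod (emp_cf f u)" if "u \<in> {-U..U}" for u
  proof -
    have "cmod (\<phi> u - emp_cf f u) \<le> t * cmod (\<phi> u)" using d[OF that] by (simp add: \<phi>_def norm_minus_commute)
    also have "\<dots> \<le> 1 / 2 * cmod (\<phi> u)" using t by (intro mult_right_mono) auto
    finally show ?thesis using norm_triangle_sub[of "\<phi> u" "emp_cf f u"] by simp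
  qed
  have nz: "\<not> (\<exists>v\<in>{-U..U}. emp_cf f v = 0)" using half pos by force
  have "\<bar>ln (cmod (trunc (trim T R \<alpha>bar C\<^sub>\<phi> u) (emp_cf f u))) - ln (cmod (\<phi> u))\<bar> \<le> 2 * t" if u: "u \<in> {-U..U}" for u
  proof -
    note tr = trim_bounds[OF k X T R a tc U u]
    have "trim T R \<alpha>bar C\<^sub>\<phi> u \<le> cmod (emp_cf f u)" using tr(3) half[OF u] pos[of u] unfolding \<phi>_def by linarith
    then have "trunc (trim T R \<alpha>bar C\<^sub>\<phi> u) (emp_cf f u) = emp_cf f u" by (simp add: trunc_def)
    moreover have "\<bar>cmod (emp_cf f u) - cmod (\<phi> u)\<bar> \<le> t * cmod (\<phi> u)"
      using order_trans[OF norm_triangle_ineq3 d[OF u]] by (simp add: \<phi>_def)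
    ultimately show ?thesis using abs_ln_ratio_le[OF pos _ t] by simp
  qed
  from alpha_est_error[OF U f nz this[unfolded \<phi>_def]] show ?thesis by simp
qed

text \<open>Without a smallness condition the trimmed modulus still lies between the trimming level
  and (1 + t)|\<phi>|, and |\<phi>| \<le> 1; the logarithm therefore errs by at most a multiple of 1
  + ln U + ln(1 + t). If the empirical function has a zero, the estimate is 0 and the error at most
  \<open>\<alpha>bar\<close>.\<close>

lemma alpha_est_error_large:
  fixes c0 :: real
  defines "c0 \<equiv> min (exp (- T * R)) C\<^sub>\<phi>"
  assumes U: "1 \<le> U" and f: "f \<in> borel_measurable borel" and t: "0 \<le> t" and B0: "0 \<le> B"
    and d: "\<And>u. u \<in> {-U..U} \<Longrightarrow> cmod (emp_cf f u - levy_cf T \<gamma> k (of_real u - \<i>)) \<le> t * cmod (levy_cf T \<gamma> k (of_real u - \<i>))"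
  shows "\<bar>alpha_est T R \<alpha>bar C\<^sub>\<phi> w U f - jump_sum k\<bar>
    \<le> (\<alpha>bar + B + 2 * Cw / T * (\<bar>ln (c0 / 3)\<bar> + T * \<alpha>bar + 1)) * (1 + ln U + ln (1 + t))"
proof -
  define \<phi> where "\<phi> u = levy_cf T \<gamma> k (of_real u - \<i>)" for u :: real
  have pos: "0 < cmod (\<phi> u)" for u unfolding \<phi>_def cmod_levy_cf_shifted[OF k X T] by simp
  have le1: "cmod (\<phi> u) \<le> 1" for u unfolding \<phi>_def by (rule cmod_levy_cf_le_one[OF k X T])
  define L where "L = 1 + ln U + ln (1 + t)"
  have lnU: "0 \<le> ln U" and lnt: "0 \<le> ln (1 + t)" using U t by auto
  have L1: "1 \<le> L" using lnU lnt by (simp add: L_def)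
  define V where "V = \<bar>ln (c0 / 3)\<bar> + T * \<alpha>bar + 1"
  have V: "1 \<le> V" using T a by (simp add: V_def)
  have CwT: "0 \<le> 2 * Cw / T" using Cw T by simp
  have jump: "0 \<le> jump_sum k" "jump_sum k \<le> \<alpha>bar" using k by (auto simp: class_Gs_def class_G0_def)
  have "\<bar>alpha_est T R \<alpha>bar C\<^sub>\<phi> w U f - jump_sum k\<bar> \<le> (\<alpha>bar + B + 2 * Cw / T * V) * L"
  proof (cases "\<exists>v\<in>{-U..U}. emp_cf f v = 0")
    case True
    then have "alpha_est T R \<alpha>bar C\<^sub>\<phi> w U f = 0" by (simp add: alpha_est_def psi_est_def)
    then have "\<bar>alpha_est T R \<alpha>bar C\<^sub>\<phi> w U f - jump_sum k\<bar> \<le> \<alpha>bar * 1" using jump by simp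
    also have "\<dots> \<le> (\<alpha>bar + B + 2 * Cw / T * V) * L"
    proof -
      have "0 \<le> 2 * Cw / T * V" using CwT V by (intro mult_nonneg_nonneg) auto
      then show ?thesis using L1 a B0 by (intro mult_mono) linarith+
    qed
    finally show ?thesis .
  next
    case False
    have m: "\<bar>ln (cmod (trunc (trim T R \<alpha>bar C\<^sub>\<phi> u) (emp_cf f u))) - ln (cmod (\<phi> u))\<bar> \<le> V * L" if u: "u \<in> {-U..U}" for u
    proof -
      note tr = trim_bounds[OF k X T R a tc U u, folded c0_def]
      have c0: "0 < c0" using tc by (auto simp: c0_def trim_constant_def)
      define Y where "Y = cmod (trunc (trim T R \<alpha>bar C\<^sub>\<phi> u) (emp_cf f u))"
      have Yeq: "Y = max (trim T R \<alpha>bar C\<^sub>\<phi> u) (cmod (emp_cf f u))"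
        unfolding Y_def using False u tr(1) by (intro cmod_trunc) auto
      have Y0: "0 < Y" using Yeq tr(1) by auto
      have "cmod (emp_cf f u) \<le> (1 + t) * cmod (\<phi> u)"
        using norm_triangle_sub[of "emp_cf f u" "\<phi> u"] d[OF u] by (simp add: \<phi>_def distrib_right)
      moreover have "trim T R \<alpha>bar C\<^sub>\<phi> u \<le> (1 + t) * cmod (\<phi> u)"
      proof -
        have "trim T R \<alpha>bar C\<^sub>\<phi> u \<le> 1 * cmod (\<phi> u)" using tr(3) pos[of u] unfolding \<phi>_def by linarith
        also have "\<dots> \<le> (1 + t) * cmod (\<phi> u)" using t by (intro mult_right_mono) auto
        finally show ?thesis .
      qed
      ultimately have "Y \<le> (1 + t) * cmod (\<phi> u)" using Yeq by simp
      then have "ln Y \<le> ln ((1 + t) * cmod (\<phi> u))" using Y0 by (intro ln_mono) auto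
      then have up: "ln Y - ln (cmod (\<phi> u)) \<le> ln (1 + t)" using t pos[of u] by (simp add: ln_mult)
      have "c0 / 3 * U powr (- T * \<alpha>bar) \<le> Y" using tr(2) Yeq by simp
      then have "ln (c0 / 3 * U powr (- T * \<alpha>bar)) \<le> ln Y" using c0 U by (intro ln_mono) auto
      moreover have "ln (c0 / 3 * U powr (- T * \<alpha>bar)) = ln (c0 / 3) + - T * \<alpha>bar * ln U"
        using c0 U by (subst ln_mult) (auto simp: ln_powr)
      ultimately have "ln (c0 / 3) - T * \<alpha>bar * ln U \<le> ln Y" by simp
      moreover have "ln (cmod (\<phi> u)) \<le> 0" using le1[of u] pos[of u] by simp
      ultimately have lo: "- (\<bar>ln (c0 / 3)\<bar> + T * \<alpha>bar * ln U) \<le> ln Y - ln (cmod (\<phi> u))" by linarith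
      have "\<bar>ln (c0 / 3)\<bar> * 1 \<le> \<bar>ln (c0 / 3)\<bar> * L" using L1 by (intro mult_left_mono) auto
      moreover have "T * \<alpha>bar * ln U \<le> T * \<alpha>bar * L" using lnt T a by (intro mult_left_mono) (auto simp: L_def)
      moreover have "0 \<le> T * \<alpha>bar * ln U" using T a lnU by simp
      moreover have "ln (1 + t) \<le> L" using lnU by (simp add: L_def)
      moreover have "V * L = \<bar>ln (c0 / 3)\<bar> * L + T * \<alpha>bar * L + L" by (simp add: V_def distrib_right)
      ultimately show ?thesis using up lo lnt unfolding Y_def[symmetric] by linarith
    qed
    have 1: "\<bar>alpha_est T R \<alpha>bar C\<^sub>\<phi> w U f - jump_sum k\<bar> \<le> B / U ^ (s - 1) + 2 * Cw / T * (V * L)"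
      by (rule alpha_est_error[OF U f False m[unfolded \<phi>_def]])
    have 2: "B / U ^ (s - 1) \<le> B / 1" using U B0 by (intro divide_left_mono) auto
    have 3: "B * 1 \<le> B * L" by (rule mult_left_mono[OF L1 B0])
    have 4: "0 \<le> \<alpha>bar * L" using a L1 by simp
    have "(\<alpha>bar + B + 2 * Cw / T * V) * L = \<alpha>bar * L + B * L + 2 * Cw / T * (V * L)"
      by (simp only: distrib_right mult.assoc)
    then show ?thesis using 1 2 3 4 by linarith
  qed
  then show ?thesis by (simp add: V_def L_def)
qed

end

section \<open>Powers of the cut-off, uniform error and the final bound\<close>

lemma cutoff_powr:
  assumes \<epsilon>: "0 < \<epsilon>" "\<epsilon> < 1" and s: "2 \<le> s" and Ta: "0 < T * \<alpha>bar"
  defines "p \<equiv> 2 * real s + 2 * T * \<alpha>bar + 1"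
  shows "1 \<le> cutoff s T \<alpha>bar \<epsilon>"
    and "cutoff s T \<alpha>bar \<epsilon> powr r = \<epsilon> powr (- (2 * r / p))"
    and "1 / cutoff s T \<alpha>bar \<epsilon> ^ (s - 1) = \<epsilon> powr ((2 * real s - 2) / p)"
    and "\<epsilon> powr (- (real s - 1) / p) = cutoff s T \<alpha>bar \<epsilon> powr ((real s - 1) / 2)"
    and "(1 / \<epsilon>)\<^sup>2 * cutoff s T \<alpha>bar \<epsilon> powr (- 2 * T * \<alpha>bar - 4) = cutoff s T \<alpha>bar \<epsilon> ^ (2 * s - 3)"
    and "0 \<le> d \<Longrightarrow> d powr (3/2) \<le> \<epsilon> \<Longrightarrow> d\<^sup>2 * cutoff s T \<alpha>bar \<epsilon> powr (2 + T * \<alpha>bar) \<le> 1 / cutoff s T \<alpha>bar \<epsilon> ^ (s - 1)"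
proof -
  define U where "U = cutoff s T \<alpha>bar \<epsilon>"
  have s': "2 \<le> real s" using s by simp
  have p: "0 < p" using s' Ta by (simp add: p_def mult.assoc)
  have U_eq: "U = \<epsilon> powr (- 2 / p)" by (simp add: U_def cutoff_def p_def)
  have "\<epsilon> powr 0 \<le> \<epsilon> powr (- 2 / p)" using \<epsilon> p by (intro powr_mono') auto
  then have U1: "1 \<le> U" using \<epsilon> by (simp add: U_eq)
  then show "1 \<le> cutoff s T \<alpha>bar \<epsilon>" by (simp add: U_def)
  have Ur: "U powr r = \<epsilon> powr (- (2 * r / p))" for r by (simp add: U_eq powr_powr)
  then show "cutoff s T \<alpha>bar \<epsilon> powr r = \<epsilon> powr (- (2 * r / p))" by (simp add: U_def)
  have pw: "U ^ n = U powr real n" for n using U1 by (simp add: powr_realpow)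
  have inv: "1 / U ^ (s - 1) = \<epsilon> powr ((2 * real s - 2) / p)"
  proof -
    have "1 / U ^ (s - 1) = \<epsilon> powr (2 * real (s - 1) / p)"
      unfolding pw Ur by (simp add: powr_minus field_simps)
    then show ?thesis using s by (simp add: of_nat_diff algebra_simps)
  qed
  then show "1 / cutoff s T \<alpha>bar \<epsilon> ^ (s - 1) = \<epsilon> powr ((2 * real s - 2) / p)" by (simp add: U_def)
  show "\<epsilon> powr (- (real s - 1) / p) = cutoff s T \<alpha>bar \<epsilon> powr ((real s - 1) / 2)"
  proof -
    have "2 * ((real s - 1) / 2) = real s - 1" by simp
    then show ?thesis unfolding U_def[symmetric] Ur by (simp only: minus_divide_left)
  qed
  show "(1 / \<epsilon>)\<^sup>2 * cutoff s T \<alpha>bar \<epsilon> powr (- 2 * T * \<alpha>bar - 4) = cutoff s T \<alpha>bar \<epsilon> ^ (2 * s - 3)"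
  proof -
    have "(1 / \<epsilon>)\<^sup>2 = \<epsilon> powr (- 2)" using \<epsilon> by (simp add: powr_minus power_divide inverse_eq_divide)
    also have "\<dots> = U powr p" unfolding Ur using p by simp
    finally have "(1 / \<epsilon>)\<^sup>2 * U powr (- 2 * T * \<alpha>bar - 4) = U powr (p + (- 2 * T * \<alpha>bar - 4))" by (simp add: powr_add)
    also have "p + (- 2 * T * \<alpha>bar - 4) = real (2 * s - 3)" using s by (simp add: p_def of_nat_diff)
    finally show ?thesis unfolding U_def[symmetric] pw .
  qed
  show "d\<^sup>2 * cutoff s T \<alpha>bar \<epsilon> powr (2 + T * \<alpha>bar) \<le> 1 / cutoff s T \<alpha>bar \<epsilon> ^ (s - 1)"
    if d: "0 \<le> d" "d powr (3/2) \<le> \<epsilon>"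
  proof -
    have "d\<^sup>2 = (d powr (3/2)) powr (4/3)" using d(1) by (cases "d = 0") (auto simp: powr_powr)
    also have "\<dots> \<le> \<epsilon> powr (4/3)" using d by (intro powr_mono2) auto
    finally have "d\<^sup>2 * U powr (2 + T * \<alpha>bar) \<le> \<epsilon> powr (4/3) * \<epsilon> powr (- (2 * (2 + T * \<alpha>bar) / p))"
      unfolding Ur by (intro mult_right_mono) auto
    also have "\<dots> = \<epsilon> powr (4/3 + - (2 * (2 + T * \<alpha>bar) / p))" by (rule powr_add[symmetric])
    also have "\<dots> \<le> \<epsilon> powr ((2 * real s - 2) / p)"
    proof (rule powr_mono')
      \<comment> \<open>Here d^2 \<le> \<epsilon>^(4/3); the comparison of exponents comes down to 1
        \<le> s + T \<alpha>bar.\<close>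
      have "(2 * real s - 2) + 2 * (2 + T * \<alpha>bar) \<le> 4 / 3 * p" using s' Ta by (simp add: p_def mult.assoc)
      then have "((2 * real s - 2) + 2 * (2 + T * \<alpha>bar)) / p \<le> 4 / 3" using p by (simp add: divide_le_eq)
      moreover have "x \<le> 4 / 3 + - y" if "x + y \<le> 4 / 3" for x y :: real using that by simp
      ultimately show "(2 * real s - 2) / p \<le> 4 / 3 + - (2 * (2 + T * \<alpha>bar) / p)" unfolding add_divide_distrib by blast
    qed (use \<epsilon> in auto)
    finally show ?thesis unfolding inv[symmetric] by (simp add: U_def)
  qed
qed

text \<open>Interpolation error and noise each get half of t c0 U^(-T \<alpha>bar), a lower bound
  for t |\<phi>|. The lower bound on t takes care of the first half; the second holds off an event
  whose probability comes from \<open>stochastic_sup_bound\<close>.\<close>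

lemma uniform_cf_error:
  fixes Q :: "'b measure" and X :: "real \<Rightarrow> 'b \<Rightarrow> real" and M :: "'a measure" and e :: "nat \<Rightarrow> 'a \<Rightarrow> real"
    and T R \<alpha>bar C\<^sub>\<phi> C\<^sub>A \<epsilon> :: real and s N :: nat
  assumes T: "0 < T" and R: "0 < R" and s: "2 \<le> s" and a: "0 < \<alpha>bar"
    and k: "(\<gamma>, k) \<in> class_Gs s T R \<alpha>bar" and X: "levy_process Q X \<gamma> k"
    and nm: "noise_model M e" and sg: "uniformly_subgaussian M e C1 C2"
    and C: "0 < C1" "0 < C2" "0 < C\<^sub>\<delta>" "0 < C\<^sub>A"
    and tc: "trim_constant T R \<alpha>bar C\<^sub>\<phi>"
    and D: "design N x \<delta>" and rp: "exp (- range_param N x) \<le> C\<^sub>A * (mesh N x)\<^sup>2"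
    and l2: "mesh N x * (l2_norm N \<delta>)\<^sup>2 \<le> C\<^sub>\<delta> * (linf_norm N \<delta>)\<^sup>2"
    and \<epsilon>: "\<epsilon> = noise_level N x \<delta>" "\<epsilon> < 1"
  defines "U \<equiv> cutoff s T \<alpha>bar \<epsilon>"
    and "c0 \<equiv> min (exp (- T * R)) C\<^sub>\<phi>"
    and "K0 \<equiv> 5 + (2 + 6 * (1 + (LINT \<omega>|Q. exp (2 * X T \<omega>)))) * C\<^sub>A"
  assumes t: "0 < t" "4 * K0 / c0 / U ^ (s - 1) \<le> t"
  shows "\<exists>A\<in>sets M. measure M A \<le> 39 * C1 * U * real N ^ 2 *
      exp (- (C2 * min 1 (1 / (64 * C\<^sub>\<delta>)) * c0\<^sup>2 / 16 * t\<^sup>2 * U ^ (2 * s - 3))) \<and>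
    (\<forall>\<omega>\<in>space M - A. \<forall>u\<in>{-U..U}.
      cmod (emp_cf (interpolant N x (observation (option_fun Q (X T)) x \<delta> e \<omega>)) u - levy_cf T \<gamma> k (of_real u - \<i>))
        \<le> t * cmod (levy_cf T \<gamma> k (of_real u - \<i>)))"
proof -
  interpret Q: prob_space Q using X by (simp add: levy_process_def)
  have XT [measurable]: "X T \<in> borel_measurable Q" using X T by (simp add: levy_process_def)
  note sq = levy_square_exp_integrable[OF k X T]
  note mart = levy_martingale[OF k X T]
  note ei = Q.exp_integrable[OF XT sq]
  define Of where "Of = option_fun Q (X T)"
  define B where "B = 1 + (LINT \<omega>|Q. exp (2 * X T \<omega>))"
  define d where "d = mesh N x"
  have B: "0 \<le> B" by (simp add: B_def add_nonneg_nonneg)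
  note nl = noise_level_mesh[OF D, folded \<epsilon>(1)]
  have mesh1: "mesh N x \<le> 1" using nl(3) \<epsilon>(2) by simp
  have Ta: "0 < T * \<alpha>bar" using T a by simp
  note cp = cutoff_powr[OF nl(2) \<epsilon>(2) s Ta, folded U_def]
  have U1: "1 \<le> U" by (rule cp(1))
  have c0: "0 < c0" using tc by (auto simp: c0_def trim_constant_def)
  have K0: "0 < K0" unfolding K0_def B_def[symmetric] using B C by (intro add_pos_nonneg) auto
  have Of: "integrable lborel Of" unfolding Of_def by (rule Q.option_fun_integrable[OF XT sq])
  have cf: "emp_cf Of u = levy_cf T \<gamma> k (of_real u - \<i>)" for u
    unfolding Of_def levy_cf_shifted[OF k X T] by (rule Q.emp_cf_option_fun[OF XT sq mart])
  define G where "G t = (LINT \<omega>|Q. call_slope (X T \<omega>) t) + min (exp t - 1) 0" for t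
  have G: "-1 \<le> G t" "G t \<le> 4" for t
  proof -
    have i: "integrable Q (\<lambda>\<omega>. call_slope (X T \<omega>) t)"
    proof (rule Bochner_Integration.integrable_bound)
      show "integrable Q (\<lambda>\<omega>. 4 * exp (X T \<omega>))" using ei by simp
      show "(\<lambda>\<omega>. call_slope (X T \<omega>) t) \<in> borel_measurable Q" unfolding call_slope_def by measurable
    qed (use call_slope_bounds in \<open>auto intro!: AE_I2\<close>)
    have "0 \<le> (LINT \<omega>|Q. call_slope (X T \<omega>) t)" using call_slope_bounds by simp
    moreover have "-1 \<le> min (exp t - 1) 0" by simp
    ultimately show "-1 \<le> G t" unfolding G_def by linarith
    have "(LINT \<omega>|Q. call_slope (X T \<omega>) t) \<le> (LINT \<omega>|Q. 4 * exp (X T \<omega>))"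
      using i ei call_slope_bounds by (intro integral_mono) auto
    also have "\<dots> = 4" using mart by simp
    finally show "G t \<le> 4" unfolding G_def by simp
  qed
  have Om: "Of \<in> borel_measurable borel" unfolding Of_def by (rule Q.option_fun_measurable[OF XT sq])
  have On: "0 \<le> Of y" for y unfolding Of_def by (rule Q.option_fun_nonneg[OF XT sq])
  have Ol: "Of y \<le> B * exp (- \<bar>y\<bar>)" for y unfolding Of_def B_def by (rule Q.option_fun_le[OF XT sq])
  have cell: "\<bar>lin_interp (\<lambda>x. Of x - min x 0) a b p - (Of p - min p 0)\<bar> \<le> (G b - G a) * (b - a)"
    if "a < b" "b \<le> a + 1" "p \<in> {a..b}" for a b p
    unfolding Of_def G_def by (rule Q.interpolation_error_cell[OF XT ei mart that])
  have E1: "integrable lborel (\<lambda>y. interpolant N x (\<lambda>j. Of (x j)) y - Of y)"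
    by (rule interpolation_error(1)[OF D mesh1 Om On Ol B cell G])
  have E: "(LINT y|lborel. \<bar>interpolant N x (\<lambda>j. Of (x j)) y - Of y\<bar>) \<le> 5 * (mesh N x)\<^sup>2 + (2 + 6 * B) * exp (- range_param N x)"
    by (rule interpolation_error(2)[OF D mesh1 Om On Ol B cell G])
  have "(2 + 6 * B) * exp (- range_param N x) \<le> (2 + 6 * B) * (C\<^sub>A * d\<^sup>2)"
    using rp B by (intro mult_left_mono) (auto simp: d_def)
  then have E2: "(LINT y|lborel. \<bar>interpolant N x (\<lambda>j. Of (x j)) y - Of y\<bar>) \<le> K0 * d\<^sup>2"
    using E by (simp add: K0_def B_def[symmetric] d_def algebra_simps)
  \<comment> \<open>Solves 2 U^2 z = t c0 U^(-T \<alpha>bar) / 2.\<close>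
  define z where "z = t * c0 * U powr (- T * \<alpha>bar) / (4 * U\<^sup>2)"
  have z: "0 < z" using t c0 U1 by (simp add: z_def)
  obtain A where A: "A \<in> sets M" "measure M A \<le> 39 * C1 * U * real N ^ 2 * exp (- C2 * min 1 (1 / (64 * C\<^sub>\<delta>)) * (z / \<epsilon>)\<^sup>2)"
    and good: "\<And>\<omega> u. \<omega> \<in> space M - A \<Longrightarrow> u\<in>{-U..U} \<Longrightarrow> cmod (\<Sum>j=1..N. of_real (\<delta> j * e j \<omega>) * fourier (hat_fun x j) u) < z"
    using stochastic_sup_bound[OF nm sg C(1-3) D \<epsilon> l2 U1 z] by blast
  have zeq: "(z / \<epsilon>)\<^sup>2 = c0\<^sup>2 / 16 * t\<^sup>2 * U ^ (2 * s - 3)"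
  proof -
    have "(U powr (- T * \<alpha>bar) / U\<^sup>2)\<^sup>2 = U powr (- 2 * T * \<alpha>bar - 4)"
    proof -
      have "(U powr (- T * \<alpha>bar))\<^sup>2 = U powr (- T * \<alpha>bar + - T * \<alpha>bar)"
        unfolding power2_eq_square by (rule powr_add[symmetric])
      moreover have "(U\<^sup>2)\<^sup>2 = U powr 4" using U1 by (simp add: power_mult[symmetric])
      ultimately have "(U powr (- T * \<alpha>bar) / U\<^sup>2)\<^sup>2 = U powr ((- T * \<alpha>bar + - T * \<alpha>bar) - 4)"
        by (simp only: power_divide powr_diff)
      moreover have "(- T * \<alpha>bar + - T * \<alpha>bar) - 4 = - 2 * T * \<alpha>bar - 4" by simp
      ultimately show ?thesis by (simp only:)
    qed
    moreover have "(z / \<epsilon>)\<^sup>2 = c0\<^sup>2 / 16 * t\<^sup>2 * ((1 / \<epsilon>)\<^sup>2 * (U powr (- T * \<alpha>bar) / U\<^sup>2)\<^sup>2)"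
      by (simp add: z_def power_mult_distrib power_divide mult_ac)
    ultimately show ?thesis using cp(5) by simp
  qed
  have err: "cmod (emp_cf (interpolant N x (observation Of x \<delta> e \<omega>)) u - levy_cf T \<gamma> k (of_real u - \<i>))
      \<le> t * cmod (levy_cf T \<gamma> k (of_real u - \<i>))" if \<omega>: "\<omega> \<in> space M - A" and u: "u \<in> {-U..U}" for \<omega> u
  proof -
    have "cmod (emp_cf (interpolant N x (observation Of x \<delta> e \<omega>)) u - emp_cf Of u) \<le> 2 * U\<^sup>2 * (K0 * d\<^sup>2 + z)"
      by (rule emp_cf_error[where e = e and \<omega> = \<omega>, OF D mesh1 Of E1 E2 less_imp_le[OF good[OF \<omega> u]] U1 u])
    also have "\<dots> = 2 * K0 * (U\<^sup>2 * d\<^sup>2) + t * c0 * U powr (- T * \<alpha>bar) / 2"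
      using U1 by (simp add: z_def field_simps)
    also have "2 * K0 * (U\<^sup>2 * d\<^sup>2) \<le> t * c0 * U powr (- T * \<alpha>bar) / 2"
    proof -
      have d0: "0 \<le> d" "d powr (3/2) \<le> \<epsilon>" using nl(1) mesh_pos[OF D] by (auto simp: d_def)
      have UU: "U powr (2 + T * \<alpha>bar) * U powr (- T * \<alpha>bar) = U\<^sup>2"
        using U1 by (simp add: powr_add[symmetric])
      have "4 * K0 / c0 * (d\<^sup>2 * U powr (2 + T * \<alpha>bar)) \<le> 4 * K0 / c0 * (1 / U ^ (s - 1))"
        using cp(6)[OF d0] K0 c0 by (intro mult_left_mono) auto
      also have "\<dots> \<le> t" using t by simp
      finally have "4 * K0 / c0 * (d\<^sup>2 * U powr (2 + T * \<alpha>bar)) * (c0 * U powr (- T * \<alpha>bar)) \<le> t * (c0 * U powr (- T * \<alpha>bar))"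
        using c0 by (intro mult_right_mono) auto
      moreover have "4 * K0 / c0 * (d\<^sup>2 * U powr (2 + T * \<alpha>bar)) * (c0 * U powr (- T * \<alpha>bar)) = 4 * K0 * (d\<^sup>2 * U\<^sup>2)"
        unfolding UU[symmetric] using c0 by simp
      ultimately show ?thesis by (simp add: mult_ac)
    qed
    also have "t * c0 * U powr (- T * \<alpha>bar) / 2 + t * c0 * U powr (- T * \<alpha>bar) / 2 = t * (c0 * U powr (- T * \<alpha>bar))" by simp
    also have "\<dots> \<le> t * cmod (levy_cf T \<gamma> k (of_real u - \<i>))"
      using trim_bounds(2,3)[OF k X T R a tc U1 u, folded c0_def] t by (intro mult_left_mono) auto
    finally show ?thesis unfolding cf by simp
  qed
  have ex: "- C2 * min 1 (1 / (64 * C\<^sub>\<delta>)) * (z / \<epsilon>)\<^sup>2 = - (C2 * min 1 (1 / (64 * C\<^sub>\<delta>)) * c0\<^sup>2 / 16 * t\<^sup>2 * U ^ (2 * s - 3))"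
    unfolding zeq by simp
  show ?thesis
    using A err unfolding ex Of_def by (intro bexI[of _ A] conjI ballI) auto
qed

theorem proposition4p2:
  fixes T R \<alpha>bar \<gamma> C\<^sub>\<phi> C\<^sub>A C\<^sub>\<delta> C1 C2 :: real
    and s :: nat
    and k :: "real \<Rightarrow> real"
    and Q :: "'b measure" and X :: "real \<Rightarrow> 'b \<Rightarrow> real"
    and M :: "'a measure" and e :: "nat \<Rightarrow> 'a \<Rightarrow> real"
    and w :: "real \<Rightarrow> real \<Rightarrow> real"
  assumes "0 < T" and "0 < R" and "2 \<le> s" and "0 < \<alpha>bar"
    and "(\<gamma>, k) \<in> class_Gs s T R \<alpha>bar"
    and "levy_process Q X \<gamma> k"
    and "noise_model M e"
    and "0 < C1" and "0 < C2" and "uniformly_subgaussian M e C1 C2"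
    and "trim_constant T R \<alpha>bar C\<^sub>\<phi>"
    and "weight_family s w"
    and "0 < C\<^sub>A" and "0 < C\<^sub>\<delta>"
  shows "\<exists>c>0. \<exists>b\<^sub>1>0. \<exists>b\<^sub>2>0. \<forall>\<kappa>>0. \<exists>\<epsilon>\<^sub>0.
    b\<^sub>1 * \<kappa> powr ((2 * real s + 2 * T * \<alpha>bar + 1) / (2 * real s - 2)) \<le> \<epsilon>\<^sub>0 \<and>
    \<epsilon>\<^sub>0 \<le> b\<^sub>2 * \<kappa> powr ((2 * real s + 2 * T * \<alpha>bar + 1) / (2 * real s - 2)) \<and>
    (\<forall>N x \<delta> \<epsilon>.
       design N x \<delta> \<longrightarrow>
       exp (- range_param N x) \<le> C\<^sub>A * (mesh N x)\<^sup>2 \<longrightarrow>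
       mesh N x * (l2_norm N \<delta>)\<^sup>2 \<le> C\<^sub>\<delta> * (linf_norm N \<delta>)\<^sup>2 \<longrightarrow>
       \<epsilon> = noise_level N x \<delta> \<longrightarrow>
       \<epsilon> < min \<epsilon>\<^sub>0 1 \<longrightarrow>
       measure M {\<omega> \<in> space M.
           \<bar>alpha_est T R \<alpha>bar C\<^sub>\<phi> w (cutoff s T \<alpha>bar \<epsilon>)
              (interpolant N x (observation (option_fun Q (X T)) x \<delta> e \<omega>))
            - jump_sum k\<bar> \<ge> \<kappa>}
         \<le> ((7 * real N + 1) * C1 + 2) *
            exp (- c * min (\<kappa>\<^sup>2) (\<kappa> powr (1/2)) *
                 \<epsilon> powr (- (real s - 1) / (2 * real s + 2 * T * \<alpha>bar + 1))))"
proof -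
  note T = assms(1) and R = assms(2) and s = assms(3) and a = assms(4) and k = assms(5) and X = assms(6)
    and nm = assms(7) and C12 = assms(8,9) and sg = assms(10) and tc = assms(11) and w = assms(12)
    and CA = assms(13) and C\<delta> = assms(14)
  interpret M: prob_space M using nm by (simp add: noise_model_def)
  obtain B where B: "0 \<le> B"
    "\<And>U. 1 \<le> U \<Longrightarrow> \<bar>(LINT u:{-U..U}|lborel. re_exponent k u * w U u) - jump_sum k\<bar> \<le> B / U ^ (s - 1)"
    using weight_bias[OF k s w] by blast
  obtain Cw where Cw: "\<And>U u. 0 < U \<Longrightarrow> \<bar>w U u\<bar> \<le> Cw * (\<bar>u\<bar> ^ (s - 1) / U ^ s)"
    using w unfolding weight_family_def by blast
  have Cw0: "0 \<le> Cw" using Cw[of 1 1] order_trans[OF abs_ge_zero] by auto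
  have wm: "w U \<in> borel_measurable borel" if "0 < U" for U using w that by (simp add: weight_family_def)
  define c0 where "c0 = min (exp (- T * R)) C\<^sub>\<phi>"
  define K0 where "K0 = 5 + (2 + 6 * (1 + (LINT \<omega>|Q. exp (2 * X T \<omega>)))) * C\<^sub>A"
  define c1 where "c1 = C2 * min 1 (1 / (64 * C\<^sub>\<delta>)) * c0\<^sup>2 / 16"
  define V where "V = \<alpha>bar + B + 2 * Cw / T * (\<bar>ln (c0 / 3)\<bar> + T * \<alpha>bar + 1)"
  define p where "p = 2 * real s + 2 * T * \<alpha>bar + 1"
  have c0: "0 < c0" using tc by (auto simp: c0_def trim_constant_def)
  have K0: "0 < K0" unfolding K0_def using CA by (intro add_pos_nonneg mult_nonneg_nonneg) (auto simp: add_nonneg_nonneg)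
  have c1: "0 < c1" using C12 c0 C\<delta> by (simp add: c1_def)
  have V: "0 < V"
  proof -
    have "0 \<le> 2 * Cw / T * (\<bar>ln (c0 / 3)\<bar> + T * \<alpha>bar + 1)" using Cw0 T a by (intro mult_nonneg_nonneg) auto
    then show ?thesis using B a by (simp add: V_def)
  qed
  \<comment> \<open>The extra 1 makes the constant positive even if Cw = 0 and turns the bound on
    the error into a strict inequality.\<close>
  have K5: "0 < 4 * Cw / T + 1" using Cw0 T by (intro add_nonneg_pos) auto
  have K1: "0 < 4 * K0 / c0" using K0 c0 by simp
  have K6: "0 < 39 * C1" using C12 by simp
  obtain c b where c: "0 < c" and b: "0 < b"
    and tail: "\<And>\<kappa> U N P. 0 < \<kappa> \<Longrightarrow> 1 \<le> U \<Longrightarrow> 1 \<le> N \<Longrightarrow> P \<le> 1 \<Longrightarrow> 1 / U ^ (s - 1) < b * \<kappa> \<Longrightarrow>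
    (\<And>t. 0 < t \<Longrightarrow> t \<le> 1 / 2 \<Longrightarrow> 4 * K0 / c0 / U ^ (s - 1) \<le> t \<Longrightarrow> B / U ^ (s - 1) + (4 * Cw / T + 1) * t < \<kappa> \<Longrightarrow>
       P \<le> 39 * C1 * U * N ^ 2 * exp (- (c1 * t\<^sup>2 * U ^ (2 * s - 3)))) \<Longrightarrow>
    (\<And>t. 4 * K0 / c0 \<le> t \<Longrightarrow> V * (1 + ln U + ln (1 + t)) < \<kappa> \<Longrightarrow>
       P \<le> 39 * C1 * U * N ^ 2 * exp (- (c1 * t\<^sup>2 * U ^ (2 * s - 3)))) \<Longrightarrow>
    P \<le> ((7 * N + 1) * C1 + 2) * exp (- c * (min (\<kappa>\<^sup>2) (\<kappa> powr (1/2)) * U powr ((real s - 1) / 2)))"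
    using combined_tail_bound[OF s K1 B(1) K5 V c1 C12(1) K6] by blast
  \<comment> \<open>1 / U^(s-1) = \<epsilon>^(1/r), so \<epsilon> < (b \<kappa>)^r is the condition
    1 / U^(s-1) < b \<kappa> of the tail bound; hence the power of \<kappa> in the threshold for
    \<epsilon>.\<close>
  define r where "r = p / (2 * real s - 2)"
  have Ta: "0 < T * \<alpha>bar" using T a by simp
  have s': "2 \<le> real s" using s by simp
  have p0: "0 < p" using s' Ta by (simp add: p_def mult.assoc)
  have r: "0 < r" "r * ((2 * real s - 2) / p) = 1" using p0 s' by (auto simp: r_def)
  have main: "measure M {\<omega> \<in> space M.
           \<bar>alpha_est T R \<alpha>bar C\<^sub>\<phi> w (cutoff s T \<alpha>bar \<epsilon>)
              (interpolant N x (observation (option_fun Q (X T)) x \<delta> e \<omega>))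
            - jump_sum k\<bar> \<ge> \<kappa>}
         \<le> ((7 * real N + 1) * C1 + 2) *
            exp (- c * min (\<kappa>\<^sup>2) (\<kappa> powr (1/2)) * \<epsilon> powr (- (real s - 1) / p))"
    if \<kappa>: "0 < \<kappa>" and D: "design N x \<delta>" and rp: "exp (- range_param N x) \<le> C\<^sub>A * (mesh N x)\<^sup>2"
      and l2: "mesh N x * (l2_norm N \<delta>)\<^sup>2 \<le> C\<^sub>\<delta> * (linf_norm N \<delta>)\<^sup>2"
      and \<epsilon>: "\<epsilon> = noise_level N x \<delta>" "\<epsilon> < b powr r * \<kappa> powr r" "\<epsilon> < 1"
    for \<kappa> N x \<delta> \<epsilon>
  proof -
    define U where "U = cutoff s T \<alpha>bar \<epsilon>"
    define f where "f \<omega> = interpolant N x (observation (option_fun Q (X T)) x \<delta> e \<omega>)" for \<omega>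
    define S where "S = {\<omega> \<in> space M. \<bar>alpha_est T R \<alpha>bar C\<^sub>\<phi> w U (f \<omega>) - jump_sum k\<bar> \<ge> \<kappa>}"
    have \<epsilon>0: "0 < \<epsilon>" using noise_level_mesh(2)[OF D] \<epsilon>(1) by simp
    note cp = cutoff_powr[OF \<epsilon>0 \<epsilon>(3) s Ta, folded U_def p_def]
    have U1: "1 \<le> U" by (rule cp(1))
    have N1: "1 \<le> real N" using D by (simp add: design_def)
    have fm: "f \<omega> \<in> borel_measurable borel" for \<omega> unfolding f_def by (rule interpolant_measurable[OF D])
    have q: "1 / U ^ (s - 1) < b * \<kappa>"
    proof -
      have "\<epsilon> powr ((2 * real s - 2) / p) < ((b * \<kappa>) powr r) powr ((2 * real s - 2) / p)"
        using \<epsilon> \<epsilon>0 b \<kappa> s' p0 by (intro powr_less_mono2) (auto simp: powr_mult)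
      also have "\<dots> = b * \<kappa>" unfolding powr_powr r(2) using b \<kappa> by simp
      finally show ?thesis unfolding cp(3) .
    qed
    \<comment> \<open>Monotonicity asks for measurability of the covering set \<open>A\<close> only;
      nothing is claimed about measurability of the deviation event \<open>S\<close>.\<close>
    have subset_bound: "measure M S \<le> measure M A" if "A \<in> sets M" "S \<subseteq> A" for A
      using that M.finite_measure_mono[of S A] by blast
    have P1: "measure M S \<le> 39 * C1 * U * real N ^ 2 * exp (- (c1 * t\<^sup>2 * U ^ (2 * s - 3)))"
      if t: "0 < t" "4 * K0 / c0 / U ^ (s - 1) \<le> t"
        and small: "\<And>\<omega>. (\<And>u. u \<in> {-U..U} \<Longrightarrow> cmod (emp_cf (f \<omega>) u - levy_cf T \<gamma> k (of_real u - \<i>)) \<le> t * cmod (levy_cf T \<gamma> k (of_real u - \<i>))) \<Longrightarrow>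
          \<bar>alpha_est T R \<alpha>bar C\<^sub>\<phi> w U (f \<omega>) - jump_sum k\<bar> < \<kappa>" for t
    proof -
      obtain A where A: "A \<in> sets M" "measure M A \<le> 39 * C1 * U * real N ^ 2 * exp (- (c1 * t\<^sup>2 * U ^ (2 * s - 3)))"
        "\<And>\<omega> u. \<omega> \<in> space M - A \<Longrightarrow> u \<in> {-U..U} \<Longrightarrow>
          cmod (emp_cf (f \<omega>) u - levy_cf T \<gamma> k (of_real u - \<i>)) \<le> t * cmod (levy_cf T \<gamma> k (of_real u - \<i>))"
        using uniform_cf_error[OF T R s a k X nm sg C12 C\<delta> CA tc D rp l2 \<epsilon>(1,3), folded U_def c0_def K0_def, OF t, folded c1_def f_def]
        by blast
      have "S \<subseteq> A"
      proof
        fix \<omega> assume "\<omega> \<in> S"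
        then have \<omega>: "\<omega> \<in> space M" "\<kappa> \<le> \<bar>alpha_est T R \<alpha>bar C\<^sub>\<phi> w U (f \<omega>) - jump_sum k\<bar>" by (auto simp: S_def)
        show "\<omega> \<in> A"
        proof (rule ccontr)
          assume "\<omega> \<notin> A"
          then have "\<bar>alpha_est T R \<alpha>bar C\<^sub>\<phi> w U (f \<omega>) - jump_sum k\<bar> < \<kappa>" using \<omega>(1) by (intro small A(3)) auto
          then show False using \<omega>(2) by simp
        qed
      qed
      from subset_bound[OF A(1) this] A(2) show ?thesis by simp
    qed
    have "measure M S \<le> ((7 * real N + 1) * C1 + 2) * exp (- c * (min (\<kappa>\<^sup>2) (\<kappa> powr (1/2)) * U powr ((real s - 1) / 2)))"
    proof (rule tail[OF \<kappa> U1 N1 M.prob_le_1 q])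
      fix t assume t: "0 < t" "t \<le> 1 / 2" "4 * K0 / c0 / U ^ (s - 1) \<le> t" "B / U ^ (s - 1) + (4 * Cw / T + 1) * t < \<kappa>"
      show "measure M S \<le> 39 * C1 * U * real N ^ 2 * exp (- (c1 * t\<^sup>2 * U ^ (2 * s - 3)))"
      proof (rule P1[OF t(1,3)])
        fix \<omega> assume d: "\<And>u. u \<in> {-U..U} \<Longrightarrow> cmod (emp_cf (f \<omega>) u - levy_cf T \<gamma> k (of_real u - \<i>)) \<le> t * cmod (levy_cf T \<gamma> k (of_real u - \<i>))"
        have "\<bar>alpha_est T R \<alpha>bar C\<^sub>\<phi> w U (f \<omega>) - jump_sum k\<bar> \<le> B / U ^ (s - 1) + 4 * Cw / T * t"
          by (rule alpha_est_error_small[OF k X T R a tc s Cw0 Cw wm B(2) U1 fm t(2) d])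
        then show "\<bar>alpha_est T R \<alpha>bar C\<^sub>\<phi> w U (f \<omega>) - jump_sum k\<bar> < \<kappa>"
          using t(1,4) unfolding distrib_right by linarith
      qed
    next
      fix t assume t: "4 * K0 / c0 \<le> t" "V * (1 + ln U + ln (1 + t)) < \<kappa>"
      have t0: "0 < t" using t(1) K1 by linarith
      have "4 * K0 / c0 / U ^ (s - 1) \<le> 4 * K0 / c0 / 1" using K1 U1 by (intro divide_left_mono) auto
      then have tq: "4 * K0 / c0 / U ^ (s - 1) \<le> t" using t(1) by linarith
      show "measure M S \<le> 39 * C1 * U * real N ^ 2 * exp (- (c1 * t\<^sup>2 * U ^ (2 * s - 3)))"
      proof (rule P1[OF t0 tq])
        fix \<omega> assume d: "\<And>u. u \<in> {-U..U} \<Longrightarrow> cmod (emp_cf (f \<omega>) u - levy_cf T \<gamma> k (of_real u - \<i>)) \<le> t * cmod (levy_cf T \<gamma> k (of_real u - \<i>))"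
        have "\<bar>alpha_est T R \<alpha>bar C\<^sub>\<phi> w U (f \<omega>) - jump_sum k\<bar> \<le> V * (1 + ln U + ln (1 + t))"
          unfolding V_def c0_def
          by (rule alpha_est_error_large[OF k X T R a tc s Cw0 Cw wm B(2) U1 fm less_imp_le[OF t0] B(1) d])
        then show "\<bar>alpha_est T R \<alpha>bar C\<^sub>\<phi> w U (f \<omega>) - jump_sum k\<bar> < \<kappa>" using t(2) by linarith
      qed
    qed
    then show ?thesis unfolding S_def f_def U_def cp(4)[unfolded U_def] by (simp add: mult.assoc)
  qed
  show ?thesis
  \<comment> \<open>The threshold is an exact multiple of the power of \<kappa>, so
    \<open>b powr r\<close> serves both as \<open>b\<^sub>1\<close> and as
    \<open>b\<^sub>2\<close>.\<close>
  proof (rule exI[of _ c], intro conjI c, rule exI[of _ "b powr r"], intro conjI, goal_cases)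
    case 2
    show ?case
    proof (rule exI[of _ "b powr r"], intro conjI allI impI, goal_cases)
      case (2 \<kappa>)
      show ?case
        by (rule exI[of _ "b powr r * \<kappa> powr r"]) (use main[OF 2] in \<open>auto simp: r_def p_def\<close>)
    qed (use b in simp)
  qed (use b in simp)
qed

end
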